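(* Consider the Distributed Tracking problem with $k$ players and threshold $N$ under the multinomial arrival model with unknown probabilities $\mu_1,\dots,\mu_k$, and let $\delta\in(0,1)$. With probability at least $1-\delta$, the communication cost of the algorithm $\mathit{StcSlk\text{-}LrnDst}$ (respectively, of the algorithm $\mathit{DynSlk\text{-}LrnDst}$), described in the context, is bounded by $O\!\left(k\log\log\frac{N}{k\ln\frac{k}{\delta}}+k\log\log\frac{k}{\delta}\right)$.
   Context: Distributed Tracking (DT) problem: a coordinator and $k$ players, each connected to the coordinator by a two-way channel. The coordinator holds a positive integer threshold $N$; player $i\in[k]$ holds a counter $n_i$, initially $0$. Items arrive one at a time; each arriving item increments exactly one player's counter. The coordinator must raise an alarm at exactly the moment the $N$-th item arrives. The communication cost is the total number of messages sent or received by the coordinator, each carrying $O(1)$ words. Multinomial arrival model: independently for each item, the item arrives at player $i$ with probability $\mu_i$, $\mu_i\ge0$, $\sum_i\mu_i=1$; the $\mu_i$ are not known to the algorithm. $\ln$ is the natural logarithm. Straightforward algorithm: each player sends a message for every counter increment. CMY algorithm (in rounds with current threshold $N$): if $N<4k$ run the straightforward algorithm; otherwise send slack $s=\lfloor N/(2k)\rfloor$ to all players, each player notifies whenever its counter has increased by $s$ since its last communication, and on the $k$-th notification the coordinator collects all counters, sets $N\leftarrow N-\sum_in_i$, raises the alarm if $N=0$, else starts a new round. Learning algorithms: the first round is one round of the CMY algorithm; let $w$ be the number of items tracked in it and $n_i$ the counter of player $i$ at its end; set $\bar\mu_i=n_i/w$ and $\hat\mu_i=\bar\mu_i+\sqrt{\frac{2(\bar\mu_i-\bar\mu_i^2)\ln\frac3\delta}{w}}+\frac{3\ln\frac3\delta}{w}$,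 and $\hat\Sigma=\sum_{i=1}^k\hat\mu_i$. Every subsequent round, with current threshold $N$, resets the counters to $0$ and: if $N\le4k$ runs the straightforward algorithm until termination; else if $N\le\beta k\ln\frac{k}{\delta}$ with $\beta=2(2\sqrt2+\frac23+3)^2$ runs the CMY algorithm until termination; otherwise sets $t=N/\hat\Sigma-(\sqrt2+\frac23)\sqrt{k(N/\hat\Sigma)\ln\frac{k}{\delta}}$ and — in $\mathit{StcSlk\text{-}LrnDst}$: the coordinator sends to player $i$ the slack $s_i=UB_i=\hat\mu_it+\sqrt{2t\hat\mu_i\ln\frac{k}{\delta}}+\frac23\ln\frac{k}{\delta}$, player $i$ notifies when $n_i$ reaches $s_i$, and the round ends at the first notification; — in $\mathit{DynSlk\text{-}LrnDst}$: the coordinator sends to player $i$ the pair $(b_i,s_i)$ with $b_i=\hat\mu_it$ and $s_i=\lfloor\frac{N-t}{2k}\rfloor$, player $i$ sends its $j$-th notification when $n_i$ reaches $b_i+js_i$ ($j=1,2,\dots$), and the round ends at the $k$-th notification. At the end of such a round the coordinator collects all counters, sets $N\leftarrow N-\sum_in_i$, raises the alarm and terminates if $N=0$, and otherwise starts a new round. *)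

theory Defs
  imports "HOL-Probability.Probability"
begin

text \<open>
  Players are \<open>0, \<dots>, k - 1\<close>. A round is either the straightforward algorithm, or a
  threshold round \<open>Threshold thr q\<close>: player \<open>i\<close> sends its \<open>j\<close>-th notification
  (\<open>j = 1, 2, \<dots>\<close>) when its counter reaches \<open>thr i j\<close>, and the round ends at the \<open>q\<close>-th
  notification received by the coordinator. Counters are reset at the start of every round.
\<close>

datatype round = Straightforward | Threshold "nat \<Rightarrow> nat \<Rightarrow> real" nat | Terminated

definition straightforward_or_cmy :: "nat \<Rightarrow> nat \<Rightarrow> round" where
  "straightforward_or_cmy k N =
     (if N < 4 * k then Straightforward
      else Threshold (\<lambda>i j. real (j * (N div (2 * k)))) k)"

definition mu_hat :: "real \<Rightarrow> nat \<Rightarrow> (nat \<Rightarrow> nat) \<Rightarrow> nat \<Rightarrow> real" where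
  "mu_hat \<delta> w n i =
     (let m = real (n i) / real w
      in m + sqrt (2 * (m - m\<^sup>2) * ln (3 / \<delta>) / real w) + 3 * ln (3 / \<delta>) / real w)"

definition lrn_t :: "nat \<Rightarrow> real \<Rightarrow> (nat \<Rightarrow> real) \<Rightarrow> nat \<Rightarrow> real" where
  "lrn_t k \<delta> \<mu>h N =
     (let x = real N / (\<Sum>i<k. \<mu>h i)
      in x - (sqrt 2 + 2 / 3) * sqrt (real k * x * ln (real k / \<delta>)))"

definition upper_bound :: "nat \<Rightarrow> real \<Rightarrow> (nat \<Rightarrow> real) \<Rightarrow> nat \<Rightarrow> nat \<Rightarrow> real" where
  "upper_bound k \<delta> \<mu>h N i =
     (let t = lrn_t k \<delta> \<mu>h N
      in \<mu>h i * t + sqrt (2 * t * \<mu>h i * ln (real k / \<delta>)) + 2 / 3 * ln (real k / \<delta>))"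

datatype algorithm = StcSlk_LrnDst | DynSlk_LrnDst

text \<open>In a static round only the first notification of a player can occur, so \<open>thr i j\<close>
  is relevant for \<open>j = 1\<close> only.\<close>

fun learned_round :: "algorithm \<Rightarrow> nat \<Rightarrow> real \<Rightarrow> (nat \<Rightarrow> real) \<Rightarrow> nat \<Rightarrow> round" where
  "learned_round StcSlk_LrnDst k \<delta> \<mu>h N = Threshold (\<lambda>i j. upper_bound k \<delta> \<mu>h N i) 1"
| "learned_round DynSlk_LrnDst k \<delta> \<mu>h N =
     (let t = lrn_t k \<delta> \<mu>h N;
          s = \<lfloor>(real N - t) / (2 * real k)\<rfloor>
      in Threshold (\<lambda>i j. \<mu>h i * t + real j * real_of_int s) k)"

definition lrn_beta :: real where
  "lrn_beta = 2 * (2 * sqrt 2 + 2 / 3 + 3)\<^sup>2"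

text \<open>\<open>Learned \<mu>h\<close> is every phase after the first round, with \<open>\<mu>h\<close> the estimates obtained
  in the first round; \<open>CMY\<close> means that the CMY algorithm is run until termination.\<close>

datatype phase = First_Round | Learned "nat \<Rightarrow> real" | CMY

fun next_round :: "algorithm \<Rightarrow> nat \<Rightarrow> real \<Rightarrow> phase \<Rightarrow> nat \<Rightarrow> phase \<times> round" where
  "next_round A k \<delta> First_Round N = (First_Round, straightforward_or_cmy k N)"
| "next_round A k \<delta> CMY N = (CMY, straightforward_or_cmy k N)"
| "next_round A k \<delta> (Learned \<mu>h) N =
     (if N \<le> 4 * k then (Learned \<mu>h, Straightforward)
      else if real N \<le> lrn_beta * real k * ln (real k / \<delta>)
        then (CMY, straightforward_or_cmy k N)
      else (Learned \<mu>h, learned_round A k \<delta> \<mu>h N))"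

record state =
  st_phase :: phase
  st_round :: round
  threshold :: nat
  counter :: "nat \<Rightarrow> nat"
  messages :: nat

text \<open>Starting any round, including the straightforward algorithm, costs one message to each
  player: it carries the parameters of the round (an \<open>O(1)\<close>-word message).\<close>

definition start_round ::
  "algorithm \<Rightarrow> nat \<Rightarrow> real \<Rightarrow> phase \<Rightarrow> nat \<Rightarrow> nat \<Rightarrow> state" where
  "start_round A k \<delta> ph N msgs =
     \<lparr>st_phase = fst (next_round A k \<delta> ph N), st_round = snd (next_round A k \<delta> ph N),
      threshold = N, counter = (\<lambda>_. 0), messages = msgs + k\<rparr>"

text \<open>At the end of a threshold round the coordinator collects all counters (\<open>k\<close> requests and
  \<open>k\<close> replies). The subtraction \<open>threshold st - w\<close> is truncated, i.e. the
  coordinator also stops if it discovers that more than \<open>N\<close> items have arrived: the thresholds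
  of a dynamic round do not rule this out.\<close>

definition end_round :: "algorithm \<Rightarrow> nat \<Rightarrow> real \<Rightarrow> state \<Rightarrow> state" where
  "end_round A k \<delta> st =
     (let w = (\<Sum>i<k. counter st i);
          N' = threshold st - w;
          ph = (if st_phase st = First_Round then Learned (mu_hat \<delta> w (counter st))
                else st_phase st);
          msgs = messages st + 2 * k
      in if N' = 0 then st\<lparr>st_round := Terminated, messages := msgs\<rparr>
         else start_round A k \<delta> ph N' msgs)"

text \<open>The number of notifications sent so far. Capping \<open>j\<close> at \<open>q\<close> is harmless, since the
  round ends at the \<open>q\<close>-th notification, and keeps the set finite also if the slack is \<open>0\<close>.\<close>

definition notifications ::
  "nat \<Rightarrow> (nat \<Rightarrow> nat \<Rightarrow> real) \<Rightarrow> nat \<Rightarrow> (nat \<Rightarrow> nat) \<Rightarrow> nat" where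
  "notifications k thr q n = (\<Sum>i<k. card {j \<in> {1..q}. thr i j \<le> real (n i)})"

definition step :: "algorithm \<Rightarrow> nat \<Rightarrow> real \<Rightarrow> nat \<Rightarrow> state \<Rightarrow> state" where
  "step A k \<delta> i st =
     (let n = counter st; n' = n(i := n i + 1) in
      case st_round st of
        Terminated \<Rightarrow> st
      | Straightforward \<Rightarrow>
          st\<lparr>counter := n', messages := messages st + 1,
             st_round := (if (\<Sum>j<k. n' j) \<ge> threshold st then Terminated else Straightforward)\<rparr>
      | Threshold thr q \<Rightarrow>
          let st' = st\<lparr>counter := n',
                messages := messages st + (notifications k thr q n' - notifications k thr q n)\<rparr>
          in if notifications k thr q n' \<ge> q then end_round A k \<delta> st' else st')"

text \<open>\<open>\<omega> m\<close> is the player at which the \<open>m\<close>-th item (counted from \<open>0\<close>) arrives.\<close>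

primrec run :: "algorithm \<Rightarrow> nat \<Rightarrow> real \<Rightarrow> nat \<Rightarrow> (nat \<Rightarrow> nat) \<Rightarrow> nat \<Rightarrow> state" where
  "run A k \<delta> N \<omega> 0 = start_round A k \<delta> First_Round N 0"
| "run A k \<delta> N \<omega> (Suc m) = step A k \<delta> (\<omega> m) (run A k \<delta> N \<omega> m)"

definition comm_cost :: "algorithm \<Rightarrow> nat \<Rightarrow> real \<Rightarrow> nat \<Rightarrow> (nat \<Rightarrow> nat) \<Rightarrow> ereal" where
  "comm_cost A k \<delta> N \<omega> = (SUP m. ereal (real (messages (run A k \<delta> N \<omega> m))))"

text \<open>Multinomial arrivals: the items arrive independently, each at player \<open>i\<close> with
  probability \<open>\<mu>\<^sub>i = pmf p i\<close>.\<close>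

definition multinomial_arrivals :: "nat pmf \<Rightarrow> (nat \<Rightarrow> nat) measure" where
  "multinomial_arrivals p = (\<Pi>\<^sub>M m\<in>(UNIV :: nat set). measure_pmf p)"

text \<open>Iterated logarithm with the usual convention for \<open>O\<close>-bounds that it is at least \<open>1\<close>;
  otherwise \<open>ln (ln x)\<close> can be negative or undefined for small \<open>x\<close>.\<close>

definition loglog :: "real \<Rightarrow> real" where
  "loglog x = ln (ln (max x (exp (exp 1))))"

end

(*
  Every round costs at most 5k messages, so the number of rounds has to be bounded. From a threshold
  N far below the initial one, a learned round that tracks its t items leaves about
  sqrt (k N ln (k / \<delta>)) items, and O(log log) such successes lead to the CMY phase, whose length is
  deterministic. As long as N is close to the initial threshold, the estimates are too crude for
  this, but then a round still shrinks N by a constant factor, and O(log log (k / \<delta>)) of those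
  suffice. A round fails with conditional probability at most 0.99 \<delta>. A union bound over the rounds
  is not available, so failures are tolerated: the number of rounds used and the number of
  successes still needed enter the exponent of a potential that, arrival by arrival, is a
  supermartingale, with binomial tails as the failure probability of the current round. Ville's
  inequality for this potential gives the exact probability 1 - \<delta>.
*)
theory Submission
  imports Defs
begin

text \<open>The constant of the theorem is absolute while \<open>\<delta>\<close> may be arbitrarily
  close to 1, so the failure probabilities of even two rounds can add up to more than 1. The
  potential is instead a generating function. If a round fails with probability at most
  \<open>f\<close> and each round is charged a factor \<open>z\<close>, bounding the success
  probability by 1 gives \<open>V r = z * (f * V r + V (r - 1))\<close> for the value
  \<open>V r\<close> with \<open>r\<close> successes to go. Hence
  \<open>V r / V (r - 1) = z / (1 - z * f)\<close>, and \<open>f = sd\<^sup>2\<close>,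
  \<open>z = 1 / sd\<close> yield the base \<open>1 / (sd * (1 - sd))\<close>. These bases are
  useful only if \<open>sd\<close> stays away from 1. This is why a round has to improve on the
  value \<open>k * exp (- l) = \<delta>\<close> of the plain union bound over the players by a
  constant factor. The probability \<open>\<delta>\<close> is spent in two halves, one on the rounds
  and one on the estimates of the first round. The latter are tracked by exponential
  supermartingales that start at \<open>exp (- 2 * l) = (\<delta> / k)\<^sup>2\<close> per player,
  which is at most \<open>\<delta> / 2\<close> in total for two or more players. A single player is
  deterministic and is treated apart.\<close>

section \<open>Binomial tails\<close>

text \<open>\<open>tail \<mu> n s\<close> is the probability that a binomial variable with parameters \<open>n\<close>, \<open>\<mu>\<close> is at
  least \<open>s\<close>. The recursion makes \<open>tail \<mu> (n - m) (s - X\<^sub>m)\<close> a martingale in the number \<open>m\<close> of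
  trials made, \<open>X\<^sub>m\<close> of them successful.\<close>

primrec tail :: "real \<Rightarrow> nat \<Rightarrow> real \<Rightarrow> real" where
  "tail \<mu> 0 s = (if s \<le> 0 then 1 else 0)"
| "tail \<mu> (Suc n) s = \<mu> * tail \<mu> n (s - 1) + (1 - \<mu>) * tail \<mu> n s"

lemma tail_nonneg: "0 \<le> \<mu> \<Longrightarrow> \<mu> \<le> 1 \<Longrightarrow> 0 \<le> tail \<mu> n s"
  by (induction n arbitrary: s) auto

lemma tail_nonpos: "s \<le> 0 \<Longrightarrow> tail \<mu> n s = 1"
  by (induction n arbitrary: s) auto

lemma tail_antimono: "0 \<le> \<mu> \<Longrightarrow> \<mu> \<le> 1 \<Longrightarrow> s \<le> s' \<Longrightarrow> tail \<mu> n s' \<le> tail \<mu> n s"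
  by (induction n arbitrary: s s') (auto intro!: add_mono mult_left_mono)

lemma tail_certain: "real n < s \<Longrightarrow> tail 1 n s = 0"
  by (induction n arbitrary: s) auto

text \<open>The factor besides the Chernoff bound is the tail under the exponentially tilted law; it is
  what saves a constant factor over the Chernoff bound.\<close>

lemma tail_tilt:
  assumes "0 \<le> \<mu>" "\<mu> \<le> 1" "0 \<le> \<theta>"
  defines "Z \<equiv> 1 + \<mu> * (exp \<theta> - 1)"
  shows "tail \<mu> n s \<le> exp (- \<theta> * s) * Z ^ n * tail (\<mu> * exp \<theta> / Z) n s"
proof (induction n arbitrary: s)
  case 0
  then show ?case using \<open>0 \<le> \<theta>\<close> by (auto simp: mult_nonneg_nonpos)
next
  case (Suc n)
  let ?\<nu> = "\<mu> * exp \<theta> / Z"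
  have Z: "Z > 0"
    using assms by (simp add: add_pos_nonneg)
  have \<nu>: "Z * ?\<nu> = \<mu> * exp \<theta>" "Z * (1 - ?\<nu>) = 1 - \<mu>"
    using Z by (auto simp: field_simps Z_def)
  have "tail \<mu> (Suc n) s \<le> \<mu> * (exp (- \<theta> * (s - 1)) * Z ^ n * tail ?\<nu> n (s - 1))
      + (1 - \<mu>) * (exp (- \<theta> * s) * Z ^ n * tail ?\<nu> n s)"
    using Suc assms by (auto intro!: add_mono mult_left_mono)
  also have "exp (- \<theta> * (s - 1)) = exp (- \<theta> * s) * exp \<theta>"
    by (simp add: exp_add[symmetric] algebra_simps)
  also have "\<mu> * (exp (- \<theta> * s) * exp \<theta> * Z ^ n * tail ?\<nu> n (s - 1))
      + (1 - \<mu>) * (exp (- \<theta> * s) * Z ^ n * tail ?\<nu> n s)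
      = exp (- \<theta> * s) * Z ^ n * ((\<mu> * exp \<theta>) * tail ?\<nu> n (s - 1) + (1 - \<mu>) * tail ?\<nu> n s)"
    by (simp add: algebra_simps)
  also have "\<dots> = exp (- \<theta> * s) * Z ^ n * ((Z * ?\<nu>) * tail ?\<nu> n (s - 1) + (Z * (1 - ?\<nu>)) * tail ?\<nu> n s)"
    by (simp only: \<nu>)
  also have "\<dots> = exp (- \<theta> * s) * Z ^ Suc n * (?\<nu> * tail ?\<nu> n (s - 1) + (1 - ?\<nu>) * tail ?\<nu> n s)"
    by (simp only: power_Suc2 ring_distribs mult_ac)
  also have "\<dots> = exp (- \<theta> * s) * Z ^ Suc n * tail ?\<nu> (Suc n) s"
    by simp
  finally show ?case .
qed

lemma tail_le_1: "0 \<le> \<mu> \<Longrightarrow> \<mu> \<le> 1 \<Longrightarrow> tail \<mu> n s \<le> 1"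
proof (induction n arbitrary: s)
  case (Suc n)
  then have "tail \<mu> (Suc n) s \<le> \<mu> * 1 + (1 - \<mu>) * 1"
    by (auto simp del: mult_1_right intro!: add_mono mult_left_mono)
  then show ?case by simp
qed auto

lemma tilted_mean_le:
  fixes \<mu> \<theta> :: real
  assumes "0 \<le> \<mu>" "\<mu> \<le> 1" "0 \<le> \<theta>"
  shows "0 \<le> \<mu> * exp \<theta> / (1 + \<mu> * (exp \<theta> - 1))"
    "\<mu> * exp \<theta> / (1 + \<mu> * (exp \<theta> - 1)) \<le> 1"
    "\<mu> * exp \<theta> / (1 + \<mu> * (exp \<theta> - 1)) \<le> \<mu> * exp \<theta>"
proof -
  have 1: "1 + \<mu> * (exp \<theta> - 1) \<ge> 1"
    using mult_nonneg_nonneg[of \<mu> "exp \<theta> - 1"] assms by simp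
  show "0 \<le> \<mu> * exp \<theta> / (1 + \<mu> * (exp \<theta> - 1))"
    using assms 1 by simp
  show "\<mu> * exp \<theta> / (1 + \<mu> * (exp \<theta> - 1)) \<le> 1"
    using assms 1 by (simp add: divide_le_eq algebra_simps)
  have "\<mu> * exp \<theta> / (1 + \<mu> * (exp \<theta> - 1)) \<le> \<mu> * exp \<theta> / 1"
    using assms 1 by (intro divide_left_mono mult_pos_pos) (auto intro: less_le_trans[OF zero_less_one])
  then show "\<mu> * exp \<theta> / (1 + \<mu> * (exp \<theta> - 1)) \<le> \<mu> * exp \<theta>" by simp
qed

lemma tail_tilt_exp:
  assumes "0 \<le> \<mu>" "\<mu> \<le> 1" "0 \<le> \<theta>"
  shows "tail \<mu> n s \<le> exp (real n * \<mu> * (exp \<theta> - 1) - \<theta> * s)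
    * tail (\<mu> * exp \<theta> / (1 + \<mu> * (exp \<theta> - 1))) n s"
proof -
  let ?Z = "1 + \<mu> * (exp \<theta> - 1)"
  have "?Z ^ n \<le> exp (\<mu> * (exp \<theta> - 1)) ^ n"
    using assms by (intro power_mono) auto
  also have "\<dots> = exp (real n * \<mu> * (exp \<theta> - 1))"
    by (simp add: exp_of_nat_mult[symmetric] algebra_simps)
  finally have "exp (- \<theta> * s) * ?Z ^ n * tail (\<mu> * exp \<theta> / ?Z) n s
    \<le> exp (- \<theta> * s) * exp (real n * \<mu> * (exp \<theta> - 1)) * tail (\<mu> * exp \<theta> / ?Z) n s"
    using assms by (intro mult_right_mono mult_left_mono tail_nonneg tilted_mean_le) auto
  also have "exp (- \<theta> * s) * exp (real n * \<mu> * (exp \<theta> - 1)) = exp (real n * \<mu> * (exp \<theta> - 1) - \<theta> * s)"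
    by (simp add: exp_add[symmetric])
  finally show ?thesis
    using tail_tilt[OF assms, of n s] by linarith
qed

lemma tail_chernoff:
  assumes "0 \<le> \<mu>" "\<mu> \<le> 1" "0 \<le> \<theta>"
  shows "tail \<mu> n s \<le> exp (real n * \<mu> * (exp \<theta> - 1) - \<theta> * s)"
proof -
  let ?\<nu> = "\<mu> * exp \<theta> / (1 + \<mu> * (exp \<theta> - 1))"
  have "exp (real n * \<mu> * (exp \<theta> - 1) - \<theta> * s) * tail ?\<nu> n s
    \<le> exp (real n * \<mu> * (exp \<theta> - 1) - \<theta> * s) * 1"
    using assms by (intro mult_left_mono tail_le_1 tilted_mean_le) auto
  with tail_tilt_exp[OF assms, of n s] show ?thesis by linarith
qed

text \<open>Second moment method: for a binomial \<open>X\<close> the right side is the mean of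
  \<open>(B - s + X)\<^sup>2\<close>, which is at least \<open>B\<^sup>2\<close> when
  \<open>X \<ge> s\<close>.\<close>

lemma tail_quadratic:
  assumes "0 \<le> \<mu>" "\<mu> \<le> 1" "0 \<le> B"
  shows "B\<^sup>2 * tail \<mu> n s \<le> (B - s + real n * \<mu>)\<^sup>2 + real n * \<mu> * (1 - \<mu>)"
proof (induction n arbitrary: s)
  case 0
  have "B\<^sup>2 \<le> (B - s)\<^sup>2" if "s \<le> 0"
    using that assms by (intro power_mono) auto
  then show ?case by auto
next
  case (Suc n)
  have "B\<^sup>2 * tail \<mu> (Suc n) s = \<mu> * (B\<^sup>2 * tail \<mu> n (s - 1)) + (1 - \<mu>) * (B\<^sup>2 * tail \<mu> n s)"
    by (simp add: algebra_simps)
  also have "\<dots> \<le> \<mu> * ((B - (s - 1) + real n * \<mu>)\<^sup>2 + real n * \<mu> * (1 - \<mu>))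
      + (1 - \<mu>) * ((B - s + real n * \<mu>)\<^sup>2 + real n * \<mu> * (1 - \<mu>))"
    using Suc assms by (intro add_mono mult_left_mono) auto
  also have "\<dots> = (B - s + real (Suc n) * \<mu>)\<^sup>2 + real (Suc n) * \<mu> * (1 - \<mu>)"
    by (simp add: algebra_simps power2_eq_square)
  finally show ?case .
qed

text \<open>The right-hand side of \<open>tail_quadratic\<close> is a martingale; \<open>B\<close> is its optimal parameter.\<close>

lemma tail_cantelli:
  assumes "0 \<le> \<mu>" "\<mu> \<le> 1" "real n * \<mu> \<le> V" "0 < V" "0 < \<sigma>" "\<sigma> \<le> s - real n * \<mu>"
  shows "tail \<mu> n s \<le> V / (V + \<sigma>\<^sup>2)"
proof -
  define B where "B = \<sigma> + V / \<sigma>"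
  have B: "B > 0" using assms by (simp add: B_def add_pos_pos)
  have "B\<^sup>2 * tail \<mu> n s \<le> B\<^sup>2 * tail \<mu> n (\<sigma> + real n * \<mu>)"
    using assms by (intro mult_left_mono tail_antimono) auto
  also have "\<dots> \<le> (B - (\<sigma> + real n * \<mu>) + real n * \<mu>)\<^sup>2 + real n * \<mu> * (1 - \<mu>)"
    using assms B by (intro tail_quadratic) auto
  also have "real n * \<mu> * (1 - \<mu>) \<le> real n * \<mu> * 1"
    using assms by (intro mult_left_mono) auto
  also have "real n * \<mu> * 1 \<le> V" using assms by simp
  finally have "B\<^sup>2 * tail \<mu> n s \<le> (V / \<sigma>)\<^sup>2 + V"
    by (simp add: B_def)
  also have "(V / \<sigma>)\<^sup>2 + V = B\<^sup>2 * (V / (V + \<sigma>\<^sup>2))"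
  proof -
    have "V + \<sigma>\<^sup>2 > 0" "\<sigma> \<noteq> 0" using assms by (auto simp: add_pos_nonneg)
    then show ?thesis
      unfolding B_def by (simp add: divide_simps) (simp add: algebra_simps power2_eq_square)
  qed
  finally show ?thesis using B by (simp only: mult_le_cancel_left_pos zero_less_power)
qed

lemma exp_4_le: "exp 4 \<le> (81 :: real)"
proof -
  have "exp 1 ^ 4 \<le> (3 :: real) ^ 4" using exp_le by (intro power_mono) auto
  then show ?thesis by (simp add: exp_of_nat_mult[symmetric])
qed

text \<open>From the quadratic term on, the exponential series is dominated by a geometric series
  with ratio \<open>\<theta> / 3\<close>, because
  \<open>2 * 3 ^ n \<le> fact (n + 2)\<close>.\<close>

lemma exp_bernstein:
  fixes \<theta> :: real
  assumes "0 \<le> \<theta>" "\<theta> < 3"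
  shows "exp \<theta> - 1 - \<theta> \<le> \<theta>\<^sup>2 / (2 * (1 - \<theta> / 3))"
proof -
  have f: "(2::real) * 3 ^ n \<le> fact (n + 2)" for n :: nat
  proof (induction n)
    case (Suc n)
    have "(2::real) * 3 ^ Suc n = 3 * (2 * 3 ^ n)" by simp
    also have "\<dots> \<le> real (n + 3) * fact (n + 2)"
      using Suc by (intro mult_mono) auto
    also have "\<dots> = fact (Suc n + 2)" by (simp add: algebra_simps)
    finally show ?case .
  qed auto
  have s: "(\<lambda>n. \<theta> ^ n / fact n) sums exp \<theta>"
    using exp_converges[of \<theta>] by (simp add: divide_inverse mult.commute)
  have s2: "(\<lambda>n. \<theta> ^ (n + 2) / fact (n + 2)) sums (exp \<theta> - 1 - \<theta>)"
    using sums_split_initial_segment[OF s, of 2] by (simp add: numeral_2_eq_2 diff_diff_eq)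
  have g: "(\<lambda>n. \<theta>\<^sup>2 / 2 * (\<theta> / 3) ^ n) sums (\<theta>\<^sup>2 / 2 * (1 / (1 - \<theta> / 3)))"
    using assms by (intro sums_mult geometric_sums) auto
  have "exp \<theta> - 1 - \<theta> \<le> \<theta>\<^sup>2 / 2 * (1 / (1 - \<theta> / 3))"
  proof (rule sums_le[OF _ s2 g])
    fix n
    have "\<theta> ^ (n + 2) / fact (n + 2) \<le> \<theta> ^ (n + 2) / (2 * 3 ^ n)"
      using assms f[of n] by (intro divide_left_mono) auto
    also have "\<dots> = \<theta>\<^sup>2 / 2 * (\<theta> / 3) ^ n"
      by (simp add: power_add power_divide power2_eq_square)
    finally show "\<theta> ^ (n + 2) / fact (n + 2) \<le> \<theta>\<^sup>2 / 2 * (\<theta> / 3) ^ n" .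
  qed
  then show ?thesis by simp
qed

text \<open>Here \<open>r\<^sup>2\<close> is the mean and \<open>u\<^sup>2 / 2\<close> the Bernstein
  exponent for the threshold \<open>r\<^sup>2 + u * r + u\<^sup>2 / 3\<close>. Keeping the
  third-order term improves this exponent by the factor \<open>1 + u / (3 * r + u)\<close>. Lowering
  the threshold by the error \<open>\<epsilon>\<close> costs little, since the tilting parameter
  stays at most 3.\<close>

lemma tail_exponent:
  assumes "0 \<le> \<mu>" "\<mu> \<le> 1" "0 \<le> u" "0 \<le> r" "0 < 3 * r + u" "r\<^sup>2 = real n * \<mu>"
    and s: "r\<^sup>2 + u * r + u\<^sup>2 / 3 - \<epsilon> * (u * r + u\<^sup>2 / 2) \<le> s" and "0 \<le> \<epsilon>"
  shows "tail \<mu> n s \<le> exp (- (u\<^sup>2 / 2 * (1 + u / (3 * r + u)) - 5 / 2 * \<epsilon> * u\<^sup>2))"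
proof (cases "r = 0")
  case True
  then have nm: "real n * \<mu> = 0" using assms by simp
  \<comment> \<open>The general choice of \<open>\<theta>\<close> would be 3 here, the excluded end
    point of \<open>exp_bernstein\<close>; with mean 0 no estimate of \<open>exp \<theta>\<close> is
    required.\<close>
  have "tail \<mu> n s \<le> exp (real n * \<mu> * (exp 3 - 1) - 3 * s)"
    using assms by (intro tail_chernoff) auto
  also have "\<dots> \<le> exp (- (u\<^sup>2 / 2 * (1 + u / (3 * r + u)) - 5 / 2 * \<epsilon> * u\<^sup>2))"
  proof -
    have "0 \<le> \<epsilon> * u\<^sup>2" using assms by simp
    moreover have "u\<^sup>2 / 3 - \<epsilon> * u\<^sup>2 / 2 \<le> s" using s True by simp
    ultimately have "- (3 * s) \<le> 5 * \<epsilon> * u\<^sup>2 / 2 - u\<^sup>2" by (simp add: algebra_simps)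
    then show ?thesis unfolding nm using True assms by simp
  qed
  finally show ?thesis .
next
  case False
  then have r: "r > 0" using assms by simp
  define D where "D = 3 * r + u"
  have D: "D > 0" "u = D - 3 * r" using assms by (auto simp: D_def)
  \<comment> \<open>Chosen so that \<open>\<theta> * (u * r + u\<^sup>2 / 3) = u\<^sup>2\<close>,
    against a Bernstein error of at most
    \<open>3 * r * u\<^sup>2 / (2 * (3 * r + u))\<close>.\<close>
  define \<theta> where "\<theta> = 3 * u / D"
  have \<theta>: "0 \<le> \<theta>" "\<theta> < 3" "1 - \<theta> / 3 = 3 * r / D"
    using r assms(3) D by (auto simp: \<theta>_def field_simps)
  have \<theta>D: "\<theta> * D = 3 * u" using D by (simp add: \<theta>_def)
  have "r\<^sup>2 * (exp \<theta> - 1 - \<theta>) \<le> r\<^sup>2 * (\<theta>\<^sup>2 / (2 * (1 - \<theta> / 3)))"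
    using \<theta> by (intro mult_left_mono exp_bernstein) auto
  also have "\<dots> = 3 * r * u\<^sup>2 / (2 * D)"
    unfolding \<theta>(3) unfolding \<theta>_def using r D(1) by (simp add: field_simps power2_eq_square)
  finally have 1: "r\<^sup>2 * (exp \<theta> - 1 - \<theta>) \<le> 3 * r * u\<^sup>2 / (2 * D)" .
  have 2: "u\<^sup>2 - 3 * r * u\<^sup>2 / (2 * D) = u\<^sup>2 / 2 * (1 + u / D)"
    using D(1) by (simp add: field_simps D_def)
  have 3: "\<theta> * (u * r + u\<^sup>2 / 3) = u\<^sup>2"
  proof -
    have "\<theta> * (u * r + u\<^sup>2 / 3) = u * (\<theta> * D) / 3"
      by (simp add: D_def power2_eq_square algebra_simps)
    then show ?thesis by (simp add: \<theta>D power2_eq_square)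
  qed
  have 4: "\<theta> * (u * r + u\<^sup>2 / 2) \<le> 5 / 2 * u\<^sup>2"
  proof -
    have "\<theta> * (u * r + u\<^sup>2 / 2) = u\<^sup>2 + \<theta> * u\<^sup>2 / 6"
      using 3 by (simp add: algebra_simps)
    also have "\<theta> * u\<^sup>2 \<le> 3 * u\<^sup>2" using \<theta> by (intro mult_right_mono) auto
    finally show ?thesis using zero_le_power2[of u] by linarith
  qed
  have 5: "\<epsilon> * (\<theta> * (u * r + u\<^sup>2 / 2)) \<le> \<epsilon> * (5 / 2 * u\<^sup>2)"
    using 4 assms by (intro mult_left_mono) auto
  have 6: "\<theta> * (r\<^sup>2 + u * r + u\<^sup>2 / 3 - \<epsilon> * (u * r + u\<^sup>2 / 2)) \<le> \<theta> * s"
    using s \<theta> by (intro mult_left_mono) auto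
  have "tail \<mu> n s \<le> exp (r\<^sup>2 * (exp \<theta> - 1) - \<theta> * s)"
    using assms \<theta> tail_chernoff[of \<mu> \<theta> n s] by simp
  also have "\<dots> \<le> exp (- (u\<^sup>2 / 2 * (1 + u / D) - 5 / 2 * \<epsilon> * u\<^sup>2))"
    unfolding 2[symmetric] using 1 3 5 6 by (simp add: algebra_simps)
  finally show ?thesis by (simp add: D_def)
qed

lemma tail_bernstein:
  assumes "0 \<le> \<mu>" "\<mu> \<le> 1" "0 \<le> l"
    and s: "real n * \<mu> + sqrt (2 * (real n * \<mu>) * l) + 2 / 3 * l \<le> s"
  shows "tail \<mu> n s \<le> exp (- l)"
proof (cases "l = 0")
  case True
  then show ?thesis using assms by (simp add: tail_le_1)
next
  case False
  define u where "u = sqrt (2 * l)"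
  define r where "r = sqrt (real n * \<mu>)"
  have u: "u > 0" "u\<^sup>2 = 2 * l" using False assms by (auto simp: u_def)
  have r: "r \<ge> 0" "r\<^sup>2 = real n * \<mu>" using assms by (auto simp: r_def)
  have ur: "u * r = sqrt (2 * (real n * \<mu>) * l)"
    by (simp add: u_def r_def real_sqrt_mult)
  have "tail \<mu> n s \<le> exp (- (u\<^sup>2 / 2 * (1 + u / (3 * r + u)) - 5 / 2 * 0 * u\<^sup>2))"
    using assms u r by (intro tail_exponent) (auto simp: ur add_nonneg_pos)
  also have "\<dots> \<le> exp (- l)"
    using u r assms by (simp add: mult_le_cancel_left1)
  finally show ?thesis .
qed

text \<open>At the static slack, Bernstein's inequality only gives \<open>exp (- l) = \<delta> / k\<close> per player, which
  sums up to \<open>\<delta>\<close> and is useless for \<open>\<delta>\<close> near \<open>1\<close>. A factor below \<open>1\<close> is gained for small means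
  from the third-order term of the exponent, and for large means from Cantelli's inequality
  applied to a tilted law whose mean is one standard deviation below \<open>s\<close>. The error \<open>\<epsilon>\<close> absorbs
  the inaccuracy of the estimated probabilities.\<close>

lemma tail_static:
  assumes \<mu>: "0 \<le> \<mu>" "\<mu> \<le> 1" and l: "69 / 100 \<le> l"
    and \<epsilon>: "0 \<le> \<epsilon>" "\<epsilon> \<le> 1 / 1000" "\<epsilon> * l \<le> 1 / 1000"
    and s: "real n * \<mu> + (1 - \<epsilon>) * sqrt (2 * (real n * \<mu>) * l) + (2 / 3 - \<epsilon>) * l \<le> s"
  shows "tail \<mu> n s \<le> 99 / 100 * exp (- l)"
proof -
  define u where "u = sqrt (2 * l)"
  define r where "r = sqrt (real n * \<mu>)"
  have u2: "u\<^sup>2 = 2 * l" using l by (simp add: u_def)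
  have "(117 / 100)\<^sup>2 \<le> u\<^sup>2" using l unfolding u2 by (simp add: power2_eq_square)
  then have u: "u \<ge> 117 / 100" by (rule power2_le_imp_le) (use l in \<open>simp add: u_def\<close>)
  have r: "r \<ge> 0" "r\<^sup>2 = real n * \<mu>" using assms by (auto simp: r_def)
  have ur: "u * r = sqrt (2 * (real n * \<mu>) * l)"
    by (simp add: u_def r_def real_sqrt_mult)
  have s': "r\<^sup>2 + u * r + u\<^sup>2 / 3 - \<epsilon> * (u * r + u\<^sup>2 / 2) \<le> s"
    using s unfolding r(2) ur u2 by (simp add: algebra_simps)
  have \<epsilon>u: "\<epsilon> * u\<^sup>2 \<le> 2 / 1000" using \<epsilon> by (simp add: u2)
  have \<epsilon>u1: "\<epsilon> * u \<le> 2 / 1000"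
  proof -
    have "\<epsilon> * u * 1 \<le> \<epsilon> * u * u" using u \<epsilon> by (intro mult_left_mono) auto
    then show ?thesis using \<epsilon>u by (simp add: power2_eq_square)
  qed
  show ?thesis
  \<comment> \<open>Up to this bound the third-order term adds at least 37/2000 to the exponent, of
    which the error \<open>\<epsilon>\<close> takes at most 10/2000.\<close>
  proof (cases "r \<le> 10 * u\<^sup>2")
    case True
    have "tail \<mu> n s \<le> exp (- (u\<^sup>2 / 2 * (1 + u / (3 * r + u)) - 5 / 2 * \<epsilon> * u\<^sup>2))"
      using assms u r s' by (intro tail_exponent) auto
    also have "\<dots> \<le> exp (- 27 / 2000 - l)"
    proof -
      have "37 / 1000 * (3 * r + u) \<le> 37 / 1000 * (30 * u\<^sup>2 + u)" using True by simp
      also have "\<dots> = u * (111 / 100 * u + 37 / 1000)" by (simp add: power2_eq_square algebra_simps)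
      also have "\<dots> \<le> u * u\<^sup>2"
      proof (intro mult_left_mono)
        have "117 / 100 * u \<le> u * u" using u by (intro mult_right_mono) auto
        then show "111 / 100 * u + 37 / 1000 \<le> u\<^sup>2" using u unfolding power2_eq_square by linarith
      qed (use u in auto)
      finally have "37 / 2000 \<le> u\<^sup>2 / 2 * (u / (3 * r + u))"
        using u r by (simp add: field_simps power2_eq_square)
      moreover have "u\<^sup>2 / 2 * (1 + u / (3 * r + u)) = l + u\<^sup>2 / 2 * (u / (3 * r + u))"
        by (simp add: u2 distrib_left)
      ultimately show ?thesis using \<epsilon>u unfolding exp_le_cancel_iff by linarith
    qed
    also have "\<dots> = exp (- 27 / 2000) * exp (- l)" by (simp add: exp_add[symmetric])
    also have "exp (- 27 / 2000) \<le> (99 / 100 :: real)"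
    proof -
      have "(1 + 27 / 2000 :: real) \<le> exp (27 / 2000)" by (rule exp_ge_add_one_self)
      then have "inverse (exp (27 / 2000)) \<le> inverse (1 + 27 / 2000 :: real)"
        by (intro le_imp_inverse_le) auto
      then show ?thesis by (simp add: exp_minus)
    qed
    finally show ?thesis by simp
  next
    case False
    then have r10: "r > 10 * u\<^sup>2" by simp
    have uu: "u * (117 / 100) \<le> u\<^sup>2" using u unfolding power2_eq_square by (intro mult_left_mono) auto
    have rpos: "r > 13" using r10 uu u by linarith
    \<comment> \<open>Tilting raises the mean by about
      \<open>\<theta> * r\<^sup>2 = (u - 1) * r\<close>, and the standard deviation is at most about
      \<open>r\<close>. The Chernoff factor is then about \<open>exp (1 / 2 - l)\<close>, Cantelli's
      inequality contributes about 1/2, and \<open>exp (1 / 2) / 2 < 1\<close>.\<close>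
    define \<theta> where "\<theta> = (u - 1) / r"
    have \<theta>0: "\<theta> \<ge> 0" using u rpos by (simp add: \<theta>_def)
    have \<theta>r: "\<theta> * r = u - 1" using rpos by (simp add: \<theta>_def)
    have \<theta>1: "\<theta> \<le> 86 / 1000"
    proof -
      have "u - 1 \<le> 86 / 1000 * r" using r10 uu u by linarith
      then show ?thesis using rpos by (simp add: \<theta>_def divide_le_eq)
    qed
    define d where "d = exp \<theta> - 1 - \<theta>"
    have d: "d \<le> \<theta>\<^sup>2 / 2 * (1 + 9 / 25 * \<theta>)"
    proof -
      have "d \<le> \<theta>\<^sup>2 / (2 * (1 - \<theta> / 3))"
        unfolding d_def using \<theta>0 \<theta>1 by (intro exp_bernstein) auto
      also have "\<dots> = \<theta>\<^sup>2 / 2 * (1 / (1 - \<theta> / 3))" by simp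
      also have "\<dots> \<le> \<theta>\<^sup>2 / 2 * (1 + 9 / 25 * \<theta>)"
      proof (rule mult_left_mono)
        have "\<theta> * \<theta> \<le> \<theta> * (86 / 1000)" using \<theta>0 \<theta>1 by (intro mult_left_mono) auto
        then have "1 \<le> (1 + 9 / 25 * \<theta>) * (1 - \<theta> / 3)" using \<theta>0 by (simp add: algebra_simps)
        then show "1 / (1 - \<theta> / 3) \<le> 1 + 9 / 25 * \<theta>"
          using \<theta>1 by (simp add: divide_le_eq)
      qed auto
      finally show ?thesis .
    qed
    have rd: "r\<^sup>2 * d \<le> (u - 1)\<^sup>2 / 2 * (1 + 9 / 25 * \<theta>)"
    proof -
      have "r\<^sup>2 * d \<le> r\<^sup>2 * (\<theta>\<^sup>2 / 2 * (1 + 9 / 25 * \<theta>))" using d by (intro mult_left_mono) auto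
      also have "\<dots> = (\<theta> * r)\<^sup>2 / 2 * (1 + 9 / 25 * \<theta>)" by (simp add: power_mult_distrib)
      finally show ?thesis by (simp only: \<theta>r)
    qed
    let ?\<nu> = "\<mu> * exp \<theta> / (1 + \<mu> * (exp \<theta> - 1))"
    have "r\<^sup>2 * (exp \<theta> - 1) - \<theta> * s \<le> 1 / 2 + 5 / 2000 - l"
    proof -
      have "\<theta> * (r\<^sup>2 + u * r + u\<^sup>2 / 3 - \<epsilon> * (u * r + u\<^sup>2 / 2)) \<le> \<theta> * s"
        using s' \<theta>0 by (intro mult_left_mono) auto
      moreover have "\<theta> * (r\<^sup>2 + u * r + u\<^sup>2 / 3 - \<epsilon> * (u * r + u\<^sup>2 / 2))
         = \<theta> * r\<^sup>2 + u * (\<theta> * r) + \<theta> * (u\<^sup>2 / 3) - \<epsilon> * u * (\<theta> * r) - \<theta> * (\<epsilon> * u\<^sup>2 / 2)"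
        by (simp add: algebra_simps)
      moreover have "r\<^sup>2 * (exp \<theta> - 1) = \<theta> * r\<^sup>2 + r\<^sup>2 * d" by (simp add: d_def algebra_simps)
      moreover have "\<epsilon> * u * (u - 1) \<le> \<epsilon> * u * u"
        using u \<epsilon> by (intro mult_left_mono) auto
      moreover have "\<theta> * (\<epsilon> * u\<^sup>2 / 2) \<le> 86 / 1000 * (2 / 1000 / 2)"
        using \<theta>0 \<theta>1 \<epsilon>u \<epsilon> by (intro mult_mono) auto
      moreover have "(u - 1)\<^sup>2 * (9 / 25 * \<theta>) / 2 \<le> \<theta> * (u\<^sup>2 / 3)"
      proof -
        have "\<theta> * (u - 1)\<^sup>2 \<le> \<theta> * u\<^sup>2" using u \<theta>0 by (intro mult_left_mono power_mono) auto
        moreover have "0 \<le> \<theta> * u\<^sup>2" using \<theta>0 by simp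
        ultimately show ?thesis by (simp add: algebra_simps)
      qed
      moreover have "(u - 1)\<^sup>2 / 2 * (1 + 9 / 25 * \<theta>) = (u - 1)\<^sup>2 / 2 + (u - 1)\<^sup>2 * (9 / 25 * \<theta>) / 2"
        by (simp add: algebra_simps)
      moreover have "u * (u - 1) - (u - 1)\<^sup>2 / 2 = l - 1 / 2"
        using u2 by (simp add: power2_eq_square field_simps)
      ultimately show ?thesis
        using rd \<epsilon>u unfolding \<theta>r power2_eq_square[of u] by (simp add: algebra_simps)
    qed
    then have E: "exp (real n * \<mu> * (exp \<theta> - 1) - \<theta> * s) \<le> exp (1 / 2 + 5 / 2000) * exp (- l)"
      by (simp add: r(2)[symmetric] exp_add[symmetric])
    have V: "tail ?\<nu> n s \<le> (r\<^sup>2 * exp \<theta>) / (r\<^sup>2 * exp \<theta> + (97 / 100 * r)\<^sup>2)"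
    proof (rule tail_cantelli)
      show "0 \<le> ?\<nu>" "?\<nu> \<le> 1" using \<mu> \<theta>0 by (auto intro!: tilted_mean_le)
      show M: "real n * ?\<nu> \<le> r\<^sup>2 * exp \<theta>"
        using mult_left_mono[OF tilted_mean_le(3)[OF \<mu> \<theta>0], of "real n"] by (simp add: r(2) mult.assoc)
      show "0 < r\<^sup>2 * exp \<theta>" "0 < 97 / 100 * r" using rpos by auto
      have "r\<^sup>2 * exp \<theta> = r\<^sup>2 + r * (\<theta> * r) + r\<^sup>2 * d"
        by (simp add: d_def power2_eq_square algebra_simps)
      also have "\<dots> = r\<^sup>2 + r * (u - 1) + r\<^sup>2 * d" by (simp only: \<theta>r)
      finally have *: "r\<^sup>2 * exp \<theta> = r\<^sup>2 + r * (u - 1) + r\<^sup>2 * d" .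
      have "(u - 1)\<^sup>2 / 2 * (1 + 9 / 25 * \<theta>) \<le> (u - 1)\<^sup>2 / 2 * (104 / 100)"
        using \<theta>1 by (intro mult_left_mono) auto
      then have rd': "r\<^sup>2 * d \<le> 52 / 100 * u\<^sup>2 - 104 / 100 * u + 52 / 100"
      proof -
        have "r\<^sup>2 * d \<le> (u - 1)\<^sup>2 / 2 * (104 / 100)"
          using rd \<open>(u - 1)\<^sup>2 / 2 * (1 + 9 / 25 * \<theta>) \<le> _\<close> by (rule order_trans)
        then show ?thesis by (simp add: power2_eq_square field_simps)
      qed
      have "\<epsilon> * (u * r + u\<^sup>2 / 2) \<le> 2 / 1000 * r + 1 / 1000"
        using mult_right_mono[OF \<epsilon>u1 r(1)] \<epsilon>u by (simp add: algebra_simps)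
      then show "97 / 100 * r \<le> s - real n * ?\<nu>"
        using s' M * rd' r10 u rpos by (simp add: algebra_simps)
    qed
    also have "\<dots> \<le> 540 / 1000"
    proof -
      have "exp \<theta> \<le> 1 + \<theta> + \<theta>\<^sup>2" using \<theta>0 \<theta>1 by (intro exp_bound) auto
      also have "\<theta>\<^sup>2 \<le> (86 / 1000)\<^sup>2" using \<theta>0 \<theta>1 by (intro power_mono) auto
      finally have "exp \<theta> \<le> 110 / 100" using \<theta>1 by (simp add: power2_eq_square)
      then have "460 * exp \<theta> \<le> 540 * (97 / 100)\<^sup>2" by (simp add: power2_eq_square)
      then have "r\<^sup>2 * (460 * exp \<theta>) \<le> r\<^sup>2 * (540 * (97 / 100)\<^sup>2)" by (intro mult_left_mono) auto
      moreover have "(97 / 100 * r)\<^sup>2 = r\<^sup>2 * (97 / 100)\<^sup>2"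
        by (simp only: power_mult_distrib mult.commute)
      ultimately have "460 * (r\<^sup>2 * exp \<theta>) \<le> 540 * (97 / 100 * r)\<^sup>2"
        by (simp only: mult_ac)
      moreover have "0 < r\<^sup>2 * exp \<theta> + (97 / 100 * r)\<^sup>2" using rpos by (simp add: add_pos_pos)
      moreover have "a / (a + b) \<le> 540 / 1000" if "460 * a \<le> 540 * b" "0 < a + b" for a b :: real
        using that by (simp add: pos_divide_le_eq)
      ultimately show ?thesis by blast
    qed
    finally have "tail \<mu> n s \<le> (exp (1 / 2 + 5 / 2000) * exp (- l)) * (540 / 1000)"
      using tail_tilt_exp[OF \<mu> \<theta>0, of n s] E tilted_mean_le[OF \<mu> \<theta>0]
      by (smt (verit) mult_mono tail_nonneg exp_gt_zero mult_pos_pos)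
    also have "exp (1 / 2 + 5 / 2000) \<le> (1 + (1 / 2 + 5 / 2000) + (1 / 2 + 5 / 2000)\<^sup>2 :: real)"
      by (rule exp_bound) auto
    finally have "tail \<mu> n s \<le> 7581627 / 8000000 * exp (- l)" by (simp add: power2_eq_square)
    then show ?thesis using exp_gt_zero[of "- l"] by linarith
  qed
qed

section \<open>A maximal inequality for chains driven by the arrivals\<close>

primrec drive :: "(nat \<Rightarrow> 's \<Rightarrow> 's) \<Rightarrow> 's \<Rightarrow> (nat \<Rightarrow> nat) \<Rightarrow> nat \<Rightarrow> 's" where
  "drive F s \<omega> 0 = s"
| "drive F s \<omega> (Suc m) = F (\<omega> m) (drive F s \<omega> m)"

lemma drive_case_nat: "drive F s (case_nat i \<omega>) (Suc m) = drive F (F i s) \<omega> m"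
  by (induction m) auto

lemma space_multinomial_arrivals [simp]: "space (multinomial_arrivals p) = UNIV"
  by (simp add: multinomial_arrivals_def space_PiM)

text \<open>Holds for arbitrary \<open>Q\<close>, without a sigma-algebra on the states: the state
  depends on finitely many discrete coordinates, and the induction splits on the last of
  them.\<close>

lemma sets_drive [measurable]: "{\<omega>. Q (drive F s \<omega> m)} \<in> sets (multinomial_arrivals p)"
proof (induction m arbitrary: Q)
  case 0
  then show ?case
    using sets.top[of "multinomial_arrivals p"] by (cases "Q s") auto
next
  case (Suc m)
  have c: "{\<omega>. \<omega> m = i} \<in> sets (multinomial_arrivals p)" for i
  proof -
    have "(\<lambda>\<omega>. \<omega> m) -` {i} \<inter> space (multinomial_arrivals p) \<in> sets (multinomial_arrivals p)"
      unfolding multinomial_arrivals_def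
      by (rule measurable_sets[OF measurable_component_singleton]) auto
    moreover have "(\<lambda>\<omega>. \<omega> m) -` {i} \<inter> space (multinomial_arrivals p) = {\<omega>. \<omega> m = i}" by auto
    ultimately show ?thesis by simp
  qed
  have "{\<omega>. Q (drive F s \<omega> (Suc m))} = (\<Union>i. {\<omega>. \<omega> m = i} \<inter> {\<omega>. Q (F i (drive F s \<omega> m))})"
    by auto
  then show ?case
    using c Suc.IH[of "\<lambda>s. Q (F i s)" for i] by auto
qed

lemma sets_drive_hit: "{\<omega>. \<exists>m\<le>n. Q (drive F s \<omega> m)} \<in> sets (multinomial_arrivals p)"
proof -
  have "{\<omega>. \<exists>m\<le>n. Q (drive F s \<omega> m)} = (\<Union>m\<in>{..n}. {\<omega>. Q (drive F s \<omega> m)})" by auto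
  then show ?thesis using sets_drive by auto
qed

lemma prob_space_multinomial_arrivals: "prob_space (multinomial_arrivals p)"
  unfolding multinomial_arrivals_def by (intro prob_space_PiM measure_pmf.prob_space_axioms)

text \<open>The arrival sequence is a first item followed by an independent copy of the sequence.
  This takes the place of conditional expectations in the proof of Ville's inequality, an induction
  on first steps.\<close>

lemma emeasure_first_arrival:
  assumes X: "X \<in> sets (multinomial_arrivals p)"
  shows "emeasure (multinomial_arrivals p) X
    = (\<integral>\<^sup>+ i. emeasure (multinomial_arrivals p) {\<omega>. case_nat i \<omega> \<in> X} \<partial>measure_pmf p)"
proof -
  interpret sequence_space "measure_pmf p" ..
  let ?S = "multinomial_arrivals p"
  interpret S: prob_space ?S by (rule prob_space_multinomial_arrivals)
  have SS: "?S = (\<Pi>\<^sub>M i\<in>(UNIV::nat set). measure_pmf p)" by (simp add: multinomial_arrivals_def)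
  have meas: "(\<lambda>(s, \<omega>). case_nat s \<omega>) \<in> measurable (measure_pmf p \<Otimes>\<^sub>M ?S) ?S"
    unfolding SS by measurable
  have "emeasure ?S X = emeasure (distr (measure_pmf p \<Otimes>\<^sub>M ?S) ?S (\<lambda>(s, \<omega>). case_nat s \<omega>)) X"
    unfolding SS PiM_iter ..
  also have "\<dots> = emeasure (measure_pmf p \<Otimes>\<^sub>M ?S) ((\<lambda>(s, \<omega>). case_nat s \<omega>) -` X \<inter> space (measure_pmf p \<Otimes>\<^sub>M ?S))"
    by (rule emeasure_distr[OF meas X])
  also have "\<dots> = (\<integral>\<^sup>+ i. emeasure ?S (Pair i -` ((\<lambda>(s, \<omega>). case_nat s \<omega>) -` X \<inter> space (measure_pmf p \<Otimes>\<^sub>M ?S))) \<partial>measure_pmf p)"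
    by (intro S.emeasure_pair_measure_alt measurable_sets[OF meas X])
  also have "\<dots> = (\<integral>\<^sup>+ i. emeasure ?S {\<omega>. case_nat i \<omega> \<in> X} \<partial>measure_pmf p)"
    by (intro nn_integral_cong arg_cong2[where f = emeasure]) (auto simp: space_pair_measure)
  finally show ?thesis .
qed

text \<open>Ville's maximal inequality for a nonnegative supermartingale \<open>\<Phi>\<close> of the chain.\<close>

lemma ville_finite:
  assumes p: "set_pmf p \<subseteq> {..<k}"
    and inv: "\<And>s i. I s \<Longrightarrow> i < k \<Longrightarrow> I (F i s)"
    and nonneg: "\<And>s. I s \<Longrightarrow> 0 \<le> \<Phi> s"
    and super: "\<And>s. I s \<Longrightarrow> (\<Sum>i<k. pmf p i * \<Phi> (F i s)) \<le> \<Phi> s"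
    and bad: "\<And>s. I s \<Longrightarrow> Q s \<Longrightarrow> 1 \<le> \<Phi> s"
    and s: "I s"
  shows "emeasure (multinomial_arrivals p) {\<omega>. \<exists>m\<le>n. Q (drive F s \<omega> m)} \<le> ennreal (\<Phi> s)"
  using s
proof (induction n arbitrary: s)
  case 0
  interpret S: prob_space "multinomial_arrivals p" by (rule prob_space_multinomial_arrivals)
  show ?case
  proof (cases "Q s")
    case True
    then have "1 \<le> ennreal (\<Phi> s)" using bad[OF 0] by simp
    then show ?thesis using S.emeasure_le_1 order_trans by blast
  qed auto
next
  case (Suc n)
  interpret S: prob_space "multinomial_arrivals p" by (rule prob_space_multinomial_arrivals)
  show ?case
  proof (cases "Q s")
    case True
    then have "1 \<le> ennreal (\<Phi> s)" using bad[OF Suc.prems] by simp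
    then show ?thesis using S.emeasure_le_1 order_trans by blast
  next
    case False
    let ?X = "{\<omega>. \<exists>m\<le>Suc n. Q (drive F s \<omega> m)}"
    have *: "{\<omega>. case_nat i \<omega> \<in> ?X} = {\<omega>. \<exists>m\<le>n. Q (drive F (F i s) \<omega> m)}" for i
    proof -
      have "(\<exists>m\<le>Suc n. Q (drive F s (case_nat i \<omega>) m)) \<longleftrightarrow> (\<exists>m\<le>n. Q (drive F s (case_nat i \<omega>) (Suc m)))" for \<omega>
        using False by (metis Suc_le_mono drive.simps(1) not0_implies_Suc)
      then show ?thesis by (simp only: drive_case_nat mem_Collect_eq)
    qed
    have fin: "finite (set_pmf p)" using p finite_subset by blast
    have "emeasure (multinomial_arrivals p) ?X
      = (\<integral>\<^sup>+ i. emeasure (multinomial_arrivals p) {\<omega>. \<exists>m\<le>n. Q (drive F (F i s) \<omega> m)} \<partial>measure_pmf p)"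
      by (subst emeasure_first_arrival[OF sets_drive_hit]) (simp only: *)
    also have "\<dots> \<le> (\<integral>\<^sup>+ i. ennreal (\<Phi> (F i s)) \<partial>measure_pmf p)"
      using p by (intro nn_integral_mono_AE AE_pmfI Suc.IH inv Suc.prems) auto
    also have "\<dots> = (\<Sum>i\<in>set_pmf p. ennreal (\<Phi> (F i s)) * ennreal (pmf p i))"
      using fin by (subst nn_integral_measure_pmf_finite) (auto intro!: sum.cong)
    also have "\<dots> = (\<Sum>i\<in>set_pmf p. ennreal (pmf p i * \<Phi> (F i s)))"
      using p inv[OF Suc.prems] nonneg by (intro sum.cong refl) (auto simp: ennreal_mult' mult.commute)
    also have "\<dots> = ennreal (\<Sum>i\<in>set_pmf p. pmf p i * \<Phi> (F i s))"
      using p inv[OF Suc.prems] nonneg by (intro sum_ennreal) auto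
    also have "(\<Sum>i\<in>set_pmf p. pmf p i * \<Phi> (F i s)) = (\<Sum>i<k. pmf p i * \<Phi> (F i s))"
      using p by (intro sum.mono_neutral_left) (auto simp: set_pmf_iff)
    also have "ennreal \<dots> \<le> ennreal (\<Phi> s)"
      using super[OF Suc.prems] by (rule ennreal_leI)
    finally show ?thesis .
  qed
qed

lemma ville:
  assumes p: "set_pmf p \<subseteq> {..<k}"
    and inv: "\<And>s i. I s \<Longrightarrow> i < k \<Longrightarrow> I (F i s)"
    and nonneg: "\<And>s. I s \<Longrightarrow> 0 \<le> \<Phi> s"
    and super: "\<And>s. I s \<Longrightarrow> (\<Sum>i<k. pmf p i * \<Phi> (F i s)) \<le> \<Phi> s"
    and bad: "\<And>s. I s \<Longrightarrow> Q s \<Longrightarrow> 1 \<le> \<Phi> s"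
    and s: "I s"
  shows "measure (multinomial_arrivals p) {\<omega>. \<forall>m. \<not> Q (drive F s \<omega> m)} \<ge> 1 - \<Phi> s"
proof -
  interpret S: prob_space "multinomial_arrivals p" by (rule prob_space_multinomial_arrivals)
  let ?A = "\<lambda>n. {\<omega>. \<exists>m\<le>n. Q (drive F s \<omega> m)}"
  have inc: "incseq ?A" by (auto simp: incseq_def intro: order_trans)
  have "emeasure (multinomial_arrivals p) (\<Union>n. ?A n) = (SUP n. emeasure (multinomial_arrivals p) (?A n))"
    using inc sets_drive_hit by (intro SUP_emeasure_incseq[symmetric]) auto
  also have "\<dots> \<le> ennreal (\<Phi> s)"
    using ville_finite[OF assms] by (intro SUP_least) auto
  also have "(\<Union>n. ?A n) = {\<omega>. \<exists>m. Q (drive F s \<omega> m)}" by auto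
  finally have 1: "measure (multinomial_arrivals p) {\<omega>. \<exists>m. Q (drive F s \<omega> m)} \<le> \<Phi> s"
    using nonneg[OF s] by (simp add: S.emeasure_eq_measure)
  have "{\<omega>. \<exists>m. Q (drive F s \<omega> m)} = (\<Union>m. {\<omega>. Q (drive F s \<omega> m)})" by auto
  then have "{\<omega>. \<exists>m. Q (drive F s \<omega> m)} \<in> S.events" using sets_drive by auto
  from S.prob_compl[OF this] 1 show ?thesis
    by (simp add: Compl_eq_Diff_UNIV[symmetric] Collect_neg_eq[symmetric])
qed

lemma run_eq_drive: "run A k \<delta> N \<omega> m = drive (step A k \<delta>) (start_round A k \<delta> First_Round N 0) \<omega> m"
  by (induction m) auto

section \<open>Estimates in a learned round\<close>

lemma ln_2_ge: "69 / 100 \<le> ln (2 :: real)"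
proof -
  have "exp (23 / 100) - 1 - 23 / 100 \<le> (23 / 100)\<^sup>2 / (2 * (1 - 23 / 100 / 3) :: real)"
    by (rule exp_bernstein) auto
  then have "exp (23 / 100) \<le> (12587 / 10000 :: real)"
    by (simp add: power2_eq_square)
  then have "exp (23 / 100) ^ 3 \<le> (12587 / 10000 :: real) ^ 3"
    by (intro power_mono) auto
  also have "\<dots> \<le> 2" by (simp add: power3_eq_cube)
  finally have "exp (69 / 100) \<le> (2 :: real)"
    using exp_of_nat_mult[of 3 "23 / 100 :: real"] by simp
  then show ?thesis by (subst ln_ge_iff) auto
qed

lemma ln_3_le: "5 * ln 3 \<le> 8 * ln (2 :: real)"
proof -
  have "5 * ln 3 = ln (3 ^ 5 :: real)" by (subst ln_realpow) auto
  also have "\<dots> \<le> ln (2 ^ 8)" by (subst ln_le_cancel_iff) auto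
  also have "\<dots> = 8 * ln (2 :: real)" by (subst ln_realpow) auto
  finally show ?thesis .
qed

lemma sqrt_2_bounds: "1414 / 1000 \<le> sqrt (2 :: real)" "sqrt (2 :: real) \<le> 1415 / 1000"
proof -
  show "1414 / 1000 \<le> sqrt (2 :: real)" by (rule real_le_rsqrt) (simp add: power2_eq_square)
  show "sqrt (2 :: real) \<le> 1415 / 1000" by (rule real_le_lsqrt) (auto simp: power2_eq_square)
qed

lemma lrn_beta_ge: "84 \<le> lrn_beta"
proof -
  have "(6494 / 1000)\<^sup>2 \<le> (2 * sqrt 2 + 2 / 3 + 3)\<^sup>2"
    using sqrt_2_bounds by (intro power_mono) auto
  then show ?thesis by (simp add: lrn_beta_def power2_eq_square)
qed

lemma lrn_beta_le: "lrn_beta \<le> 100"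
proof -
  have "(2 * sqrt 2 + 2 / 3 + 3)\<^sup>2 \<le> (7 :: real)\<^sup>2"
    using sqrt_2_bounds by (intro power_mono) auto
  then show ?thesis by (simp add: lrn_beta_def power2_eq_square)
qed

lemma mu_hat_ge:
  assumes "n i \<le> w" "0 < w" "0 < \<delta>" "\<delta> < 1"
  shows "real (n i) / real w \<le> mu_hat \<delta> w n i"
proof -
  have "0 \<le> real (n i) / real w" "real (n i) / real w \<le> 1" using assms by auto
  then have "(real (n i) / real w)\<^sup>2 \<le> real (n i) / real w"
    unfolding power2_eq_square by (intro mult_left_le)
  moreover have "0 \<le> ln (3 / \<delta>)" using assms by (intro ln_ge_zero) (auto simp: field_simps)
  ultimately have "0 \<le> sqrt (2 * (real (n i) / real w - (real (n i) / real w)\<^sup>2) * ln (3 / \<delta>) / real w)"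
      "0 \<le> 3 * ln (3 / \<delta>) / real w"
    by simp_all
  then show ?thesis unfolding mu_hat_def Let_def by linarith
qed

text \<open>The setting of a round with learned slacks. \<open>n\<close> and \<open>w\<close> are
  the counters and the item count of the first round. As that round tracks at least a quarter of the
  initial threshold, at most \<open>3 * w\<close> items remain, whence \<open>Nw\<close>.\<close>

locale active_round =
  fixes k N N0 w :: nat and \<delta> :: real and n :: "nat \<Rightarrow> nat"
  assumes k: "1 \<le> k" and \<delta>: "0 < \<delta>" "\<delta> < 1" and n: "(\<Sum>i<k. n i) = w"
    and Nw: "N \<le> 3 * w" and NN0: "N \<le> N0"
    and active: "4 * k < N" "lrn_beta * real k * ln (real k / \<delta>) < real N"
begin

abbreviation l where "l \<equiv> ln (real k / \<delta>)"
abbreviation L where "L \<equiv> ln (3 / \<delta>)"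
abbreviation mh where "mh \<equiv> mu_hat \<delta> w n"
abbreviation S where "S \<equiv> \<Sum>i<k. mh i"
abbreviation t where "t \<equiv> lrn_t k \<delta> mh N"

text \<open>\<open>h = x\<^bsup>-1/4\<^esup>\<close> for the ratio \<open>x = N / (k ln (k / \<delta>))\<close>.\<close>

definition h :: real where "h = sqrt (sqrt (real k * l / real N))"

lemma N_pos: "0 < N" "5 \<le> N" using active k by auto

lemma w_pos: "2 \<le> w" using Nw N_pos by auto

lemma l_pos: "0 < l"
  using k \<delta> by (intro ln_gt_zero) (auto simp: field_simps)

lemma L_nonneg: "0 \<le> L"
  using \<delta> by (intro ln_ge_zero) (auto simp: field_simps)

lemma h_pos: "0 < h"
  using k N_pos l_pos by (auto simp: h_def)

lemma h4: "real k * l = real N * (h\<^sup>2)\<^sup>2"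
  using k N_pos l_pos by (simp add: h_def)

lemma h2_le: "h\<^sup>2 \<le> 11 / 100"
proof (rule power2_le_imp_le)
  have "84 * (real k * l) \<le> lrn_beta * (real k * l)"
    using lrn_beta_ge k l_pos by (intro mult_right_mono) auto
  then have "84 * (real N * (h\<^sup>2)\<^sup>2) \<le> real N"
    using active(2) unfolding h4[symmetric] mult.assoc by linarith
  then have "real N * (84 * (h\<^sup>2)\<^sup>2) \<le> real N * 1" by simp
  then have "84 * (h\<^sup>2)\<^sup>2 \<le> 1" using N_pos by (simp only: mult_le_cancel_left_pos of_nat_0_less_iff)
  then show "(h\<^sup>2)\<^sup>2 \<le> (11 / 100)\<^sup>2" by (simp add: power2_eq_square[of "11/100"])
qed auto

lemma mh_bounds:
  assumes "i < k"
  shows "real (n i) / real w \<le> mh i" "0 \<le> mh i"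
proof -
  have "n i \<le> w"
    unfolding n[symmetric] using assms by (intro member_le_sum) auto
  then show "real (n i) / real w \<le> mh i"
    using w_pos \<delta> by (intro mu_hat_ge) auto
  then show "0 \<le> mh i" by (rule order_trans[rotated]) simp
qed

lemma sum_mbar: "(\<Sum>i<k. real (n i) / real w) = 1"
  using n w_pos by (simp add: sum_divide_distrib[symmetric] of_nat_sum[symmetric] del: of_nat_sum)

lemma S_ge: "1 \<le> S"
  using sum_mono[of "{..<k}" "\<lambda>i. real (n i) / real w" mh] mh_bounds sum_mbar by auto

text \<open>Summed over the players, the square-root terms are at most
  \<open>sqrt (2 * k * L / w)\<close> by Cauchy-Schwarz. With \<open>w \<ge> N / 3\<close> and
  \<open>L \<le> 1.6 * l\<close>, which holds for two or more players, this is of order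
  \<open>sqrt (k * l / N) = h\<^sup>2\<close>; the linear terms are of order
  \<open>h ^ 4\<close>.\<close>

lemma S_le:
  assumes "2 \<le> k"
  shows "S \<le> 1 + 47 / 10 * h\<^sup>2"
proof -
  define m where "m i = real (n i) / real w" for i
  define a where "a i = 2 * (m i - (m i)\<^sup>2) * L / real w" for i
  have m: "0 \<le> m i" "m i \<le> 1" if "i < k" for i
  proof -
    have "n i \<le> w"
      unfolding n[symmetric] using that by (intro member_le_sum) auto
    then show "0 \<le> m i" "m i \<le> 1" using w_pos by (auto simp: m_def)
  qed
  have a0: "0 \<le> a i" if "i < k" for i
    using m[OF that] L_nonneg by (auto simp: a_def power2_eq_square mult_left_le)
  have "S = (\<Sum>i<k. m i + sqrt (a i) + 3 * L / real w)"
    by (simp add: mu_hat_def Let_def a_def m_def)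
  also have "\<dots> = 1 + (\<Sum>i<k. sqrt (a i)) + 3 * (real k * L / real w)"
    by (simp add: sum.distrib m_def sum_mbar algebra_simps)
  finally have S: "S = 1 + (\<Sum>i<k. sqrt (a i)) + 3 * (real k * L / real w)" .
  have kL: "real k * L / real w \<le> 48 / 10 * (h\<^sup>2)\<^sup>2"
  proof -
    have "ln 2 \<le> ln (real k)" using assms by (subst ln_le_cancel_iff) auto
    moreover have "l = ln (real k) + ln (1 / \<delta>)" "L = ln 3 + ln (1 / \<delta>)" "0 \<le> ln (1 / \<delta>)"
      using k \<delta> by (auto simp: ln_div)
    ultimately have "L \<le> 16 / 10 * l" using ln_3_le by simp
    then have "real k * L \<le> real k * (16 / 10 * l)" by (intro mult_left_mono) auto
    also have "\<dots> = 16 / 10 * (h\<^sup>2)\<^sup>2 * real N" using h4 by simp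
    also have "\<dots> \<le> 16 / 10 * (h\<^sup>2)\<^sup>2 * (3 * real w)"
      using Nw by (intro mult_left_mono) auto
    finally show ?thesis using w_pos by (simp add: divide_le_eq)
  qed
  have sa: "(\<Sum>i<k. a i) \<le> 2 * L / real w"
  proof -
    have "(\<Sum>i<k. a i) \<le> (\<Sum>i<k. m i * (2 * L / real w))"
    proof (rule sum_mono)
      fix i
      have "(m i - (m i)\<^sup>2) * (2 * L / real w) \<le> m i * (2 * L / real w)"
        using L_nonneg by (intro mult_right_mono) auto
      moreover have "a i = (m i - (m i)\<^sup>2) * (2 * L / real w)" by (simp add: a_def)
      ultimately show "a i \<le> m i * (2 * L / real w)" by simp
    qed
    also have "\<dots> = 2 * L / real w"
      by (simp only: sum_distrib_right[symmetric] m_def sum_mbar mult_1)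
    finally show ?thesis .
  qed
  have "(\<Sum>i<k. sqrt (a i) * 1)\<^sup>2 \<le> (\<Sum>i<k. (sqrt (a i))\<^sup>2) * (\<Sum>i<k. 1\<^sup>2)"
    by (rule Cauchy_Schwarz_ineq_sum)
  also have "(\<Sum>i<k. (sqrt (a i))\<^sup>2) = (\<Sum>i<k. a i)"
    using a0 by (intro sum.cong) auto
  finally have "(\<Sum>i<k. sqrt (a i))\<^sup>2 \<le> (\<Sum>i<k. a i) * real k" by simp
  also have "\<dots> \<le> 2 * L / real w * real k" using sa by (intro mult_right_mono) auto
  also have "\<dots> = 2 * (real k * L / real w)" by simp
  also have "\<dots> \<le> 96 / 10 * (h\<^sup>2)\<^sup>2" using kL by simp
  also have "\<dots> \<le> (31 / 10 * h\<^sup>2)\<^sup>2"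
    unfolding power_mult_distrib by (intro mult_right_mono) (auto simp: power2_eq_square)
  finally have "(\<Sum>i<k. sqrt (a i)) \<le> 31 / 10 * h\<^sup>2"
    by (rule power2_le_imp_le) simp
  moreover have "(h\<^sup>2)\<^sup>2 \<le> 11 / 100 * h\<^sup>2"
    using h2_le unfolding power2_eq_square[of "h\<^sup>2"] by (intro mult_right_mono) auto
  ultimately show ?thesis using S kL zero_le_power2[of h] by linarith
qed

lemma sqrt_kyl: "sqrt (real k * (real N / S) * l) = real N * h\<^sup>2 / sqrt S"
proof -
  have "real k * (real N / S) * l = (real N * h\<^sup>2)\<^sup>2 / S"
    using h4 by (simp add: power2_eq_square mult_ac)
  then show ?thesis by (simp only: real_sqrt_divide) simp
qed

lemma t_eq: "t = real N / S - (sqrt 2 + 2 / 3) * (real N * h\<^sup>2 / sqrt S)"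
  unfolding lrn_t_def Let_def sqrt_kyl ..

lemma t_le: "t \<le> real N"
proof -
  have "real N / S \<le> real N / 1" using S_ge by (intro divide_left_mono) auto
  moreover have "0 \<le> (sqrt 2 + 2 / 3) * (real N * h\<^sup>2 / sqrt S)" using S_ge by simp
  ultimately show ?thesis unfolding t_eq by simp
qed

lemma Nh_sqrt_S_le: "(sqrt 2 + 2 / 3) * (real N * h\<^sup>2 / sqrt S) \<le> 21 / 10 * (real N * h\<^sup>2)"
proof (intro mult_mono)
  have "real N * h\<^sup>2 / sqrt S \<le> real N * h\<^sup>2 / 1"
    using S_ge by (intro divide_left_mono) auto
  then show "real N * h\<^sup>2 / sqrt S \<le> real N * h\<^sup>2" by simp
qed (use sqrt_2_bounds S_ge in auto)

text \<open>The inflated estimates cost \<open>4.7 * h\<^sup>2\<close> because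
  \<open>1 / S \<ge> 2 - S\<close>, the subtracted margin costs \<open>2.1 * h\<^sup>2\<close>. At
  the largest \<open>h\<^sup>2\<close>, 0.11, a quarter of \<open>N\<close> is left.\<close>

lemma t_ge:
  assumes "2 \<le> k"
  shows "real N * (1 - 68 / 10 * h\<^sup>2) \<le> t" "real N / 4 \<le> t"
proof -
  have "2 - S \<le> 1 / S"
  proof -
    have "0 \<le> (S - 1) * (S - 1)" by simp
    then have "(2 - S) * S \<le> 1" by (simp add: algebra_simps)
    then show ?thesis using S_ge by (simp add: le_divide_eq)
  qed
  then have "1 - 47 / 10 * h\<^sup>2 \<le> 1 / S" using S_le[OF assms] by linarith
  then have "real N * (1 - 47 / 10 * h\<^sup>2) \<le> real N * (1 / S)" by (intro mult_left_mono) auto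
  then show 1: "real N * (1 - 68 / 10 * h\<^sup>2) \<le> t"
    using Nh_sqrt_S_le unfolding t_eq by (simp only: right_diff_distrib mult.left_commute) simp
  have "real N * (1 / 4) \<le> real N * (1 - 68 / 10 * h\<^sup>2)"
    using h2_le by (intro mult_left_mono) auto
  then show "real N / 4 \<le> t" using 1 by linarith
qed

lemma slack_ge:
  assumes "2 \<le> k"
  shows "16 / 10 * (real N * h\<^sup>2) \<le> real N - t"
proof -
  have "S \<le> (124 / 100)\<^sup>2" using S_le[OF assms] h2_le by (simp add: power2_eq_square)
  then have "sqrt S \<le> 124 / 100" by (intro real_le_lsqrt) auto
  then have "(real N * h\<^sup>2) / (124 / 100) \<le> real N * h\<^sup>2 / sqrt S"
    using S_ge by (intro divide_left_mono) auto
  then have "208 / 100 * ((real N * h\<^sup>2) / (124 / 100)) \<le> (sqrt 2 + 2 / 3) * (real N * h\<^sup>2 / sqrt S)"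
    using sqrt_2_bounds by (intro mult_mono) auto
  moreover have "real N / S \<le> real N / 1" using S_ge by (intro divide_left_mono) auto
  moreover have "16 / 10 * (real N * h\<^sup>2) \<le> 208 / 100 * ((real N * h\<^sup>2) / (124 / 100))" by simp
  moreover have "a \<le> N' - (y - p)" if "q \<le> p" "y \<le> N' / 1" "a \<le> q" for a q p y N' :: real
    using that by simp
  ultimately show ?thesis unfolding t_eq by blast
qed

text \<open>With one player \<open>S\<close> need not be close to 1, as \<open>l\<close> may be tiny
  compared with \<open>L\<close>. But only the product \<open>mh 0 * t = S * t\<close> matters:
  \<open>S\<close> cancels from its main term, and a constant bound on \<open>sqrt S\<close>
  controls the margin.\<close>

lemma single_player:
  assumes "k = 1"
  shows "real N * (1 - 68 / 10 * h\<^sup>2) \<le> mh 0 * t" "0 \<le> t"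
proof -
  have S: "S = mh 0" using assms by simp
  have w: "n 0 = w" using n assms by simp
  have "S = 1 + 3 * L / real w"
    unfolding S using w w_pos by (simp add: mu_hat_def)
  also have "3 * L / real w \<le> 32 / 10"
  proof -
    have "ln 3 \<le> (3 :: real) - 1" by (rule ln_le_minus_one) auto
    moreover have "l = ln (1 / \<delta>)" "L = ln 3 + ln (1 / \<delta>)" using \<delta> assms by (auto simp: ln_div)
    moreover have "l \<le> 3 / 84 * real w"
    proof -
      have "84 * l \<le> lrn_beta * l" using lrn_beta_ge l_pos by (intro mult_right_mono) auto
      then show ?thesis using active Nw assms by simp
    qed
    ultimately show ?thesis using w_pos by (simp add: divide_le_eq)
  qed
  finally have "S \<le> (21 / 10)\<^sup>2" by (simp add: power2_eq_square)
  then have sS: "sqrt S \<le> 21 / 10" by (intro real_le_lsqrt) auto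
  have SS: "S * (real N * h\<^sup>2 / sqrt S) = sqrt S * (real N * h\<^sup>2)"
    using S_ge by (simp add: field_simps)
  have "(sqrt 2 + 2 / 3) * sqrt S \<le> 21 / 10 * (21 / 10)"
    using sqrt_2_bounds sS S_ge by (intro mult_mono) auto
  then have "(sqrt 2 + 2 / 3) * sqrt S * (real N * h\<^sup>2) \<le> 68 / 10 * (real N * h\<^sup>2)"
    by (intro mult_right_mono) auto
  moreover have "S * t = real N - (sqrt 2 + 2 / 3) * sqrt S * (real N * h\<^sup>2)"
  proof -
    have "S * t = S * (real N / S) - (sqrt 2 + 2 / 3) * (S * (real N * h\<^sup>2 / sqrt S))"
      unfolding t_eq by (simp only: right_diff_distrib mult.left_commute)
    then show ?thesis unfolding SS using S_ge by simp
  qed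
  ultimately show 1: "real N * (1 - 68 / 10 * h\<^sup>2) \<le> mh 0 * t"
    unfolding S by (simp add: algebra_simps)
  have "0 \<le> real N * (1 - 68 / 10 * h\<^sup>2)" using h2_le by simp
  then have "0 \<le> S * t" using 1 S by simp
  then show "0 \<le> t" using S_ge by (simp add: zero_le_mult_iff)
qed

lemma t_nonneg: "0 \<le> t"
  using single_player(2) t_ge(2) k by (cases "k = 1") force+

end

text \<open>Counter value of player \<open>i\<close> at its first notification. The analysis of the dynamic algorithm
  uses only that a round does not end before the first notification.\<close>

definition guard :: "algorithm \<Rightarrow> nat \<Rightarrow> real \<Rightarrow> (nat \<Rightarrow> real) \<Rightarrow> nat \<Rightarrow> nat \<Rightarrow> real" where
  "guard A k \<delta> \<mu>h N i = (case A of
      StcSlk_LrnDst \<Rightarrow> upper_bound k \<delta> \<mu>h N i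
    | DynSlk_LrnDst \<Rightarrow> \<mu>h i * lrn_t k \<delta> \<mu>h N
        + real_of_int \<lfloor>(real N - lrn_t k \<delta> \<mu>h N) / (2 * real k)\<rfloor>)"

text \<open>The estimate of \<open>\<mu>\<^sub>i\<close> is only accurate up to \<open>sqrt (\<mu>\<^sub>i ln (k / \<delta>) / N0)\<close>, because the paper's
  \<open>ln (3 / \<delta>)\<close> does not allow for a union bound over the players. Only if \<open>N\<close> is small enough
  compared with \<open>N0\<close> is this error negligible against the slack.\<close>

definition fast_round :: "nat \<Rightarrow> real \<Rightarrow> nat \<Rightarrow> nat \<Rightarrow> bool" where
  "fast_round k \<delta> N0 N \<longleftrightarrow>
     real N * (15000 * max 1 (ln (real k / \<delta>)))\<^sup>2 \<le> real N0 \<and>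
     10 ^ 8 * (real k * ln (real k / \<delta>)) \<le> real N"

text \<open>A round is successful if it tracks more than \<open>target\<close> items.\<close>

definition target :: "nat \<Rightarrow> real \<Rightarrow> nat \<Rightarrow> nat \<Rightarrow> real" where
  "target k \<delta> N0 N =
     (if fast_round k \<delta> N0 N
      then real N * (1 - sqrt (sqrt (real k * ln (real k / \<delta>) / real N)))
      else real N / 50000)"

section \<open>Failure probability of a learned round\<close>

context active_round
begin

lemma no_notification:
  assumes "\<And>i. i < k \<Longrightarrow> real (c i) < guard A k \<delta> mh N i"
    and "learned_round A k \<delta> mh N = Threshold thr q"
  shows "notifications k thr q c = 0"
proof -
  have 0: "0 \<le> \<lfloor>(real N - t) / (2 * real k)\<rfloor>" using t_le by simp
  have "{j \<in> {1..q}. thr i j \<le> real (c i)} = {}" if "i < k" for i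
  proof (cases A)
    case StcSlk_LrnDst
    then show ?thesis using assms(1)[OF that] assms(2) by (auto simp: guard_def)
  next
    case DynSlk_LrnDst
    have "real (c i) < thr i j" if "1 \<le> j" for j
    proof -
      have "real_of_int \<lfloor>(real N - t) / (2 * real k)\<rfloor> \<le> real j * real_of_int \<lfloor>(real N - t) / (2 * real k)\<rfloor>"
        using 0 that by (simp add: mult_le_cancel_right1)
      then show ?thesis
        using assms(1)[OF \<open>i < k\<close>] assms(2) DynSlk_LrnDst by (auto simp: guard_def Let_def)
    qed
    then show ?thesis by fastforce
  qed
  then show ?thesis by (simp add: notifications_def)
qed

lemma l_ge:
  assumes "2 \<le> k"
  shows "69 / 100 \<le> l"
proof -
  have "ln 2 \<le> ln (real k)" using assms by (subst ln_le_cancel_iff) auto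
  moreover have "l = ln (real k) + ln (1 / \<delta>)" "0 \<le> ln (1 / \<delta>)"
    using k \<delta> by (auto simp: ln_div)
  ultimately show ?thesis using ln_2_ge by linarith
qed

text \<open>By \<open>slack_ge\<close> the dynamic slack is at least
  \<open>0.8 * N * h\<^sup>2 / k\<close>, which is \<open>0.8 * l / h\<^sup>2\<close> since
  \<open>k * l = N * h ^ 4\<close>. Rounding down costs at most
  \<open>1 \<le> 1.45 * l\<close>.\<close>

lemma guard_dyn_ge:
  assumes "2 \<le> k"
  shows "mh i * t + (8 / 10 * (l / h\<^sup>2) - 145 / 100 * l) \<le> guard DynSlk_LrnDst k \<delta> mh N i"
proof -
  have kN: "real N * h\<^sup>2 = real k * (l / h\<^sup>2)"
    using h4 h_pos by (simp add: field_simps power2_eq_square)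
  have "8 / 10 * (l / h\<^sup>2) * (2 * real k) \<le> real N - t"
    using slack_ge[OF assms] unfolding kN by (simp add: mult_ac)
  then have "8 / 10 * (l / h\<^sup>2) \<le> (real N - t) / (2 * real k)"
    using k by (simp only: le_divide_eq) simp
  moreover have "(real N - t) / (2 * real k) - 1 \<le> real_of_int \<lfloor>(real N - t) / (2 * real k)\<rfloor>"
    by linarith
  moreover have "1 \<le> 145 / 100 * l" using l_ge[OF assms] by simp
  ultimately show ?thesis unfolding guard_def algorithm.case by linarith
qed

lemma guard_stc_ge:
  assumes "i < k"
  shows "mh i * t + 2 / 3 * l \<le> guard StcSlk_LrnDst k \<delta> mh N i"
  using t_nonneg mh_bounds(2)[OF assms] l_pos by (simp add: guard_def upper_bound_def Let_def)

lemma guard_ge: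
  assumes "2 \<le> k" "i < k"
  shows "mh i * t + 2 / 3 * l \<le> guard A k \<delta> mh N i"
proof (cases A)
  case StcSlk_LrnDst
  then show ?thesis using guard_stc_ge[OF assms(2)] by simp
next
  case DynSlk_LrnDst
  have "l * (100 / 11) \<le> l * (1 / h\<^sup>2)"
    using h2_le h_pos l_pos by (intro mult_left_mono) (auto simp: field_simps)
  then show ?thesis using DynSlk_LrnDst guard_dyn_ge[OF assms(1), of i] l_pos by simp
qed

lemma k_exp: "real k * exp (- l) = \<delta>"
  using k \<delta> by (simp add: exp_minus)

text \<open>An exponent \<open>2 * l\<close> has the factor 0.99 to spare. Only the fast rounds of
  the static algorithm, whose slack is tuned to the exponent \<open>l\<close>, require
  \<open>tail_static\<close>.\<close>

lemma exp_2l_le: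
  assumes "2 \<le> k"
  shows "exp (- (2 * l)) \<le> 99 / 100 * exp (- l)"
proof -
  have "exp (- l) = \<delta> / real k" using k \<delta> by (simp add: exp_minus)
  also have "\<dots> \<le> 99 / 100" using assms \<delta> by (simp add: field_simps)
  finally have "exp (- l) * exp (- l) \<le> 99 / 100 * exp (- l)" by (intro mult_right_mono) auto
  then show ?thesis by (simp add: exp_add[symmetric])
qed

text \<open>The guard is at least 80 times the mean of the counter, so Chernoff with
  \<open>\<theta> = 4\<close> gives an exponent of at most \<open>- 3\<close> times the guard, hence
  at most \<open>- 2 * l\<close>. If \<open>\<mu> * N0 \<ge> 400 * l\<close>, the estimate is at
  least \<open>\<mu> / 2\<close>; otherwise the mean is at most \<open>l / 125\<close>, and the term
  \<open>2 / 3 * l\<close> of the guard suffices. This fixes the constant 50000.\<close>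

lemma tail_constant:
  assumes k2: "2 \<le> k" and i: "i < k" and \<mu>: "0 \<le> \<mu>" "\<mu> \<le> 1"
    and good: "\<mu> - 10 * sqrt (\<mu> * l / real N0) \<le> mh i"
    and T: "real T \<le> real N / 50000"
  shows "tail \<mu> T (guard A k \<delta> mh N i) \<le> 99 / 100 * exp (- l)"
proof -
  let ?g = "guard A k \<delta> mh N i"
  have N0: "0 < N0" using N_pos NN0 by linarith
  have b: "0 \<le> mh i * t" using mh_bounds(2)[OF i] t_nonneg by simp
  have M: "real T * \<mu> \<le> real N / 50000 * \<mu>" using T \<mu> by (intro mult_right_mono) auto
  have "80 * (real T * \<mu>) \<le> ?g"
  proof (cases "400 * l \<le> \<mu> * real N0")
    case True
    have "\<mu> * l / real N0 \<le> (\<mu> / 20)\<^sup>2"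
    proof -
      have "\<mu> * (400 * l) \<le> \<mu> * (\<mu> * real N0)" using True \<mu> by (intro mult_left_mono) auto
      then show ?thesis using N0 by (simp add: field_simps power2_eq_square)
    qed
    then have "sqrt (\<mu> * l / real N0) \<le> \<mu> / 20" using \<mu> by (intro real_le_lsqrt) auto
    then have "\<mu> / 2 \<le> mh i" using good by linarith
    then have "\<mu> / 2 * (real N / 4) \<le> mh i * t"
      using t_ge(2)[OF k2] \<mu> mh_bounds(2)[OF i] by (intro mult_mono) auto
    moreover have "0 \<le> \<mu> * real N" using \<mu> by simp
    ultimately show ?thesis using M guard_ge[OF k2 i, of A] l_pos by (simp add: mult.commute)
  next
    case False
    have "\<mu> * real N \<le> \<mu> * real N0" using NN0 \<mu> by (intro mult_left_mono) auto
    then show ?thesis using False M guard_ge[OF k2 i, of A] l_pos b by (simp add: mult.commute)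
  qed
  moreover have "real T * \<mu> * (exp 4 - 1) \<le> real T * \<mu> * 80"
    using \<mu> exp_4_le by (intro mult_left_mono) auto
  ultimately have "real T * \<mu> * (exp 4 - 1) - 4 * ?g \<le> - (2 * l)"
    using guard_ge[OF k2 i, of A] b by linarith
  then have "tail \<mu> T ?g \<le> exp (- (2 * l))"
    using tail_chernoff[OF \<mu>, of 4 T ?g] by (smt (verit) exp_le_cancel_iff)
  then show ?thesis using exp_2l_le[OF k2] by linarith
qed

lemma fast_h:
  assumes "fast_round k \<delta> N0 N"
  shows "h \<le> 1 / 100"
proof -
  have "10 ^ 8 * (real N * (h\<^sup>2)\<^sup>2) \<le> real N"
    using assms unfolding fast_round_def h4[symmetric] by simp
  then have "real N * (10 ^ 8 * (h\<^sup>2)\<^sup>2) \<le> real N * 1" by simp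
  then have "10 ^ 8 * (h\<^sup>2)\<^sup>2 \<le> 1" using N_pos by (simp only: mult_le_cancel_left_pos of_nat_0_less_iff)
  then have "(h\<^sup>2)\<^sup>2 \<le> ((1 / 100)\<^sup>2)\<^sup>2" by (simp add: power2_eq_square[of "1/100"] power2_eq_square[of "1/10000"])
  then have "h\<^sup>2 \<le> (1 / 100)\<^sup>2" by (rule power2_le_imp_le) simp
  then show ?thesis by (rule power2_le_imp_le) simp
qed

lemma t_fast:
  assumes "2 \<le> k" "fast_round k \<delta> N0 N"
  shows "real N * (1 - h / 2) \<le> t"
proof -
  have "h * h \<le> h * (1 / 100)" using fast_h[OF assms(2)] h_pos by (intro mult_left_mono) auto
  then have "real N * (1 - h / 2) \<le> real N * (1 - 68 / 10 * h\<^sup>2)"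
    using h_pos by (intro mult_left_mono) (auto simp: power2_eq_square)
  then show ?thesis using t_ge(1)[OF assms(1)] by linarith
qed

text \<open>Over \<open>t\<close> items the error of the estimate is the fluctuation scale
  \<open>sqrt (\<mu> * t * l)\<close> times \<open>sqrt (t / N0)\<close>; \<open>fast_round\<close>
  makes the latter factor small.\<close>

lemma mh_t_ge:
  assumes "i < k" "0 \<le> \<mu>" and good: "\<mu> - 10 * sqrt (\<mu> * l / real N0) \<le> mh i"
  shows "\<mu> * t - 10 * sqrt (t / real N0) * sqrt (\<mu> * t * l) \<le> mh i * t"
proof -
  have "(\<mu> - 10 * sqrt (\<mu> * l / real N0)) * t \<le> mh i * t"
    using good t_nonneg by (intro mult_right_mono) auto
  moreover have "sqrt (\<mu> * l / real N0) * t = sqrt (t / real N0) * sqrt (\<mu> * t * l)"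
  proof -
    have "sqrt (t / real N0) * sqrt (\<mu> * t * l) = sqrt (\<mu> * l / real N0 * t\<^sup>2)"
      by (simp add: real_sqrt_mult[symmetric] power2_eq_square mult_ac)
    also have "\<dots> = sqrt (\<mu> * l / real N0) * sqrt (t\<^sup>2)"
      by (rule real_sqrt_mult)
    finally show ?thesis using t_nonneg by simp
  qed
  ultimately show ?thesis by (simp add: algebra_simps)
qed

text \<open>Fluctuation and estimation error together are at most \<open>12 * B\<close>. By AM-GM
  this is at most \<open>\<mu> * N * h / 2\<close>, the difference of the means at \<open>t\<close>
  and at the target, plus \<open>72 * l / h\<close>, which the slack of order
  \<open>l / h\<^sup>2\<close> covers for \<open>h \<le> 1 / 100\<close>.\<close>

lemma tail_dynamic:
  assumes k2: "2 \<le> k" and i: "i < k" and \<mu>: "0 \<le> \<mu>" "\<mu> \<le> 1"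
    and good: "\<mu> - 10 * sqrt (\<mu> * l / real N0) \<le> mh i"
    and fast: "fast_round k \<delta> N0 N" and T: "real T \<le> real N * (1 - h)"
  shows "tail \<mu> T (guard DynSlk_LrnDst k \<delta> mh N i) \<le> 99 / 100 * exp (- l)"
proof -
  have N0: "0 < real N0" "real N \<le> real N0" using N_pos NN0 by auto
  define B where "B = sqrt (\<mu> * real N) * sqrt l"
  have sq: "sqrt (a * l) \<le> B" if "a \<le> \<mu> * real N" for a
    using that l_pos by (auto simp: B_def real_sqrt_mult[symmetric])
  have "sqrt (t / real N0) * sqrt (\<mu> * t * l) \<le> 1 * B"
  proof (rule mult_mono)
    show "sqrt (t / real N0) \<le> 1" using t_le N0 by simp
    show "sqrt (\<mu> * t * l) \<le> B" using t_le \<mu> by (intro sq mult_left_mono) auto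
    show "0 \<le> (1 :: real)" by simp
  qed (use t_nonneg \<mu> l_pos in auto)
  then have 1: "\<mu> * t - 10 * B \<le> mh i * t" using mh_t_ge[OF i \<mu>(1) good] by linarith
  have 2: "\<mu> * (real N * (1 - h / 2)) \<le> \<mu> * t" using t_fast[OF k2 fast] \<mu> by (intro mult_left_mono) auto
  have 3: "real T * \<mu> \<le> real N * (1 - h) * \<mu>" using T \<mu> by (intro mult_right_mono) auto
  have 4: "sqrt (2 * (real T * \<mu>) * (2 * l)) \<le> 2 * B"
  proof -
    have "real T * \<mu> \<le> \<mu> * real N"
    proof -
      have "0 \<le> \<mu> * real N * h" using \<mu> h_pos by simp
      then show ?thesis using 3 by (simp add: algebra_simps)
    qed
    moreover have "sqrt (2 * (real T * \<mu>) * (2 * l)) = 2 * sqrt ((real T * \<mu>) * l)"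
      using real_sqrt_mult[of 4 "real T * \<mu> * l"] by (simp add: mult_ac)
    ultimately show ?thesis using sq[of "real T * \<mu>"] by simp
  qed
  have 5: "12 * B \<le> \<mu> * real N * h / 2 + 72 * (l / h)"
  proof -
    have "0 \<le> (sqrt (\<mu> * real N) * h - 12 * sqrt l)\<^sup>2 / (2 * h)" using h_pos by simp
    also have "(sqrt (\<mu> * real N) * h - 12 * sqrt l)\<^sup>2
        = (sqrt (\<mu> * real N))\<^sup>2 * h\<^sup>2 - 24 * B * h + 144 * (sqrt l)\<^sup>2"
      by (simp add: B_def power2_eq_square algebra_simps)
    also have "\<dots> / (2 * h) = \<mu> * real N * h / 2 - 12 * B + 72 * (l / h)"
      using h_pos \<mu> l_pos by (simp add: field_simps power2_eq_square)
    finally show ?thesis by simp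
  qed
  have 6: "72 * (l / h) + 4 / 3 * l \<le> 8 / 10 * (l / h\<^sup>2) - 145 / 100 * l"
  proof -
    define g where "g = 1 / h"
    have g: "100 \<le> g" using fast_h[OF fast] h_pos by (simp add: g_def field_simps)
    have "100 * g \<le> g * g" using g by (intro mult_right_mono) auto
    then have "72 * g + 4 / 3 \<le> 8 / 10 * (g * g) - 145 / 100" using g by linarith
    then have "l * (72 * g + 4 / 3) \<le> l * (8 / 10 * (g * g) - 145 / 100)"
      using l_pos by (intro mult_left_mono) auto
    then show ?thesis by (simp add: g_def algebra_simps power2_eq_square)
  qed
  have "tail \<mu> T (guard DynSlk_LrnDst k \<delta> mh N i) \<le> exp (- (2 * l))"
  proof (rule tail_bernstein[OF \<mu>])
    show "0 \<le> 2 * l" using l_pos by simp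
    have "real T * \<mu> + 2 * B + 2 / 3 * (2 * l) \<le> guard DynSlk_LrnDst k \<delta> mh N i"
      using 1 2 3 5 6 guard_dyn_ge[OF k2, of i] by (simp add: algebra_simps)
    then show "real T * \<mu> + sqrt (2 * (real T * \<mu>) * (2 * l)) + 2 / 3 * (2 * l)
        \<le> guard DynSlk_LrnDst k \<delta> mh N i"
      using 4 by linarith
  qed
  then show ?thesis using exp_2l_le[OF k2] by linarith
qed

lemma tail_static_slack:
  assumes k2: "2 \<le> k" and i: "i < k" and \<mu>: "0 \<le> \<mu>" "\<mu> \<le> 1"
    and good: "\<mu> - 10 * sqrt (\<mu> * l / real N0) \<le> mh i"
    and fast: "fast_round k \<delta> N0 N" and T: "real T \<le> real N * (1 - h)"
  shows "tail \<mu> T (guard StcSlk_LrnDst k \<delta> mh N i) \<le> 99 / 100 * exp (- l)"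
proof -
  have N0: "0 < real N0" "real N \<le> real N0" using N_pos NN0 by auto
  define \<zeta> where "\<zeta> = sqrt (t / real N0)"
  \<comment> \<open>The root of the estimated mean calls for
    \<open>20 * \<zeta> * (0.71 * Q) \<le> \<epsilon> * Q\<close> below. The 15000 of
    \<open>fast_round\<close> is 15 times the 1000 of \<open>tail_static\<close>.\<close>
  define \<epsilon> where "\<epsilon> = 15 * \<zeta>"
  have \<zeta>: "0 \<le> \<zeta>" using t_nonneg by (simp add: \<zeta>_def)
  have \<zeta>2: "\<zeta> * (15000 * max 1 l) \<le> 1"
  proof -
    have "t * (15000 * max 1 l)\<^sup>2 \<le> real N * (15000 * max 1 l)\<^sup>2"
      using t_le by (intro mult_right_mono) auto
    also have "\<dots> \<le> real N0" using fast by (simp add: fast_round_def)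
    finally have "t / real N0 * (15000 * max 1 l)\<^sup>2 \<le> 1" using N0 by (simp add: field_simps)
    moreover have "(\<zeta> * (15000 * max 1 l))\<^sup>2 = t / real N0 * (15000 * max 1 l)\<^sup>2"
      using t_nonneg by (simp add: \<zeta>_def power_mult_distrib)
    ultimately have "(\<zeta> * (15000 * max 1 l))\<^sup>2 \<le> 1\<^sup>2" by simp
    then show ?thesis by (rule power2_le_imp_le) simp
  qed
  have \<epsilon>: "0 \<le> \<epsilon>" "\<epsilon> \<le> 1 / 1000" "\<epsilon> * l \<le> 1 / 1000"
  proof -
    have "\<zeta> * 15000 * 1 \<le> \<zeta> * 15000 * max 1 l" "\<zeta> * 15000 * l \<le> \<zeta> * 15000 * max 1 l"
      by (rule mult_left_mono, use \<zeta> in simp_all)+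
    then show "\<epsilon> \<le> 1 / 1000" "\<epsilon> * l \<le> 1 / 1000" using \<zeta>2 by (auto simp: \<epsilon>_def mult_ac)
  qed (use \<zeta> in \<open>simp add: \<epsilon>_def\<close>)
  define Q where "Q = sqrt (2 * (\<mu> * t) * l)"
  have Q: "0 \<le> Q" "Q\<^sup>2 = 2 * (\<mu> * t) * l" using \<mu> t_nonneg l_pos by (auto simp: Q_def)
  have sQ: "sqrt (\<mu> * t * l) \<le> 71 / 100 * Q"
  proof -
    have "2 * \<mu> * t * l = 2 * (\<mu> * t * l)" by simp
    then have "Q = sqrt 2 * sqrt (\<mu> * t * l)" by (simp add: Q_def real_sqrt_mult mult_ac)
    moreover have "100 / 71 * sqrt (\<mu> * t * l) \<le> sqrt 2 * sqrt (\<mu> * t * l)"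
      using sqrt_2_bounds \<mu> t_nonneg l_pos by (intro mult_right_mono) auto
    ultimately show ?thesis by simp
  qed
  have \<zeta>Q: "10 * \<zeta> * sqrt (\<mu> * t * l) \<le> \<epsilon> * Q"
  proof -
    have "10 * \<zeta> * sqrt (\<mu> * t * l) \<le> 10 * \<zeta> * (71 / 100 * Q)"
      using sQ \<zeta> by (intro mult_left_mono) auto
    also have "\<dots> \<le> \<epsilon> * Q" using \<zeta> Q by (simp add: \<epsilon>_def mult_right_mono)
    finally show ?thesis .
  qed
  have b: "\<mu> * t - 10 * \<zeta> * sqrt (\<mu> * t * l) \<le> mh i * t"
    using mh_t_ge[OF i \<mu>(1) good] by (simp add: \<zeta>_def)
  have root: "Q - \<epsilon> * l \<le> sqrt (2 * t * mh i * l)"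
  proof (cases "Q \<le> \<epsilon> * l")
    case True
    have "0 \<le> sqrt (2 * t * mh i * l)" using t_nonneg mh_bounds(2)[OF i] l_pos by simp
    then show ?thesis using True by linarith
  next
    case False
    have "(\<epsilon> * l) * (\<epsilon> * l) \<le> (\<epsilon> * l) * Q" using False \<epsilon> l_pos by (intro mult_left_mono) auto
    then have "(Q - \<epsilon> * l)\<^sup>2 \<le> Q\<^sup>2 - \<epsilon> * l * Q"
      by (simp add: power2_eq_square algebra_simps)
    also have "\<epsilon> * l * Q \<ge> 20 * \<zeta> * l * sqrt (\<mu> * t * l)"
    proof -
      have "20 * \<zeta> * l * sqrt (\<mu> * t * l) \<le> 20 * \<zeta> * l * (71 / 100 * Q)"
        using sQ \<zeta> l_pos by (intro mult_left_mono) auto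
      also have "\<dots> \<le> \<epsilon> * l * Q" using \<zeta> Q l_pos by (simp add: \<epsilon>_def mult_ac)
      finally show ?thesis .
    qed
    then have "Q\<^sup>2 - \<epsilon> * l * Q \<le> 2 * l * (\<mu> * t - 10 * \<zeta> * sqrt (\<mu> * t * l))"
      unfolding Q(2) by (simp add: algebra_simps)
    also have "\<dots> \<le> 2 * l * (mh i * t)" using b l_pos by (intro mult_left_mono) auto
    finally have "(Q - \<epsilon> * l)\<^sup>2 \<le> 2 * t * mh i * l" by (simp add: mult_ac)
    then show ?thesis by (rule real_le_rsqrt)
  qed
  have tT: "real T \<le> t"
  proof -
    have "real N * (1 - h) \<le> real N * (1 - h / 2)" using h_pos by (intro mult_left_mono) auto
    then show ?thesis using t_fast[OF k2 fast] T by linarith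
  qed
  have M: "real T * \<mu> \<le> \<mu> * t" using tT \<mu> by (simp add: mult.commute mult_left_mono)
  show ?thesis
  proof (rule tail_static[OF \<mu> l_ge[OF k2] \<epsilon>])
    have "2 * (real T * \<mu>) * l \<le> 2 * (\<mu> * t) * l" using M l_pos by (intro mult_right_mono mult_left_mono) auto
    then have "sqrt (2 * (real T * \<mu>) * l) \<le> Q" unfolding Q_def by (rule real_sqrt_le_mono)
    then have "(1 - \<epsilon>) * sqrt (2 * (real T * \<mu>) * l) \<le> (1 - \<epsilon>) * Q"
      using \<epsilon> by (intro mult_left_mono) auto
    then have "real T * \<mu> + (1 - \<epsilon>) * sqrt (2 * (real T * \<mu>) * l) + (2 / 3 - \<epsilon>) * l
      \<le> (\<mu> * t - \<epsilon> * Q) + (Q - \<epsilon> * l) + 2 / 3 * l"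
      using M by (simp add: algebra_simps)
    also have "\<dots> \<le> guard StcSlk_LrnDst k \<delta> mh N i"
      using b \<zeta>Q root by (simp add: guard_def upper_bound_def Let_def)
    finally show "real T * \<mu> + (1 - \<epsilon>) * sqrt (2 * (real T * \<mu>) * l) + (2 / 3 - \<epsilon>) * l
      \<le> guard StcSlk_LrnDst k \<delta> mh N i" .
  qed
qed

text \<open>A union bound over the players, with \<open>k * exp (- l) = \<delta>\<close>. A single
  player has a deterministic counter, and the target lies below its guard.\<close>

lemma guard_tail:
  assumes \<mu>: "\<And>i. 0 \<le> \<mu> i" "\<And>i. \<mu> i \<le> 1" and sum: "(\<Sum>i<k. \<mu> i) = 1"
    and good: "\<And>i. i < k \<Longrightarrow> \<mu> i - 10 * sqrt (\<mu> i * l / real N0) \<le> mh i"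
    and T: "real T \<le> target k \<delta> N0 N"
  shows "(\<Sum>i<k. tail (\<mu> i) T (guard A k \<delta> mh N i)) \<le> 99 / 100 * \<delta>"
proof (cases "k = 1")
  case True
  have "real T < mh 0 * t"
  proof -
    have "target k \<delta> N0 N < real N * (1 - 68 / 10 * h\<^sup>2)"
    proof (cases "fast_round k \<delta> N0 N")
      case True
      have "h * h \<le> h * (1 / 100)" using fast_h[OF True] h_pos by (intro mult_left_mono) auto
      then have "68 / 10 * h\<^sup>2 < h" using h_pos by (simp add: power2_eq_square)
      then show ?thesis using True N_pos by (simp add: target_def h_def)
    next
      case False
      then show ?thesis using h2_le N_pos by (simp add: target_def field_simps)
    qed
    then show ?thesis using T single_player(1)[OF True] by linarith
  qed
  also have "mh 0 * t \<le> guard A k \<delta> mh N 0"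
  proof (cases A)
    case StcSlk_LrnDst
    then show ?thesis using guard_stc_ge[of 0] l_pos True by simp
  next
    case DynSlk_LrnDst
    then show ?thesis using t_le by (simp add: guard_def)
  qed
  finally show ?thesis using True sum \<delta> by (simp add: tail_certain)
next
  case False
  then have k2: "2 \<le> k" using k by simp
  have "tail (\<mu> i) T (guard A k \<delta> mh N i) \<le> 99 / 100 * exp (- l)" if "i < k" for i
  proof (cases "fast_round k \<delta> N0 N")
    case True
    then have "real T \<le> real N * (1 - h)" using T by (simp add: target_def h_def)
    then show ?thesis
      using tail_static_slack[OF k2 that \<mu> good[OF that] True]
        tail_dynamic[OF k2 that \<mu> good[OF that] True] by (cases A) auto
  next
    case False
    then show ?thesis using T tail_constant[OF k2 that \<mu> good[OF that]] by (simp add: target_def)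
  qed
  then have "(\<Sum>i<k. tail (\<mu> i) T (guard A k \<delta> mh N i)) \<le> (\<Sum>i<k. 99 / 100 * exp (- l))"
    by (intro sum_mono) auto
  also have "\<dots> = 99 / 100 * (real k * exp (- l))" by simp
  also have "\<dots> = 99 / 100 * \<delta>" by (simp only: k_exp)
  finally show ?thesis .
qed

end

section \<open>Counting successful rounds\<close>

lemma ln_max_exp_ge: "exp 1 \<le> ln (max (x :: real) (exp (exp 1)))"
proof -
  have "ln (exp (exp 1)) \<le> ln (max x (exp (exp 1)))"
    by (subst ln_le_cancel_iff) (auto simp: less_max_iff_disj)
  then show ?thesis by simp
qed

lemma ln_max_exp_pos: "0 < ln (max (x :: real) (exp (exp 1)))"
  using ln_max_exp_ge[of x] exp_gt_zero[of "1 :: real"] by linarith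

lemma loglog_ge_1: "1 \<le> loglog x"
  unfolding loglog_def using ln_max_exp_ge by (subst ln_ge_iff[OF ln_max_exp_pos])

lemma loglog_le:
  assumes "0 < y" "exp 1 \<le> y" "0 < x \<Longrightarrow> ln x \<le> y"
  shows "loglog x \<le> ln y"
proof -
  have "ln (max x (exp (exp 1))) \<le> y"
  proof (cases "x \<le> exp (exp 1)")
    case False
    then have "0 < x" using exp_gt_zero[of "exp 1"] by linarith
    then show ?thesis using False assms by (simp add: max_def)
  qed (use assms in \<open>simp add: max_def\<close>)
  then show ?thesis
    unfolding loglog_def using ln_max_exp_pos assms(1) by (subst ln_le_cancel_iff) auto
qed

lemma loglog_mono:
  assumes "x \<le> y"
  shows "loglog x \<le> loglog y"
proof -
  have "ln (max x (exp (exp 1))) \<le> ln (max y (exp (exp 1)))"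
    using assms by (subst ln_le_cancel_iff) (auto simp: less_max_iff_disj intro: max.mono)
  then show ?thesis
    unfolding loglog_def using ln_max_exp_pos by (subst ln_le_cancel_iff) auto
qed

lemma loglog_eq:
  assumes "exp (exp 1) \<le> x"
  shows "loglog x = ln (ln x)"
  using assms by (simp add: loglog_def max_def)

lemma ln_max_le_loglog:
  assumes "0 < x"
  shows "ln (max 1 (ln x)) \<le> loglog x"
proof -
  have "1 \<le> ln (max x (exp (exp 1)))"
    using ln_max_exp_ge[of x] exp_ge_add_one_self[of "1 :: real"] by linarith
  moreover have "ln x \<le> ln (max x (exp (exp 1)))"
    using assms by (subst ln_le_cancel_iff) (auto simp: less_max_iff_disj)
  ultimately show ?thesis
    unfolding loglog_def using ln_max_exp_pos by (subst ln_le_cancel_iff) (auto simp: less_max_iff_disj)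
qed

lemma exp_exp_1_le: "exp (exp 1) \<le> (81 :: real)" "4 \<le> x \<Longrightarrow> exp 1 + 1 / 50000 \<le> (x :: real)"
proof -
  have "exp (exp 1) \<le> exp (4 :: real)" using exp_le by simp
  then show "exp (exp 1) \<le> (81 :: real)" using exp_4_le by linarith
  show "4 \<le> x \<Longrightarrow> exp 1 + 1 / 50000 \<le> (x :: real)" using exp_le by linarith
qed

lemma ln_ge_4:
  assumes "81 \<le> (x :: real)"
  shows "4 \<le> ln x"
  using assms exp_4_le by (subst ln_ge_iff) auto

lemma ln_10_pow_8: "ln (10 ^ 8) \<le> (20 :: real)"
proof -
  have "13 / 8 \<le> exp (1 / 2 :: real)"
    using exp_lower_Taylor_quadratic[of "1 / 2"] by (simp add: power2_eq_square)
  then have "(13 / 8) ^ 40 \<le> exp (1 / 2 :: real) ^ 40" by (intro power_mono) auto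
  moreover have "(10 ^ 8 :: real) \<le> (13 / 8) ^ 40" by (simp add: power_divide)
  ultimately have "(10 ^ 8 :: real) \<le> exp 20" by (simp add: exp_of_nat_mult[symmetric])
  then have "ln (10 ^ 8) \<le> ln (exp 20 :: real)" by (subst ln_le_cancel_iff) auto
  then show ?thesis by simp
qed

text \<open>The number of successful rounds that are still needed. A successful round either shrinks
  \<open>N\<close> by a constant factor, which the first summand records until the estimates are accurate
  relative to \<open>N\<close>, or takes the ratio \<open>x = N / (k ln (k / \<delta>))\<close> to \<open>x\<^bsup>3/4\<^esup>\<close>.\<close>

definition rounds_left :: "nat \<Rightarrow> real \<Rightarrow> nat \<Rightarrow> nat \<Rightarrow> real" where
  "rounds_left k \<delta> N0 N =
     50000 * max 0 (ln (2 * real N * (15000 * max 1 (ln (real k / \<delta>)))\<^sup>2 / real N0))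
     + 10 ^ 6 * loglog (real N / (real k * ln (real k / \<delta>)))"

lemma rounds_left_ge_1: "1 \<le> rounds_left k \<delta> N0 N"
  using loglog_ge_1[of "real N / (real k * ln (real k / \<delta>))"] by (simp add: rounds_left_def add_increasing)

lemma rounds_left_mono:
  assumes "0 < N'" "N' \<le> N" "0 < N0" "1 \<le> k" "0 < \<delta>" "\<delta> < 1"
  shows "rounds_left k \<delta> N0 N' \<le> rounds_left k \<delta> N0 N"
proof -
  have "0 < ln (real k / \<delta>)" using assms by (intro ln_gt_zero) (auto simp: field_simps)
  then have "loglog (real N' / (real k * ln (real k / \<delta>))) \<le> loglog (real N / (real k * ln (real k / \<delta>)))"
    using assms by (intro loglog_mono divide_right_mono) auto
  moreover have "ln (2 * real N' * (15000 * max 1 (ln (real k / \<delta>)))\<^sup>2 / real N0)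
      \<le> ln (2 * real N * (15000 * max 1 (ln (real k / \<delta>)))\<^sup>2 / real N0)"
    using assms by (subst ln_le_cancel_iff) (auto intro!: divide_right_mono mult_right_mono)
  ultimately show ?thesis unfolding rounds_left_def by (intro add_mono mult_left_mono max.mono) auto
qed

context active_round
begin

text \<open>A fast round gives \<open>x' \<le> x * h = x powr (3 / 4)\<close>, so
  \<open>loglog\<close> drops by at least 1/4. A slow round shrinks \<open>N\<close> by the factor
  \<open>1 - 1 / 50000\<close>. If the estimates are too crude, the first summand pays with its
  weight 50000; if instead \<open>x \<le> 10 ^ 8\<close>, then \<open>ln x \<le> 20\<close> and
  \<open>loglog\<close> drops by \<open>1 / (50000 * 20)\<close>, whence the weight
  \<open>10 ^ 6\<close>.\<close>

lemma rounds_left_drop: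
  assumes N': "0 < N'" "real N' \<le> real N - target k \<delta> N0 N"
  shows "rounds_left k \<delta> N0 N' \<le> rounds_left k \<delta> N0 N - 1"
proof -
  define x where "x = real N / (real k * l)"
  define x' where "x' = real N' / (real k * l)"
  have kl: "0 < real k * l" using k l_pos by simp
  have N0: "0 < N0" using N_pos NN0 by linarith
  have pos: "0 < x" "0 < x'" using kl N_pos N' by (auto simp: x_def x'_def)
  \<comment> \<open>As \<open>81 \<ge> exp 4\<close>, both \<open>ln x\<close> and
    \<open>3 / 4 * ln x\<close> exceed \<open>exp 1\<close>, so the cut-off in \<open>loglog\<close>
    does not hide the drop.\<close>
  have "84 * (real k * l) \<le> lrn_beta * (real k * l)"
    using lrn_beta_ge kl by (intro mult_right_mono) auto
  then have x81: "81 \<le> x"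
    using active(2) kl by (simp add: x_def le_divide_eq mult.assoc)
  have lnx: "4 \<le> ln x" by (rule ln_ge_4[OF x81])
  have LLx: "loglog x = ln (ln x)" using exp_exp_1_le x81 by (intro loglog_eq) linarith
  define F where "F N = max 0 (ln (2 * real N * (15000 * max 1 l)\<^sup>2 / real N0))" for N :: nat
  have R: "rounds_left k \<delta> N0 N = 50000 * F N + 10 ^ 6 * loglog x"
    "rounds_left k \<delta> N0 N' = 50000 * F N' + 10 ^ 6 * loglog x'"
    by (simp_all add: rounds_left_def F_def x_def x'_def)
  have N'N: "N' \<le> N"
  proof -
    have "0 \<le> target k \<delta> N0 N"
    proof (cases "fast_round k \<delta> N0 N")
      case True
      have "0 \<le> real N * (1 - h)" using fast_h[OF True] by simp
      then show ?thesis using True by (simp add: target_def h_def)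
    qed (simp add: target_def)
    then show ?thesis using N' by linarith
  qed
  have Fmono: "F N' \<le> F N"
  proof -
    have "ln (2 * real N' * (15000 * max 1 l)\<^sup>2 / real N0) \<le> ln (2 * real N * (15000 * max 1 l)\<^sup>2 / real N0)"
      using N' N'N N0 by (subst ln_le_cancel_iff) (auto intro!: divide_right_mono mult_right_mono)
    then show ?thesis unfolding F_def by linarith
  qed
  have Lmono: "loglog x' \<le> loglog x"
    using N'N kl by (auto simp: x_def x'_def intro!: loglog_mono divide_right_mono)
  show ?thesis
  proof (cases "fast_round k \<delta> N0 N")
    case True
    then have "real N' \<le> real N * h" using N' by (simp add: target_def h_def algebra_simps)
    then have "x' \<le> x * h" using kl by (simp add: x_def x'_def divide_right_mono)
    then have "ln x' \<le> ln (x * h)" using pos h_pos by (subst ln_le_cancel_iff) auto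
    also have "\<dots> = ln x + ln h" using pos h_pos by (simp add: ln_mult)
    also have "ln h = - ln x / 4"
    proof -
      have "real k * l / real N = inverse x" using kl N_pos by (simp add: x_def field_simps)
      then show ?thesis using pos by (simp add: h_def ln_sqrt ln_inverse)
    qed
    finally have "ln x' \<le> 3 / 4 * ln x" by simp
    then have "loglog x' \<le> ln (3 / 4 * ln x)"
      using lnx exp_le by (intro loglog_le) auto
    also have "\<dots> = ln (3 / 4) + ln (ln x)" using lnx by (subst ln_mult) auto
    also have "ln (3 / 4 :: real) \<le> 3 / 4 - 1" by (rule ln_le_minus_one) simp
    finally show ?thesis using Fmono R LLx by simp
  next
    case False
    then have N'c: "real N' \<le> real N * (1 - 1 / 50000)" using N' by (simp add: target_def)
    have lnc: "ln (1 - 1 / 50000 :: real) \<le> - 1 / 50000"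
      using ln_le_minus_one[of "1 - 1 / 50000 :: real"] by simp
    show ?thesis
    proof (cases "real N * (15000 * max 1 l)\<^sup>2 \<le> real N0")
      case cond: False
      define a where "a = (15000 * max 1 l)\<^sup>2 / real N0"
      have a: "0 < a" using N0 by (simp add: a_def)
      have F: "F N = max 0 (ln (2 * real N * a))" for N by (simp add: F_def a_def)
      have "1 < real N * a" using cond N0 by (simp add: a_def field_simps)
      \<comment> \<open>The factor 2 inside the logarithm keeps its value at least
        \<open>ln 2\<close> here, so the truncation at 0 cannot swallow the decrease.\<close>
      then have "2 \<le> 2 * real N * a" by simp
      then have "ln 2 \<le> ln (2 * real N * a)"
        using N_pos a by (subst ln_le_cancel_iff) (auto intro!: mult_pos_pos)
      then have A: "69 / 100 \<le> ln (2 * real N * a)" using ln_2_ge by linarith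
      have "2 * real N' * a \<le> 2 * (real N * (1 - 1 / 50000)) * a"
        using N'c a by (intro mult_right_mono mult_left_mono) auto
      also have "\<dots> = 2 * real N * a * (1 - 1 / 50000)" by (simp only: mult_ac)
      finally have "ln (2 * real N' * a) \<le> ln (2 * real N * a * (1 - 1 / 50000))"
        using N' N_pos a by (subst ln_le_cancel_iff) auto
      also have "\<dots> = ln (2 * real N * a) + ln (1 - 1 / 50000)"
        using N_pos a by (subst ln_mult) auto
      finally have "F N' \<le> F N - 1 / 50000" using A lnc unfolding F by linarith
      then show ?thesis using Lmono R by simp
    next
      case True
      then have "real N < 10 ^ 8 * (real k * l)" using False by (simp add: fast_round_def)
      then have "x \<le> 10 ^ 8" using kl by (simp add: x_def divide_le_eq)
      then have "ln x \<le> ln (10 ^ 8)" using pos by (subst ln_le_cancel_iff) auto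
      then have lnx20: "ln x \<le> 20" using ln_10_pow_8 by linarith
      have "x' \<le> x * (1 - 1 / 50000)"
        using divide_right_mono[OF N'c less_imp_le[OF kl]] by (simp add: x_def x'_def)
      then have "ln x' \<le> ln (x * (1 - 1 / 50000))" using pos by (subst ln_le_cancel_iff) auto
      also have "\<dots> = ln x + ln (1 - 1 / 50000)" using pos by (subst ln_mult) auto
      finally have "ln x' \<le> ln x - 1 / 50000" using lnc by linarith
      then have "loglog x' \<le> ln (ln x - 1 / 50000)"
        using lnx exp_exp_1_le(2)[OF lnx] by (intro loglog_le) auto
      also have "ln x - 1 / 50000 = ln x * (1 - 1 / (50000 * ln x))"
        using lnx by (simp add: field_simps)
      also have "ln \<dots> = ln (ln x) + ln (1 - 1 / (50000 * ln x))"
        using lnx by (subst ln_mult) (auto simp: field_simps)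
      finally have "loglog x' \<le> ln (ln x) + ln (1 - 1 / (50000 * ln x))" .
      moreover have "ln (1 - 1 / (50000 * ln x)) \<le> - (1 / (50000 * ln x))"
        using ln_le_minus_one[of "1 - 1 / (50000 * ln x)"] lnx by (simp add: field_simps)
      moreover have "1 / (50000 * 20) \<le> 1 / (50000 * ln x)"
        using lnx lnx20 by (intro divide_left_mono) auto
      ultimately have "loglog x' \<le> ln (ln x) - 1 / 10 ^ 6" by simp
      then show ?thesis using Fmono R LLx by simp
    qed
  qed
qed

end

text \<open>For \<open>N = N0\<close> the first logarithm contains only constants and
  \<open>(max 1 l)\<^sup>2\<close>. This is one source of the term
  \<open>loglog (k / \<delta>)\<close> of the theorem; the other is the final CMY run.\<close>

lemma rounds_left_initial_le:
  assumes "1 \<le> k" "0 < \<delta>" "0 < N0"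
  shows "rounds_left k \<delta> N0 N0 \<le> 2 * 10 ^ 9 * (loglog (real N0 / (real k * ln (real k / \<delta>))) + loglog (real k / \<delta>))"
proof -
  let ?m = "max 1 (ln (real k / \<delta>))"
  have "ln (2 * real N0 * (15000 * ?m)\<^sup>2 / real N0) = ln (2 * 15000\<^sup>2 * ?m\<^sup>2)"
    using assms by (simp add: power_mult_distrib)
  also have "\<dots> = ln (2 * 15000\<^sup>2) + 2 * ln ?m"
    by (subst ln_mult) (auto simp: ln_realpow less_max_iff_disj)
  also have "ln (2 * 15000\<^sup>2 :: real) = ln 2 + 2 * ln 15000"
  proof -
    have "ln (2 * c\<^sup>2) = ln 2 + 2 * ln c" if "0 < c" for c :: real
      using that by (simp add: ln_mult ln_realpow)
    then show ?thesis by (metis zero_less_numeral)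
  qed
  finally have "ln (2 * real N0 * (15000 * ?m)\<^sup>2 / real N0) = ln 2 + 2 * ln 15000 + 2 * ln ?m" .
  moreover have "ln 2 \<le> (2 :: real)" "ln 15000 \<le> (15000 :: real)"
    using ln_le_minus_one[of "2 :: real"] ln_le_minus_one[of "15000 :: real"] by auto
  ultimately have "ln (2 * real N0 * (15000 * ?m)\<^sup>2 / real N0) \<le> 30002 + 2 * loglog (real k / \<delta>)"
    using ln_max_le_loglog[of "real k / \<delta>"] assms by simp
  then show ?thesis
    using loglog_ge_1[of "real k / \<delta>"] loglog_ge_1[of "real N0 / (real k * ln (real k / \<delta>))"]
    unfolding rounds_left_def by (auto simp: max_def)
qed

section \<open>Supermartingales within a round\<close>

lemma notifications_mono:
  assumes "\<And>i. c i \<le> c' i"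
  shows "notifications k thr q c \<le> notifications k thr q c'"
  unfolding notifications_def
  using assms by (intro sum_mono card_mono) (auto intro: order_trans)

lemma notifications_upd:
  assumes "i < k"
  shows "notifications k thr q (c(i := c i + 1)) \<le> notifications k thr q c + q"
proof -
  let ?f = "\<lambda>c i. card {j \<in> {1..q}. thr i j \<le> real (c i)}"
  have "?f (c(i := c i + 1)) i \<le> card {1..q}" by (intro card_mono) auto
  moreover have "(\<Sum>j\<in>{..<k} - {i}. ?f (c(i := c i + 1)) j) = (\<Sum>j\<in>{..<k} - {i}. ?f c j)"
    by (intro sum.cong) auto
  ultimately show ?thesis
    unfolding notifications_def
    using assms sum.remove[of "{..<k}" i "?f c"] sum.remove[of "{..<k}" i "?f (c(i := c i + 1))"]
    by simp
qed

lemma sum_upd: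
  fixes c :: "nat \<Rightarrow> nat"
  assumes "i < k"
  shows "(\<Sum>j<k. (c(i := c i + 1)) j) = (\<Sum>j<k. c j) + 1"
proof -
  have "(\<Sum>j\<in>{..<k} - {i}. (c(i := c i + 1)) j) = (\<Sum>j\<in>{..<k} - {i}. c j)"
    by (intro sum.cong) auto
  then show ?thesis
    using assms sum.remove[of "{..<k}" i c] sum.remove[of "{..<k}" i "c(i := c i + 1)"] by simp
qed

lemma cmy_items:
  assumes "k \<le> notifications k (\<lambda>i j. real (j * s)) k c"
  shows "k * s \<le> (\<Sum>i<k. c i)"
proof -
  have "card {j \<in> {1..k}. real (j * s) \<le> real (c i)} * s \<le> c i" for i
  proof (cases "s = 0")
    case False
    have "{j \<in> {1..k}. real (j * s) \<le> real (c i)} \<subseteq> {1..c i div s}"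
      using False by (auto simp: less_eq_div_iff_mult_less_eq simp del: of_nat_mult)
    then have "card {j \<in> {1..k}. real (j * s) \<le> real (c i)} \<le> card {1..c i div s}"
      by (intro card_mono) auto
    then have "card {j \<in> {1..k}. real (j * s) \<le> real (c i)} * s \<le> c i div s * s" by simp
    also have "\<dots> \<le> c i" by simp
    finally show ?thesis .
  qed auto
  then have "(\<Sum>i<k. card {j \<in> {1..k}. real (j * s) \<le> real (c i)} * s) \<le> (\<Sum>i<k. c i)"
    by (intro sum_mono)
  moreover have "k * s \<le> notifications k (\<lambda>i j. real (j * s)) k c * s"
    using assms by (intro mult_right_mono) auto
  ultimately show ?thesis
    by (simp only: notifications_def sum_distrib_right[symmetric])
qed

text \<open>With \<open>s\<close> the slack, \<open>N < 2 * k * s + 2 * k\<close> and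
  \<open>2 * k \<le> N / 2\<close>, so the \<open>k * s\<close> notified items are at least a
  quarter of \<open>N\<close>.\<close>

lemma cmy_items_quarter:
  assumes "1 \<le> k" "4 * k \<le> N" "k \<le> notifications k (\<lambda>i j. real (j * (N div (2 * k)))) k c"
  shows "N \<le> 4 * (\<Sum>i<k. c i)"
proof -
  have "N < (N div (2 * k) + 1) * (2 * k)"
    using assms(1) by (simp add: dividend_less_div_times)
  then have "N < 2 * (k * (N div (2 * k))) + 2 * k" by (simp add: algebra_simps)
  then have "N \<le> 4 * (k * (N div (2 * k)))" using assms(2) by linarith
  also have "\<dots> \<le> 4 * (\<Sum>i<k. c i)" using cmy_items[OF assms(3)] by simp
  finally show ?thesis .
qed

lemma sum_weights_if:
  fixes \<mu> :: "nat \<Rightarrow> real"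
  assumes "i < k" "(\<Sum>j<k. \<mu> j) = 1"
  shows "(\<Sum>j<k. \<mu> j * (if j = i then a else b)) = \<mu> i * a + (1 - \<mu> i) * b"
proof -
  have "(\<Sum>j\<in>{..<k} - {i}. \<mu> j * (if j = i then a else b)) = (\<Sum>j\<in>{..<k} - {i}. \<mu> j) * b"
    unfolding sum_distrib_right by (intro sum.cong) auto
  moreover have "(\<Sum>j\<in>{..<k} - {i}. \<mu> j) = 1 - \<mu> i"
    using assms sum.remove[of "{..<k}" i \<mu>] by simp
  ultimately show ?thesis
    using assms(1) by (subst sum.remove[of _ i]) auto
qed

text \<open>Given the current counters \<open>c\<close>, bounds the probability that some counter reaches its guard
  \<open>a i\<close> among the first \<open>T\<close> items of the round.\<close>

definition overrun :: "nat \<Rightarrow> (nat \<Rightarrow> real) \<Rightarrow> (nat \<Rightarrow> real) \<Rightarrow> nat \<Rightarrow> (nat \<Rightarrow> nat) \<Rightarrow> real" where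
  "overrun k \<mu> a T c =
     (if (\<Sum>i<k. c i) \<le> T
      then \<Sum>i<k. tail (\<mu> i) (T - (\<Sum>i<k. c i)) (a i - real (c i)) else 0)"

lemma overrun_nonneg:
  assumes "\<And>i. 0 \<le> \<mu> i" "\<And>i. \<mu> i \<le> 1"
  shows "0 \<le> overrun k \<mu> a T c"
  using assms by (auto simp: overrun_def intro!: sum_nonneg tail_nonneg)

lemma overrun_ge_1:
  assumes \<mu>: "\<And>i. 0 \<le> \<mu> i" "\<And>i. \<mu> i \<le> 1" and "(\<Sum>i<k. c i) \<le> T" "i < k" "a i \<le> real (c i)"
  shows "1 \<le> overrun k \<mu> a T c"
proof -
  have "tail (\<mu> i) (T - (\<Sum>i<k. c i)) (a i - real (c i))
      \<le> (\<Sum>i<k. tail (\<mu> i) (T - (\<Sum>i<k. c i)) (a i - real (c i)))"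
    using assms by (intro member_le_sum) (auto intro: tail_nonneg)
  then show ?thesis using assms by (simp add: overrun_def tail_nonpos)
qed

text \<open>An equality before item \<open>T\<close>, by the recursion of \<open>tail\<close> for
  each player; afterwards the value falls to 0.\<close>

lemma overrun_step:
  assumes \<mu>: "\<And>i. 0 \<le> \<mu> i" "\<And>i. \<mu> i \<le> 1" and sum: "(\<Sum>j<k. \<mu> j) = 1"
  shows "(\<Sum>j<k. \<mu> j * overrun k \<mu> a T (c(j := c j + 1))) \<le> overrun k \<mu> a T c"
proof (cases "(\<Sum>i<k. c i) + 1 \<le> T")
  case False
  then have "overrun k \<mu> a T (c(j := c j + 1)) = 0" if "j < k" for j
    using sum_upd[OF that, of c] by (simp add: overrun_def)
  then show ?thesis using overrun_nonneg[OF \<mu>] by simp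
next
  case True
  define m where "m = T - ((\<Sum>i<k. c i) + 1)"
  have Suc: "T - (\<Sum>i<k. c i) = Suc m" using True by (simp add: m_def)
  have "overrun k \<mu> a T (c(j := c j + 1))
      = (\<Sum>i<k. if j = i then tail (\<mu> i) m (a i - real (c i) - 1) else tail (\<mu> i) m (a i - real (c i)))"
    if "j < k" for j
    using sum_upd[OF that, of c] True
    by (auto simp: overrun_def m_def algebra_simps simp del: fun_upd_apply intro!: sum.cong)
       (auto simp: algebra_simps)
  then have "(\<Sum>j<k. \<mu> j * overrun k \<mu> a T (c(j := c j + 1)))
     = (\<Sum>j<k. \<Sum>i<k. \<mu> j * (if j = i then tail (\<mu> i) m (a i - real (c i) - 1) else tail (\<mu> i) m (a i - real (c i))))"
    by (simp add: sum_distrib_left)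
  also have "\<dots> = (\<Sum>i<k. \<Sum>j<k. \<mu> j * (if j = i then tail (\<mu> i) m (a i - real (c i) - 1) else tail (\<mu> i) m (a i - real (c i))))"
    by (rule sum.swap)
  also have "\<dots> = (\<Sum>i<k. tail (\<mu> i) (Suc m) (a i - real (c i)))"
    by (intro sum.cong refl) (simp add: sum_weights_if[OF _ sum])
  also have "\<dots> = overrun k \<mu> a T c" using True Suc by (simp add: overrun_def)
  finally show ?thesis by simp
qed

text \<open>Exceeds \<open>1\<close> as soon as the counter of some player lags behind its mean so far that the
  estimate derived from it would be too small.\<close>

definition lag :: "nat \<Rightarrow> (nat \<Rightarrow> real) \<Rightarrow> real \<Rightarrow> real \<Rightarrow> nat \<Rightarrow> (nat \<Rightarrow> nat) \<Rightarrow> real" where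
  "lag k \<mu> l \<theta> i c = exp (- \<theta> * real (c i) + \<mu> i * (\<theta> - \<theta>\<^sup>2 / 2) * real (\<Sum>j<k. c j) - 2 * l)"

lemma exp_minus_ge: "0 \<le> x \<Longrightarrow> exp (- x) \<le> 1 - x + x\<^sup>2 / (2 :: real)"
proof -
  assume x: "0 \<le> x"
  have "1 + x + x\<^sup>2 / 2 \<le> exp x" using x by (rule exp_lower_Taylor_quadratic)
  then have "exp (- x) * (1 + x + x\<^sup>2 / 2) \<le> exp (- x) * exp x" by (intro mult_left_mono) auto
  then have "exp (- x) * (1 + x + x\<^sup>2 / 2) \<le> 1" by (simp add: exp_minus)
  also have "1 \<le> (1 - x + x\<^sup>2 / 2) * (1 + x + x\<^sup>2 / 2)"
  proof -
    have "(1 - x + x\<^sup>2 / 2) * (1 + x + x\<^sup>2 / 2) = 1 + (x\<^sup>2 / 2)\<^sup>2"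
      by (simp add: power2_eq_square algebra_simps)
    then show ?thesis by simp
  qed
  finally show ?thesis using x by (simp add: add_nonneg_pos add_pos_nonneg)
qed

text \<open>Exponential lower-tail bound for a Bernoulli variable: by \<open>exp_minus_ge\<close>
  its transform at \<open>- \<theta>\<close> is at most
  \<open>exp (- (\<mu> i * (\<theta> - \<theta>\<^sup>2 / 2)))\<close>, the reciprocal of the drift
  factor in \<open>lag\<close>.\<close>

lemma lag_step:
  assumes \<mu>: "0 \<le> \<mu> i" and sum: "(\<Sum>j<k. \<mu> j) = 1" and i: "i < k" and \<theta>: "0 \<le> \<theta>"
  shows "(\<Sum>j<k. \<mu> j * lag k \<mu> l \<theta> i (c(j := c j + 1))) \<le> lag k \<mu> l \<theta> i c"
proof -
  define e where "e = exp (\<mu> i * (\<theta> - \<theta>\<^sup>2 / 2))"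
  have "lag k \<mu> l \<theta> i (c(j := c j + 1))
      = (if j = i then lag k \<mu> l \<theta> i c * e * exp (- \<theta>) else lag k \<mu> l \<theta> i c * e)" if "j < k" for j
    unfolding lag_def sum_upd[OF that] e_def exp_add[symmetric] by (auto simp: algebra_simps)
  then have "(\<Sum>j<k. \<mu> j * lag k \<mu> l \<theta> i (c(j := c j + 1)))
     = \<mu> i * (lag k \<mu> l \<theta> i c * e * exp (- \<theta>)) + (1 - \<mu> i) * (lag k \<mu> l \<theta> i c * e)"
    by (simp add: sum_weights_if[OF i sum, symmetric])
  also have "\<dots> = lag k \<mu> l \<theta> i c * (e * (1 - \<mu> i * (1 - exp (- \<theta>))))"
    by (simp add: algebra_simps)
  also have "\<dots> \<le> lag k \<mu> l \<theta> i c * 1"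
  proof (rule mult_left_mono)
    have "\<mu> i * (\<theta> - \<theta>\<^sup>2 / 2) \<le> \<mu> i * (1 - exp (- \<theta>))"
      using exp_minus_ge[OF \<theta>] \<mu> by (intro mult_left_mono) auto
    then have "1 - \<mu> i * (1 - exp (- \<theta>)) \<le> 1 + (- (\<mu> i * (\<theta> - \<theta>\<^sup>2 / 2)))" by simp
    also have "\<dots> \<le> exp (- (\<mu> i * (\<theta> - \<theta>\<^sup>2 / 2)))" by (rule exp_ge_add_one_self)
    finally have "e * (1 - \<mu> i * (1 - exp (- \<theta>))) \<le> e * exp (- (\<mu> i * (\<theta> - \<theta>\<^sup>2 / 2)))"
      by (intro mult_left_mono) (auto simp: e_def)
    then show "e * (1 - \<mu> i * (1 - exp (- \<theta>))) \<le> 1" by (simp add: e_def exp_minus)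
  qed (simp add: lag_def)
  finally show ?thesis by simp
qed

section \<open>The potential of a run\<close>

text \<open>Bounds the messages of the CMY algorithm from threshold \<open>N\<close>: a round costs at most \<open>5 k\<close>
  messages and reduces \<open>N\<close> to at most \<open>3 N / 4\<close>.\<close>

definition cmy_cost :: "nat \<Rightarrow> nat \<Rightarrow> real" where
  "cmy_cost k N = real k * (6 + 20 * ln (max 1 (real N / real k)))"

lemma cmy_cost_ge: "6 * real k \<le> cmy_cost k N"
  unfolding cmy_cost_def by (simp add: distrib_left less_max_iff_disj)

lemma cmy_cost_step:
  assumes "1 \<le> k" "4 * k \<le> N" "4 * N' \<le> 3 * N"
  shows "5 * real k + cmy_cost k N' \<le> cmy_cost k N"
proof -
  define x where "x = real N / real k"
  have x: "4 \<le> x" using assms by (simp add: x_def field_simps)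
  have "real N' / real k \<le> 3 / 4 * x" using assms by (simp add: x_def field_simps)
  then have "ln (max 1 (real N' / real k)) \<le> ln (3 / 4 * x)"
    using x by (subst ln_le_cancel_iff) (auto simp: less_max_iff_disj)
  also have "\<dots> = ln (3 / 4) + ln x" using x by (subst ln_mult) auto
  also have "\<dots> \<le> ln x - 1 / 4" using ln_le_minus_one[of "3 / 4 :: real"] by simp
  finally have "5 + (6 + 20 * ln (max 1 (real N' / real k))) \<le> 6 + 20 * ln x" by simp
  then have "real k * (5 + (6 + 20 * ln (max 1 (real N' / real k)))) \<le> real k * (6 + 20 * ln x)"
    by (intro mult_left_mono) auto
  then show ?thesis using x by (simp add: cmy_cost_def x_def max_def algebra_simps)
qed

text \<open>\<open>J\<close> is a budget of rounds, \<open>Bnd\<close> one of messages. Beyond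
  \<open>J\<close> rounds of \<open>5 * k\<close> messages, \<open>Bnd\<close> has room for a
  closing straightforward run, or for a complete CMY run from any threshold at which the learned
  phase hands over.\<close>

locale tracking =
  fixes A :: algorithm and k N0 :: nat and \<delta> :: real and p :: "nat pmf" and J Bnd :: real
  assumes k: "1 \<le> k" and N0: "1 \<le> N0" and \<delta>: "0 < \<delta>" "\<delta> < 1" and p: "set_pmf p \<subseteq> {..<k}"
    and J: "0 \<le> J" and Bnd: "5 * real k * (J + 1) \<le> Bnd"
    and Bnd_cmy: "\<And>N. 1 \<le> N \<Longrightarrow> real N \<le> lrn_beta * real k * ln (real k / \<delta>) \<Longrightarrow>
      5 * real k * J + cmy_cost k N \<le> Bnd"
begin

abbreviation l where "l \<equiv> ln (real k / \<delta>)"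

abbreviation \<mu> where "\<mu> \<equiv> pmf p"

lemma l_pos: "0 < l"
  using k \<delta> by (intro ln_gt_zero) (auto simp: field_simps)

lemma sum_\<mu>: "(\<Sum>i<k. \<mu> i) = 1"
  using p by (intro sum_pmf_eq_1) auto

lemmas \<mu> = pmf_nonneg[of p] pmf_le_1[of p]

text \<open>A learned round fails with probability at most \<open>sd\<^sup>2\<close>. The base \<open>1 / sd\<close> charges for the
  rounds used so far and \<open>1 / (sd (1 - sd))\<close> for the successful rounds still needed; these bases
  make \<open>credit_split\<close> an equation.\<close>

definition sd :: real where "sd = sqrt (99 / 100 * \<delta>)"

definition credit :: "real \<Rightarrow> real \<Rightarrow> real" where
  "credit b r = (1 / sd) powr (b / (5 * real k) - J) * (1 / (sd * (1 - sd))) powr r"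

lemma sd: "0 < sd" "sd < 1" "sd * sd = 99 / 100 * \<delta>"
  using \<delta> by (auto simp: sd_def)

lemma credit_bases: "1 \<le> 1 / sd" "1 \<le> 1 / (sd * (1 - sd))"
proof -
  show "1 \<le> 1 / sd" using sd by simp
  have "sd * (1 - sd) \<le> 1 * 1" using sd by (intro mult_mono) auto
  then show "1 \<le> 1 / (sd * (1 - sd))" using sd by simp
qed

lemma credit_nonneg: "0 \<le> credit b r"
  by (simp add: credit_def)

lemma credit_mono:
  assumes "b \<le> b'" "r \<le> r'"
  shows "credit b r \<le> credit b' r'"
  unfolding credit_def using assms k credit_bases
  by (intro mult_mono powr_mono) (auto intro: divide_right_mono)

lemma credit_ge_1:
  assumes "5 * real k * J \<le> b" "0 \<le> r"
  shows "1 \<le> credit b r"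
proof -
  have "J \<le> b / (5 * real k)" using assms k by (simp add: le_divide_eq mult_ac)
  then have "1 * 1 \<le> credit b r"
    unfolding credit_def using assms credit_bases by (intro mult_mono ge_one_powr_ge_zero) auto
  then show ?thesis by simp
qed

text \<open>The failure term is the fraction \<open>sd\<close> of the old credit, the success term
  the fraction \<open>1 - sd\<close>.\<close>

lemma credit_split:
  "credit (b + 5 * real k) r * (99 / 100 * \<delta>) + credit (b + 5 * real k) (r - 1) = credit b r"
proof -
  have "(b + 5 * real k) / (5 * real k) - J = (b / (5 * real k) - J) + 1"
    using k by (simp add: add_divide_distrib)
  then have 1: "credit (b + 5 * real k) r = credit b r / sd" for r
    using sd unfolding credit_def by (simp only: powr_add) simp
  have 2: "credit b (r - 1) = credit b r * (sd * (1 - sd))"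
    using sd by (simp add: credit_def powr_diff)
  show ?thesis
    unfolding 1 2 sd(3)[symmetric] using sd by (simp add: field_simps)
qed

definition good :: "(nat \<Rightarrow> real) \<Rightarrow> bool" where
  "good mh \<longleftrightarrow> (\<forall>i<k. \<mu> i - 10 * sqrt (\<mu> i * l / real N0) \<le> mh i)"

text \<open>For \<open>\<mu> i > 0\<close> this makes the quadratic term
  \<open>\<mu> i * (\<theta> i)\<^sup>2 / 2 * N0\<close> of \<open>lag\<close> equal to
  \<open>l / 2\<close>.\<close>

definition \<theta> :: "nat \<Rightarrow> real" where "\<theta> i = sqrt (l / (\<mu> i * real N0))"

text \<open>Players with \<open>\<mu> i * N0 < l\<close> are left out: the error that
  \<open>good\<close> allows them is at least \<open>\<mu> i\<close>. For one player the observed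
  frequency is exactly 1.\<close>

definition lag_total :: "(nat \<Rightarrow> nat) \<Rightarrow> real" where
  "lag_total c = (if k = 1 then 0 else \<Sum>i\<in>{i. i < k \<and> l \<le> \<mu> i * real N0}. lag k \<mu> l (\<theta> i) i c)"

text \<open>The messages sent before the current round started.\<close>

definition spent :: "state \<Rightarrow> (nat \<Rightarrow> nat \<Rightarrow> real) \<Rightarrow> nat \<Rightarrow> real" where
  "spent st thr q = real (messages st) - real k - real (notifications k thr q (counter st))
     + real (notifications k thr q (\<lambda>_. 0))"

definition items :: "state \<Rightarrow> nat" where "items st = (\<Sum>i<k. counter st i)"

definition slack_overrun :: "(nat \<Rightarrow> real) \<Rightarrow> nat \<Rightarrow> (nat \<Rightarrow> nat) \<Rightarrow> real" where
  "slack_overrun mh N c = overrun k \<mu> (guard A k \<delta> mh N) (nat \<lfloor>target k \<delta> N0 N\<rfloor>) c"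

text \<open>The straightforward and CMY phases have a deterministic cost bound, hence the 0-1
  values. A learned round is charged its \<open>5 * k\<close> messages in advance; its two terms
  stand for a guard reached too early, which keeps the rank, and for a success, which lowers it by
  1. Bad estimates count as lost, with value 1; at the end of the first round
  \<open>lag_total\<close> pays for that.\<close>

definition potential :: "state \<Rightarrow> real" where
  "potential st = (case st_round st of
      Terminated \<Rightarrow> of_bool (Bnd < real (messages st))
    | Straightforward \<Rightarrow> of_bool (Bnd < real (messages st) + real (threshold st) - real (items st))
    | Threshold thr q \<Rightarrow> (case st_phase st of
        First_Round \<Rightarrow> credit (5 * real k) (rounds_left k \<delta> N0 N0) + lag_total (counter st)
      | Learned mh \<Rightarrow>
          (if good mh
           then credit (spent st thr q + 5 * real k) (rounds_left k \<delta> N0 (threshold st))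
                  * slack_overrun mh (threshold st) (counter st)
                + credit (spent st thr q + 5 * real k) (rounds_left k \<delta> N0 (threshold st) - 1)
           else 1)
      | CMY \<Rightarrow> of_bool (Bnd < spent st thr q + cmy_cost k (threshold st))))"

fun phase_ok :: "phase \<Rightarrow> nat \<Rightarrow> bool" where
  "phase_ok First_Round N \<longleftrightarrow> N = N0"
| "phase_ok CMY N \<longleftrightarrow> True"
| "phase_ok (Learned mh) N \<longleftrightarrow>
     (\<exists>w n. mh = mu_hat \<delta> w n \<and> (\<Sum>i<k. n i) = w \<and> N \<le> 3 * w \<and> N \<le> N0)"

text \<open>The alternative of zero counters covers the start of a round, where
  \<open>notifications\<close> would already count thresholds that are at most 0.\<close>

fun round_ok :: "state \<Rightarrow> round \<Rightarrow> bool" where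
  "round_ok st Terminated \<longleftrightarrow> True"
| "round_ok st Straightforward \<longleftrightarrow> items st < threshold st"
| "round_ok st (Threshold thr q) \<longleftrightarrow>
     (counter st = (\<lambda>_. 0) \<or> notifications k thr q (counter st) < q) \<and>
     (st_phase st = First_Round \<longrightarrow> spent st thr q = 0)"

definition reachable :: "state \<Rightarrow> bool" where
  "reachable st \<longleftrightarrow> st_round st = Terminated \<or>
     next_round A k \<delta> (st_phase st) (threshold st) = (st_phase st, st_round st) \<and>
     1 \<le> threshold st \<and> phase_ok (st_phase st) (threshold st) \<and> round_ok st (st_round st)"

lemma straightforward_or_cmy_Threshold:
  assumes "straightforward_or_cmy k N = Threshold thr q"
  shows "q = k" "thr = (\<lambda>i j. real (j * (N div (2 * k))))" "4 * k \<le> N"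
  using assms by (auto simp: straightforward_or_cmy_def split: if_splits)

lemma next_round_idem:
  assumes "next_round A k \<delta> ph N = (ph', rd)"
  shows "next_round A k \<delta> ph' N = (ph', rd)"
  using assms by (cases ph) (auto split: if_splits)

lemma next_round_q:
  assumes "next_round A k \<delta> ph N = (ph', Threshold thr q)"
  shows "1 \<le> q" "q \<le> k"
  using assms k straightforward_or_cmy_Threshold(1)[of N thr q]
  by (cases ph; cases A; auto simp: Let_def split: if_splits)+

lemma reachable_start_round:
  assumes "1 \<le> N" "phase_ok ph N" "ph = First_Round \<Longrightarrow> msgs = 0"
  shows "reachable (start_round A k \<delta> ph N msgs)"
proof -
  obtain ph' rd where nr: "next_round A k \<delta> ph N = (ph', rd)" by fastforce
  have "phase_ok ph' N" using nr assms by (cases ph) (auto split: if_splits)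
  moreover have "ph = First_Round" if "ph' = First_Round"
    using nr that by (cases ph) (auto split: if_splits)
  ultimately show ?thesis
    using assms next_round_idem[OF nr] nr
    by (cases rd) (auto simp: reachable_def start_round_def items_def spent_def)
qed

lemma potential_start_cmy:
  assumes "1 \<le> N"
  shows "potential (start_round A k \<delta> CMY N msgs) \<le> of_bool (Bnd < real msgs + cmy_cost k N)"
  using assms cmy_cost_ge[of k N]
  by (auto simp: start_round_def potential_def straightforward_or_cmy_def items_def spent_def)

text \<open>A final phase can exceed \<open>Bnd\<close> only if more than \<open>5 * k * J\<close>
  messages have been sent before, and then the credit alone is at least 1. In a learned round,
  \<open>guard_tail\<close> bounds the overrun and \<open>credit_split\<close> recombines the two
  terms.\<close>

lemma potential_start_learned:
  assumes "1 \<le> N" "phase_ok (Learned mh) N"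
  shows "potential (start_round A k \<delta> (Learned mh) N msgs)
    \<le> (if good mh then credit (real msgs) (rounds_left k \<delta> N0 N) else 1)"
proof -
  have r: "1 \<le> rounds_left k \<delta> N0 N" by (rule rounds_left_ge_1)
  have cr: "of_bool (5 * real k * J \<le> real msgs) \<le> credit (real msgs) (rounds_left k \<delta> N0 N)"
    using credit_ge_1[of "real msgs" "rounds_left k \<delta> N0 N"] credit_nonneg[of "real msgs"] r by auto
  consider "N \<le> 4 * k" | "4 * k < N" "real N \<le> lrn_beta * real k * l"
    | "4 * k < N" "lrn_beta * real k * l < real N" by linarith
  then show ?thesis
  proof cases
    case 1
    have "potential (start_round A k \<delta> (Learned mh) N msgs) = of_bool (Bnd < real msgs + real k + real N)"
      using 1 by (simp add: start_round_def potential_def items_def)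
    also have "\<dots> \<le> of_bool (5 * real k * J \<le> real msgs)"
      using 1 Bnd by (auto simp: algebra_simps)
    finally show ?thesis using cr by (auto simp: of_bool_def split: if_splits)
  next
    case 2
    have "potential (start_round A k \<delta> (Learned mh) N msgs) = potential (start_round A k \<delta> CMY N msgs)"
      using 2 by (simp add: start_round_def)
    also have "\<dots> \<le> of_bool (Bnd < real msgs + cmy_cost k N)"
      by (rule potential_start_cmy[OF assms(1)])
    also have "\<dots> \<le> of_bool (5 * real k * J \<le> real msgs)"
      using Bnd_cmy[OF assms(1) 2(2)] by auto
    finally show ?thesis using cr by (auto simp: of_bool_def split: if_splits)
  next
    case 3
    obtain w n where mh: "mh = mu_hat \<delta> w n" "(\<Sum>i<k. n i) = w" "N \<le> 3 * w" "N \<le> N0"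
      using assms(2) by auto
    interpret ar: active_round k N N0 w \<delta> n
      using k \<delta> mh 3 by unfold_locales auto
    obtain thr q where lr: "learned_round A k \<delta> mh N = Threshold thr q"
      by (cases A) (auto simp: Let_def)
    show ?thesis
    proof (cases "good mh")
      case False
      then show ?thesis using 3 lr by (simp add: start_round_def potential_def)
    next
      case True
      let ?T = "nat \<lfloor>target k \<delta> N0 N\<rfloor>"
      have nonneg: "0 \<le> target k \<delta> N0 N"
      proof (cases "fast_round k \<delta> N0 N")
        case True
        then have "0 \<le> real N * (1 - ar.h)" using ar.fast_h[OF True] by simp
        then show ?thesis using True by (simp add: target_def ar.h_def)
      qed (simp add: target_def)
      have "(\<Sum>i<k. tail (\<mu> i) ?T (guard A k \<delta> (mu_hat \<delta> w n) N i)) \<le> 99 / 100 * \<delta>"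
      proof (rule ar.guard_tail)
        show "real ?T \<le> target k \<delta> N0 N" using nonneg by linarith
      qed (use \<mu> sum_\<mu> True mh in \<open>auto simp: good_def\<close>)
      then have so: "slack_overrun mh N (\<lambda>_. 0) \<le> 99 / 100 * \<delta>"
        by (simp add: slack_overrun_def overrun_def mh(1))
      have "potential (start_round A k \<delta> (Learned mh) N msgs)
        = credit (real msgs + 5 * real k) (rounds_left k \<delta> N0 N) * slack_overrun mh N (\<lambda>_. 0)
          + credit (real msgs + 5 * real k) (rounds_left k \<delta> N0 N - 1)"
        using 3 lr True by (simp add: start_round_def potential_def spent_def)
      also have "\<dots> \<le> credit (real msgs + 5 * real k) (rounds_left k \<delta> N0 N) * (99 / 100 * \<delta>)
          + credit (real msgs + 5 * real k) (rounds_left k \<delta> N0 N - 1)"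
        using so by (intro add_mono mult_left_mono credit_nonneg) auto
      also have "\<dots> = credit (real msgs) (rounds_left k \<delta> N0 N)" by (rule credit_split)
      finally show ?thesis using True by simp
    qed
  qed
qed

end

section \<open>Change of the potential when an item arrives\<close>

context tracking
begin

definition receive :: "nat \<Rightarrow> (nat \<Rightarrow> nat \<Rightarrow> real) \<Rightarrow> nat \<Rightarrow> state \<Rightarrow> state" where
  "receive i thr q st = st\<lparr>counter := (counter st)(i := counter st i + 1),
     messages := messages st + (notifications k thr q ((counter st)(i := counter st i + 1))
       - notifications k thr q (counter st))\<rparr>"

lemma step_Threshold:
  assumes "st_round st = Threshold thr q"
  shows "step A k \<delta> i st =
    (if q \<le> notifications k thr q (counter (receive i thr q st))
     then end_round A k \<delta> (receive i thr q st) else receive i thr q st)"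
  using assms by (simp add: step_def receive_def Let_def)

lemma receive_simps [simp]:
  "st_phase (receive i thr q st) = st_phase st"
  "st_round (receive i thr q st) = st_round st"
  "threshold (receive i thr q st) = threshold st"
  "counter (receive i thr q st) = (counter st)(i := counter st i + 1)"
  by (simp_all add: receive_def)

lemma spent_receive [simp]: "spent (receive i thr q st) thr q = spent st thr q"
proof -
  have "notifications k thr q (counter st) \<le> notifications k thr q ((counter st)(i := counter st i + 1))"
    by (rule notifications_mono) auto
  then show ?thesis by (simp add: spent_def receive_def of_nat_diff)
qed

lemma messages_le:
  assumes "reachable st" "st_round st = Threshold thr q"
  shows "real (messages st) \<le> spent st thr q + 2 * real k"
proof -
  have "1 \<le> q" "q \<le> k" using assms next_round_q by (auto simp: reachable_def)
  moreover have "counter st = (\<lambda>_. 0) \<or> notifications k thr q (counter st) < q"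
    using assms by (auto simp: reachable_def)
  ultimately show ?thesis by (auto simp: spent_def)
qed

text \<open>Origin of \<open>5 * k\<close>: \<open>k\<close> messages to start the round, fewer than
  \<open>2 * k\<close> notifications (the last item may raise up to \<open>q\<close> at once), and
  \<open>2 * k\<close> to collect the counters.\<close>

lemma messages_receive_le:
  assumes "reachable st" "st_round st = Threshold thr q" "i < k"
  shows "real (messages (receive i thr q st)) + 2 * real k \<le> spent st thr q + 5 * real k"
proof -
  have "q \<le> k" using assms next_round_q by (auto simp: reachable_def)
  moreover have "counter st = (\<lambda>_. 0) \<or> notifications k thr q (counter st) < q"
    using assms by (auto simp: reachable_def)
  moreover have "notifications k thr q ((counter st)(i := counter st i + 1)) \<le> notifications k thr q (counter st) + q"
    by (rule notifications_upd[OF assms(3)])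
  moreover have "spent st thr q = real (messages (receive i thr q st)) - real k
      - real (notifications k thr q ((counter st)(i := counter st i + 1))) + real (notifications k thr q (\<lambda>_. 0))"
    by (subst spent_receive[of i, symmetric]) (simp add: spent_def)
  ultimately show ?thesis by auto
qed

definition after_phase :: "state \<Rightarrow> phase" where
  "after_phase st = (if st_phase st = First_Round then Learned (mu_hat \<delta> (items st) (counter st)) else st_phase st)"

lemma end_round_eq:
  "end_round A k \<delta> st =
    (if threshold st \<le> items st then st\<lparr>st_round := Terminated, messages := messages st + 2 * k\<rparr>
     else start_round A k \<delta> (after_phase st) (threshold st - items st) (messages st + 2 * k))"
  by (simp add: end_round_def Let_def items_def after_phase_def)

lemma first_round_items:
  assumes "reachable st" "st_round st = Threshold thr q" "st_phase st = First_Round \<or> st_phase st = CMY"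
    and "q \<le> notifications k thr q c"
  shows "threshold st \<le> 4 * (\<Sum>i<k. c i)" "4 * k \<le> threshold st"
proof -
  have "straightforward_or_cmy k (threshold st) = Threshold thr q"
    using assms(1,2,3) by (auto simp: reachable_def)
  from straightforward_or_cmy_Threshold[OF this] show "threshold st \<le> 4 * (\<Sum>i<k. c i)" "4 * k \<le> threshold st"
    using cmy_items_quarter[OF k] assms(4) by auto
qed

lemma phase_ok_end:
  assumes "reachable st" "st_round st = Threshold thr q" "i < k"
    and "q \<le> notifications k thr q (counter (receive i thr q st))"
  shows "phase_ok (after_phase (receive i thr q st)) (threshold st - items (receive i thr q st))"
proof (cases "st_phase st")
  case First_Round
  have "threshold st = N0" using assms First_Round by (simp add: reachable_def)
  moreover have "threshold st \<le> 4 * items (receive i thr q st)"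
    using first_round_items(1)[OF assms(1,2) _ assms(4)] First_Round by (simp add: items_def)
  ultimately show ?thesis
    using First_Round by (auto simp: after_phase_def items_def intro!: exI[of _ "(counter st)(i := Suc (counter st i))"])
next
  case (Learned mh)
  then show ?thesis
    using assms by (auto simp: after_phase_def reachable_def)
next
  case CMY
  then show ?thesis by (simp add: after_phase_def)
qed

lemma reachable_step:
  assumes "reachable st" "i < k"
  shows "reachable (step A k \<delta> i st)"
proof (cases "st_round st")
  case Straightforward
  then have "items st < threshold st" using assms by (simp add: reachable_def)
  then show ?thesis
    using assms Straightforward sum_upd[OF assms(2), of "counter st"]
    by (auto simp: step_def reachable_def items_def Let_def)
next
  case Terminated
  then show ?thesis using assms by (simp add: step_def)
next
  case (Threshold thr q)
  let ?st = "receive i thr q st"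
  show ?thesis
  proof (cases "q \<le> notifications k thr q (counter ?st)")
    case False
    then show ?thesis
      unfolding step_Threshold[OF Threshold] using assms Threshold
      by (auto simp: reachable_def simp del: fun_upd_apply)
  next
    case True
    have "reachable (end_round A k \<delta> ?st)"
    proof (cases "threshold st \<le> items ?st")
      case False
      have "after_phase ?st \<noteq> First_Round" by (simp add: after_phase_def)
      then show ?thesis
        using False phase_ok_end[OF assms(1) Threshold assms(2) True]
        by (auto simp: end_round_eq intro!: reachable_start_round)
    qed (simp add: end_round_eq reachable_def)
    then show ?thesis using True by (simp add: step_Threshold[OF Threshold])
  qed
qed

lemma lag_total_single:
  assumes "k = 1"
  shows "lag_total c = 0"
  unfolding lag_total_def using assms by (rule if_P)

lemma Bnd_ge: "5 * real k + 5 * real k * J \<le> Bnd" "5 * real k \<le> Bnd"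
proof -
  show "5 * real k + 5 * real k * J \<le> Bnd" using Bnd by (simp add: algebra_simps)
  moreover have "0 \<le> 5 * real k * J" using J by simp
  ultimately show "5 * real k \<le> Bnd" by linarith
qed

lemma lag_total_nonneg: "0 \<le> lag_total c"
proof -
  have "0 \<le> lag k \<mu> l (\<theta> i) i c" for i by (simp add: lag_def)
  then show ?thesis by (simp add: lag_total_def sum_nonneg)
qed

lemma slack_overrun_nonneg: "0 \<le> slack_overrun mh N c"
  unfolding slack_overrun_def by (rule overrun_nonneg) (rule \<mu>)+

lemma potential_nonneg: "0 \<le> potential st"
proof (cases "st_round st")
  case (Threshold thr q)
  show ?thesis
  proof (cases "st_phase st")
    case First_Round
    show ?thesis
      using Threshold First_Round add_nonneg_nonneg[OF credit_nonneg lag_total_nonneg]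
      by (simp add: potential_def)
  next
    case (Learned mh)
    show ?thesis
      using Threshold Learned
        add_nonneg_nonneg[OF mult_nonneg_nonneg[OF credit_nonneg slack_overrun_nonneg] credit_nonneg]
      by (simp add: potential_def)
  next
    case CMY
    show ?thesis using Threshold CMY by (simp add: potential_def)
  qed
qed (simp_all add: potential_def)

text \<open>Since \<open>w \<ge> N0 / 4\<close>, the counter of the lagging player is short by
  \<open>10 * sqrt (\<mu> i * l / N0) * w \<ge> 5 / 2 * sqrt (\<mu> i * N0 * l)\<close>. Times
  \<open>\<theta> i\<close> this is \<open>5 / 2 * l\<close>; the quadratic term takes at most
  \<open>l / 2\<close>, and the remaining \<open>2 * l\<close> cancels the initial value
  \<open>exp (- 2 * l)\<close>.\<close>

lemma lag_total_ge_1: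
  assumes c: "(\<Sum>i<k. c i) = w" and w: "N0 \<le> 4 * w" "w \<le> N0"
    and bad: "\<not> good (mu_hat \<delta> w c)"
  shows "1 \<le> lag_total c"
proof -
  obtain i where i: "i < k" "mu_hat \<delta> w c i < \<mu> i - 10 * sqrt (\<mu> i * l / real N0)"
    using bad by (auto simp: good_def not_le)
  have w0: "0 < w" using w N0 by auto
  have mi: "c i \<le> w" unfolding c[symmetric] using i by (intro member_le_sum) auto
  have "real (c i) / real w \<le> mu_hat \<delta> w c i" using mi w0 \<delta> by (rule mu_hat_ge)
  then have ci: "real (c i) / real w < \<mu> i - 10 * sqrt (\<mu> i * l / real N0)" using i(2) by linarith
  have \<mu>i: "0 \<le> \<mu> i" by simp
  have "0 < \<mu> i - 10 * sqrt (\<mu> i * l / real N0)"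
    using ci by (smt (verit) divide_nonneg_nonneg of_nat_0_le_iff)
  then have \<mu>pos: "0 < \<mu> i" using \<mu>i l_pos N0 by (cases "\<mu> i = 0") auto
  have k2: "k \<noteq> 1"
  proof
    assume "k = 1"
    then have "real (c i) / real w = 1" "\<mu> i \<le> 1" "0 \<le> sqrt (\<mu> i * l / real N0)"
      using i c w0 l_pos pmf_le_1[of p i] by auto
    then show False using ci by linarith
  qed
  have large: "l \<le> \<mu> i * real N0"
  proof (rule ccontr)
    assume "\<not> l \<le> \<mu> i * real N0"
    then have "\<mu> i * (\<mu> i * real N0) \<le> \<mu> i * l" using \<mu>i by (intro mult_left_mono) auto
    then have "(\<mu> i)\<^sup>2 \<le> \<mu> i * l / real N0" using N0 by (simp add: field_simps power2_eq_square)
    then have "\<mu> i \<le> sqrt (\<mu> i * l / real N0)" by (rule real_le_rsqrt)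
    then show False using \<open>0 < \<mu> i - _\<close> \<mu>i by linarith
  qed
  define r where "r = sqrt (\<mu> i * real N0)"
  have r: "0 < r" "r\<^sup>2 = \<mu> i * real N0" using \<mu>pos N0 by (auto simp: r_def)
  define s where "s = sqrt l"
  have s: "0 < s" "s\<^sup>2 = l" using l_pos by (auto simp: s_def)
  have \<theta>: "\<theta> i = s / r" by (simp add: \<theta>_def r_def s_def real_sqrt_divide)
  have \<theta>0: "0 < \<theta> i" using r s by (simp add: \<theta>)
  have \<theta>rs: "\<theta> i * (r * s) = l" using r s by (simp add: \<theta> field_simps power2_eq_square)
  have \<theta>2: "\<mu> i * (\<theta> i)\<^sup>2 * real w \<le> l"
  proof -
    have "\<theta> i * r = s" using r by (simp add: \<theta>)
    then have "(\<theta> i)\<^sup>2 * r\<^sup>2 = l" by (simp only: power_mult_distrib[symmetric] s)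
    then have "\<mu> i * (\<theta> i)\<^sup>2 * real N0 = l" unfolding r(2) by (simp add: mult_ac)
    moreover have "\<mu> i * (\<theta> i)\<^sup>2 * real w \<le> \<mu> i * (\<theta> i)\<^sup>2 * real N0"
      using w \<mu>i by (intro mult_left_mono) auto
    ultimately show ?thesis by simp
  qed
  have "sqrt (\<mu> i * l / real N0) * real N0 = r * s"
  proof -
    have "(sqrt (\<mu> i * l / real N0) * real N0)\<^sup>2 = (r * s)\<^sup>2"
      unfolding power_mult_distrib r(2) s(2) using N0 \<mu>i l_pos by (simp add: power2_eq_square)
    then show ?thesis using r s \<mu>i l_pos by (subst (asm) power2_eq_iff_nonneg) auto
  qed
  moreover have "sqrt (\<mu> i * l / real N0) * real N0 \<le> sqrt (\<mu> i * l / real N0) * (4 * real w)"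
    using w \<mu>i l_pos by (intro mult_left_mono) auto
  ultimately have rs: "r * s \<le> 4 * (sqrt (\<mu> i * l / real N0) * real w)" by simp
  have "real (c i) < (\<mu> i - 10 * sqrt (\<mu> i * l / real N0)) * real w"
    using ci w0 by (simp add: divide_less_eq)
  then have "real (c i) \<le> \<mu> i * real w - 5 / 2 * (r * s)"
    using rs by (simp add: algebra_simps)
  then have "\<theta> i * real (c i) \<le> \<theta> i * (\<mu> i * real w - 5 / 2 * (r * s))"
    using \<theta>0 by (intro mult_left_mono) auto
  also have "\<dots> = \<theta> i * \<mu> i * real w - 5 / 2 * l"
    unfolding right_diff_distrib using \<theta>rs by simp
  finally have "0 \<le> - \<theta> i * real (c i) + \<mu> i * (\<theta> i - (\<theta> i)\<^sup>2 / 2) * real w - 2 * l"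
    using \<theta>2 by (simp add: algebra_simps)
  then have "1 \<le> lag k \<mu> l (\<theta> i) i c" by (simp add: lag_def c)
  also have "\<dots> \<le> (\<Sum>i\<in>{i. i < k \<and> l \<le> \<mu> i * real N0}. lag k \<mu> l (\<theta> i) i c)"
    using i large by (intro member_le_sum) (auto simp: lag_def)
  finally show ?thesis using k2 by (simp add: lag_total_def)
qed

lemma average:
  assumes "\<And>i. i < k \<Longrightarrow> f i \<le> (B :: real)"
  shows "(\<Sum>i<k. \<mu> i * f i) \<le> B"
proof -
  have "(\<Sum>i<k. \<mu> i * f i) \<le> (\<Sum>i<k. \<mu> i * B)"
    using assms by (intro sum_mono mult_left_mono) auto
  then show ?thesis by (simp add: sum_distrib_right[symmetric] sum_\<mu>)
qed

lemma lag_total_step: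
  "(\<Sum>i<k. \<mu> i * lag_total (c(i := c i + 1))) \<le> lag_total c"
proof (cases "k = 1")
  case False
  let ?I = "{i. i < k \<and> l \<le> \<mu> i * real N0}"
  have "(\<Sum>j<k. \<mu> j * lag_total (c(j := c j + 1)))
      = (\<Sum>j<k. \<Sum>i\<in>?I. \<mu> j * lag k \<mu> l (\<theta> i) i (c(j := c j + 1)))"
    using False by (simp add: lag_total_def sum_distrib_left)
  also have "\<dots> = (\<Sum>i\<in>?I. \<Sum>j<k. \<mu> j * lag k \<mu> l (\<theta> i) i (c(j := c j + 1)))"
    by (rule sum.swap)
  also have "\<dots> \<le> (\<Sum>i\<in>?I. lag k \<mu> l (\<theta> i) i c)"
    using sum_\<mu> l_pos by (intro sum_mono lag_step) (auto simp: \<theta>_def)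
  finally show ?thesis using False by (simp add: lag_total_def)
next
  case True
  show ?thesis by (simp add: lag_total_single[OF True])
qed

text \<open>The free \<open>r\<close> serves failures, successes and the first round alike.
  \<open>rank\<close> is asked only while items remain, since \<open>rounds_left\<close> is
  meaningful for positive thresholds.\<close>

lemma potential_end_round:
  assumes "reachable st" "st_round st = Threshold thr q" "i < k"
    and ended: "q \<le> notifications k thr q (counter (receive i thr q st))"
    and after: "after_phase (receive i thr q st) = Learned mh"
    and rank: "threshold st - items (receive i thr q st) \<noteq> 0 \<Longrightarrow> rounds_left k \<delta> N0 (threshold st - items (receive i thr q st)) \<le> r" and r: "0 \<le> r"
  shows "potential (end_round A k \<delta> (receive i thr q st))
    \<le> (if good mh then credit (spent st thr q + 5 * real k) r else 1)"
proof (cases "threshold st \<le> items (receive i thr q st)")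
  case True
  have "5 * real k * J \<le> Bnd" using Bnd k by (simp add: algebra_simps)
  then show ?thesis
    using True messages_receive_le[OF assms(1-3)] credit_nonneg[of "spent st thr q + 5 * real k" r]
      credit_ge_1[of "spent st thr q + 5 * real k" r] r
    by (auto simp: end_round_eq potential_def)
next
  case False
  let ?N = "threshold st - items (receive i thr q st)"
  have "potential (end_round A k \<delta> (receive i thr q st))
    \<le> (if good mh then credit (real (messages (receive i thr q st) + 2 * k)) (rounds_left k \<delta> N0 ?N) else 1)"
    using False potential_start_learned[of ?N mh] phase_ok_end[OF assms(1-4)] after
    by (simp add: end_round_eq)
  also have "\<dots> \<le> (if good mh then credit (spent st thr q + 5 * real k) r else 1)"
    using messages_receive_le[OF assms(1-3)] rank False by (auto intro!: credit_mono)
  finally show ?thesis .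
qed

lemma potential_step_first:
  assumes "reachable st" "st_round st = Threshold thr q" "st_phase st = First_Round" "i < k"
  shows "potential (step A k \<delta> i st)
    \<le> credit (5 * real k) (rounds_left k \<delta> N0 N0) + lag_total ((counter st)(i := counter st i + 1))"
proof -
  let ?st = "receive i thr q st"
  let ?c = "(counter st)(i := counter st i + 1)"
  show ?thesis
  proof (cases "q \<le> notifications k thr q (counter ?st)")
    case False
    then show ?thesis using assms by (simp add: step_Threshold potential_def)
  next
    case True
    define mh where "mh = mu_hat \<delta> (items ?st) ?c"
    have N: "threshold st = N0" "spent st thr q = 0" using assms by (auto simp: reachable_def)
    have "potential (step A k \<delta> i st) = potential (end_round A k \<delta> ?st)"
      using True assms by (simp add: step_Threshold)
    also have "\<dots> \<le> (if threshold st \<le> items ?st \<or> good mh then credit (5 * real k) (rounds_left k \<delta> N0 N0) else 1)"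
    proof (cases "threshold st \<le> items ?st")
      case le: True
      have "real (messages ?st) + 2 * real k \<le> Bnd"
        using messages_receive_le[OF assms(1,2,4)] N Bnd_ge by linarith
      then show ?thesis using le credit_nonneg by (simp add: end_round_eq potential_def)
    next
      case nle: False
      have "potential (end_round A k \<delta> ?st) \<le> (if good mh then credit (spent st thr q + 5 * real k) (rounds_left k \<delta> N0 N0) else 1)"
      proof (rule potential_end_round[OF assms(1,2,4) True])
        show "after_phase ?st = Learned mh" using assms by (simp add: after_phase_def mh_def)
        show "rounds_left k \<delta> N0 (threshold st - items ?st) \<le> rounds_left k \<delta> N0 N0" if "threshold st - items ?st \<noteq> 0"
          using N N0 k \<delta> that by (intro rounds_left_mono) auto
        show "0 \<le> rounds_left k \<delta> N0 N0" using rounds_left_ge_1 order_trans zero_le_one by blast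
      qed
      then show ?thesis using nle N by (cases "good mh") auto
    qed
    also have "\<dots> \<le> credit (5 * real k) (rounds_left k \<delta> N0 N0) + lag_total ?c"
    proof (cases "threshold st \<le> items ?st \<or> good mh")
      case True
      then show ?thesis using lag_total_nonneg by simp
    next
      case False
      have "1 \<le> lag_total ?c"
        using False first_round_items(1)[OF assms(1,2) _ True] assms(3) N
        by (intro lag_total_ge_1[of _ "items ?st"]) (auto simp: items_def mh_def simp del: fun_upd_apply)
      then show ?thesis using False credit_nonneg by (simp add: add_increasing)
    qed
    finally show ?thesis .
  qed
qed

lemma potential_step_learned:
  assumes "reachable st" "st_round st = Threshold thr q" "st_phase st = Learned mh" "i < k" and good: "good mh"
  shows "potential (step A k \<delta> i st)
    \<le> credit (spent st thr q + 5 * real k) (rounds_left k \<delta> N0 (threshold st))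
          * slack_overrun mh (threshold st) ((counter st)(i := counter st i + 1))
      + credit (spent st thr q + 5 * real k) (rounds_left k \<delta> N0 (threshold st) - 1)"
proof -
  let ?st = "receive i thr q st"
  let ?c = "(counter st)(i := counter st i + 1)"
  let ?N = "threshold st"
  have nr: "next_round A k \<delta> (Learned mh) ?N = (Learned mh, Threshold thr q)"
    using assms by (simp add: reachable_def)
  then have act: "4 * k < ?N" "lrn_beta * real k * l < real ?N"
    and lr: "learned_round A k \<delta> mh ?N = Threshold thr q"
    by (auto split: if_splits)
  obtain w n where mh: "mh = mu_hat \<delta> w n" "(\<Sum>i<k. n i) = w" "?N \<le> 3 * w" "?N \<le> N0"
    using assms by (auto simp: reachable_def)
  interpret ar: active_round k ?N N0 w \<delta> n
    by unfold_locales (fact k \<delta> mh act)+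
  show ?thesis
  proof (cases "q \<le> notifications k thr q (counter ?st)")
    case False
    then show ?thesis using assms by (simp add: step_Threshold potential_def)
  next
    case True
    have step: "step A k \<delta> i st = end_round A k \<delta> ?st" using True assms by (simp add: step_Threshold)
    have after: "after_phase ?st = Learned mh" using assms by (simp add: after_phase_def)
    have items: "items ?st = (\<Sum>i<k. ?c i)" by (simp only: items_def receive_simps)
    have q: "1 \<le> q" using next_round_q[OF nr] by simp
    note end_bound = potential_end_round[OF assms(1,2,4) True after]
    show ?thesis
    proof (cases "items ?st \<le> nat \<lfloor>target k \<delta> N0 ?N\<rfloor>")
      case early: True
      \<comment> \<open>The round ended within its target, so some counter has reached its guard;
        \<open>slack_overrun\<close> is then at least 1 and pays for the unchanged rank.\<close>
      have "\<exists>j<k. guard A k \<delta> mh ?N j \<le> real (?c j)"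
      proof (rule ccontr)
        assume "\<not> ?thesis"
        then have "notifications k thr q ?c = 0"
          using lr unfolding mh(1) by (intro ar.no_notification) (auto simp: not_le)
        then show False using True q by simp
      qed
      then have one: "1 \<le> slack_overrun mh ?N ?c"
        using early items unfolding slack_overrun_def by (auto intro!: overrun_ge_1 \<mu> simp del: fun_upd_apply)
      have "potential (end_round A k \<delta> ?st) \<le> credit (spent st thr q + 5 * real k) (rounds_left k \<delta> N0 ?N)"
      proof -
        have "rounds_left k \<delta> N0 (?N - items ?st) \<le> rounds_left k \<delta> N0 ?N" if "?N - items ?st \<noteq> 0"
          using N0 k \<delta> that by (intro rounds_left_mono) auto
        then show ?thesis using end_bound[of "rounds_left k \<delta> N0 ?N"] rounds_left_ge_1[of k \<delta> N0 ?N] good by simp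
      qed
      also have "\<dots> \<le> credit (spent st thr q + 5 * real k) (rounds_left k \<delta> N0 ?N) * slack_overrun mh ?N ?c"
        using mult_left_mono[OF one credit_nonneg] by simp
      finally show ?thesis using step credit_nonneg by (simp add: add_increasing2)
    next
      case late: False
      have "potential (end_round A k \<delta> ?st) \<le> credit (spent st thr q + 5 * real k) (rounds_left k \<delta> N0 ?N - 1)"
      proof -
        have "rounds_left k \<delta> N0 (?N - items ?st) \<le> rounds_left k \<delta> N0 ?N - 1" if "?N - items ?st \<noteq> 0"
        proof (rule ar.rounds_left_drop)
          have "target k \<delta> N0 ?N \<le> real (items ?st)" using late by linarith
          then show "real (?N - items ?st) \<le> real ?N - target k \<delta> N0 ?N" using that by simp
        qed (use that in simp)
        then show ?thesis using end_bound[of "rounds_left k \<delta> N0 ?N - 1"] rounds_left_ge_1[of k \<delta> N0 ?N] good by simp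
      qed
      then show ?thesis using step credit_nonneg slack_overrun_nonneg by (simp add: add_increasing)
    qed
  qed
qed

lemma potential_step_cmy:
  assumes "reachable st" "st_round st = Threshold thr q" "st_phase st = CMY" "i < k"
  shows "potential (step A k \<delta> i st) \<le> potential st"
proof -
  let ?st = "receive i thr q st"
  show ?thesis
  proof (cases "q \<le> notifications k thr q (counter ?st)")
    case False
    then show ?thesis using assms by (simp add: step_Threshold potential_def)
  next
    case True
    have le: "real (messages ?st) + 2 * real k \<le> spent st thr q + 5 * real k"
      by (rule messages_receive_le[OF assms(1,2,4)])
    have items: "threshold st \<le> 4 * items ?st" "4 * k \<le> threshold st"
      using first_round_items[OF assms(1,2) _ True] assms(3) by (auto simp: items_def)
    have "potential (end_round A k \<delta> ?st) \<le> of_bool (Bnd < spent st thr q + cmy_cost k (threshold st))"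
    proof (cases "threshold st \<le> items ?st")
      case True
      then show ?thesis using le cmy_cost_ge[of k "threshold st"]
        by (auto simp: end_round_eq potential_def)
    next
      case False
      have "after_phase ?st = CMY" using assms by (simp add: after_phase_def)
      then have "end_round A k \<delta> ?st = start_round A k \<delta> CMY (threshold st - items ?st) (messages ?st + 2 * k)"
        using False by (simp add: end_round_eq)
      then have "potential (end_round A k \<delta> ?st)
        \<le> of_bool (Bnd < real (messages ?st + 2 * k) + cmy_cost k (threshold st - items ?st))"
        using False by (simp only:) (rule potential_start_cmy, simp)
      also have "\<dots> \<le> of_bool (Bnd < spent st thr q + cmy_cost k (threshold st))"
      proof -
        have "4 * (threshold st - items ?st) \<le> 3 * threshold st" using items(1) by linarith
        from cmy_cost_step[OF k items(2) this] show ?thesis using le by simp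
      qed
      finally show ?thesis .
    qed
    then show ?thesis using assms True by (simp add: step_Threshold potential_def)
  qed
qed

lemma potential_super:
  assumes "reachable st"
  shows "(\<Sum>i<k. \<mu> i * potential (step A k \<delta> i st)) \<le> potential st"
proof (cases "st_round st")
  case Straightforward
  show ?thesis
  proof (rule average)
    fix i assume i: "i < k"
    have "items st < threshold st" using assms Straightforward by (simp add: reachable_def)
    moreover have "items (step A k \<delta> i st) = items st + 1"
      "st_round (step A k \<delta> i st) = (if threshold st \<le> items st + 1 then Terminated else Straightforward)"
      using Straightforward sum_upd[OF i, of "counter st"] by (simp_all add: step_def items_def Let_def)
    moreover have "threshold (step A k \<delta> i st) = threshold st" "messages (step A k \<delta> i st) = messages st + 1"
      using Straightforward by (simp_all add: step_def Let_def)
    ultimately show "potential (step A k \<delta> i st) \<le> potential st"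
      using Straightforward by (simp add: potential_def)
  qed
next
  case Terminated
  then show ?thesis by (intro average) (simp add: step_def)
next
  case (Threshold thr q)
  show ?thesis
  proof (cases "st_phase st")
    case First_Round
    have "(\<Sum>i<k. \<mu> i * potential (step A k \<delta> i st))
      \<le> (\<Sum>i<k. \<mu> i * (credit (5 * real k) (rounds_left k \<delta> N0 N0) + lag_total ((counter st)(i := counter st i + 1))))"
      using potential_step_first[OF assms Threshold First_Round] by (intro sum_mono mult_left_mono) auto
    also have "\<dots> = credit (5 * real k) (rounds_left k \<delta> N0 N0)
        + (\<Sum>i<k. \<mu> i * lag_total ((counter st)(i := counter st i + 1)))"
      by (simp add: distrib_left sum.distrib sum_distrib_right[symmetric] sum_\<mu>)
    also have "\<dots> \<le> potential st"
      using lag_total_step[of "counter st"] Threshold First_Round by (simp add: potential_def)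
    finally show ?thesis .
  next
    case (Learned mh)
    show ?thesis
    proof (cases "good mh")
      case True
      let ?C = "credit (spent st thr q + 5 * real k) (rounds_left k \<delta> N0 (threshold st))"
      let ?D = "credit (spent st thr q + 5 * real k) (rounds_left k \<delta> N0 (threshold st) - 1)"
      let ?o = "\<lambda>i. slack_overrun mh (threshold st) ((counter st)(i := counter st i + 1))"
      have "(\<Sum>i<k. \<mu> i * potential (step A k \<delta> i st)) \<le> (\<Sum>i<k. \<mu> i * (?C * ?o i + ?D))"
        using potential_step_learned[OF assms Threshold Learned _ True] by (intro sum_mono mult_left_mono) auto
      also have "\<dots> = ?C * (\<Sum>i<k. \<mu> i * ?o i) + ?D"
        by (simp add: distrib_left sum.distrib sum_distrib_right[symmetric] sum_\<mu> sum_distrib_left mult.left_commute)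
      also have "\<dots> \<le> ?C * slack_overrun mh (threshold st) (counter st) + ?D"
        unfolding slack_overrun_def
        by (intro add_mono mult_left_mono overrun_step \<mu> sum_\<mu> credit_nonneg order_refl)
      also have "\<dots> = potential st" using Threshold Learned True by (simp add: potential_def)
      finally show ?thesis .
    next
      case False
      show ?thesis
      proof (rule average)
        fix i assume i: "i < k"
        let ?st = "receive i thr q st"
        have one: "potential st = 1" using Threshold Learned False by (simp add: potential_def)
        show "potential (step A k \<delta> i st) \<le> potential st"
        proof (cases "q \<le> notifications k thr q (counter ?st)")
          case True
          have "after_phase ?st = Learned mh" using Learned by (simp add: after_phase_def)
          from potential_end_round[OF assms Threshold i True this, of "max 0 (rounds_left k \<delta> N0 (threshold st - items ?st))"]
          show ?thesis using True one False Threshold by (simp add: step_Threshold)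
        qed (use one Learned Threshold False in \<open>simp add: step_Threshold potential_def\<close>)
      qed
    qed
  next
    case CMY
    then show ?thesis using potential_step_cmy[OF assms Threshold] by (intro average) auto
  qed
qed

lemma potential_ge_1:
  assumes "reachable st" "Bnd < real (messages st)"
  shows "1 \<le> potential st"
proof (cases "st_round st")
  case Straightforward
  then have "items st < threshold st" using assms by (simp add: reachable_def)
  then show ?thesis using Straightforward assms by (simp add: potential_def)
next
  case Terminated
  then show ?thesis using assms by (simp add: potential_def)
next
  case (Threshold thr q)
  have m: "real (messages st) \<le> spent st thr q + 2 * real k"
    by (rule messages_le[OF assms(1) Threshold])
  have B: "5 * real k + 5 * real k * J \<le> Bnd" "0 \<le> 5 * real k * J"
    using Bnd J by (auto simp: algebra_simps)
  show ?thesis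
  proof (cases "st_phase st")
    case First_Round
    then have "spent st thr q = 0" using assms Threshold by (simp add: reachable_def)
    then show ?thesis using m B assms(2) by simp
  next
    case (Learned mh)
    have "1 \<le> credit (spent st thr q + 5 * real k) (rounds_left k \<delta> N0 (threshold st) - 1)"
      using m B assms(2) rounds_left_ge_1[of k \<delta> N0 "threshold st"] by (intro credit_ge_1) auto
    then show ?thesis
      using Threshold Learned credit_nonneg slack_overrun_nonneg by (simp add: potential_def add_increasing)
  next
    case CMY
    then show ?thesis
      using Threshold m assms(2) cmy_cost_ge[of k "threshold st"] by (simp add: potential_def)
  qed
qed

lemma lag_total_0: "lag_total (\<lambda>_. 0) \<le> \<delta> / 2"
proof (cases "k = 1")
  case False
  then have k2: "2 \<le> real k" using k by simp
  have "lag_total (\<lambda>_. 0) = (\<Sum>i\<in>{i. i < k \<and> l \<le> \<mu> i * real N0}. exp (- (2 * l)))"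
    using False by (simp add: lag_total_def lag_def)
  also have "\<dots> \<le> (\<Sum>i<k. exp (- (2 * l)))"
    by (intro sum_mono2) auto
  also have "\<dots> = real k * (exp (- l) * exp (- l))" by (simp add: exp_add[symmetric])
  also have "exp (- l) = \<delta> / real k" using k \<delta> by (simp add: exp_minus)
  also have "real k * (\<delta> / real k * (\<delta> / real k)) = \<delta> * (\<delta> / real k)" using k by simp
  also have "\<dots> \<le> \<delta> * (1 / 2)"
    using \<delta> k2 by (intro mult_left_mono) (auto simp: field_simps)
  finally show ?thesis by simp
next
  case True
  show ?thesis using \<delta> by (simp add: lag_total_single[OF True])
qed

lemma potential_initial:
  "potential (start_round A k \<delta> First_Round N0 0) \<le> credit (5 * real k) (rounds_left k \<delta> N0 N0) + \<delta> / 2"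
proof (cases "N0 < 4 * k")
  case True
  have "real k + real N0 \<le> Bnd" using True Bnd_ge by linarith
  then show ?thesis
    using True \<delta> credit_nonneg[of "5 * real k" "rounds_left k \<delta> N0 N0"]
    by (simp add: start_round_def potential_def straightforward_or_cmy_def items_def)
next
  case False
  then show ?thesis
    using lag_total_0 by (simp add: start_round_def potential_def straightforward_or_cmy_def)
qed

theorem messages_bound:
  assumes "credit (5 * real k) (rounds_left k \<delta> N0 N0) \<le> \<delta> / 2"
  shows "measure (multinomial_arrivals p) {\<omega>. \<forall>m. real (messages (run A k \<delta> N0 \<omega> m)) \<le> Bnd} \<ge> 1 - \<delta>"
proof -
  let ?s = "start_round A k \<delta> First_Round N0 0"
  have "1 - potential ?s \<le> measure (multinomial_arrivals p)
      {\<omega>. \<forall>m. \<not> Bnd < real (messages (drive (step A k \<delta>) ?s \<omega> m))}"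
  proof (rule ville[OF p, where I = reachable])
    show "reachable ?s" using N0 by (intro reachable_start_round) auto
  qed (rule reachable_step potential_nonneg potential_super potential_ge_1; assumption)+
  then show ?thesis
    using potential_initial assms by (simp add: run_eq_drive not_less)
qed

end

section \<open>Choice of the constants\<close>

lemma comm_cost_le_iff:
  "comm_cost A k \<delta> N \<omega> \<le> ereal c \<longleftrightarrow> (\<forall>m. real (messages (run A k \<delta> N \<omega> m)) \<le> c)"
  by (simp add: comm_cost_def SUP_le_iff)

text \<open>As \<open>sd \<le> 199 / 200\<close>, Bernoulli's inequality gives \<open>(1 / sd) ^
  39601 \<ge> 1 + 39601 / 199 = 200 \<ge> 1 / (1 - sd)\<close>, so a success still needed is worth
  at most 39602 rounds. The other 201 rounds contribute \<open>sd\<^sup>2 \<le> \<delta>\<close> and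
  \<open>sd ^ 199 \<le> 1 / 2\<close>.\<close>

lemma credit_initial_le:
  assumes "0 < \<delta>" "\<delta> < 1" "0 \<le> r"
  defines "sd \<equiv> sqrt (99 / 100 * \<delta>)"
  shows "(1 / sd) powr (- (39602 * r + 201)) * (1 / (sd * (1 - sd))) powr r \<le> \<delta> / 2"
proof -
  have sd: "0 < sd" "sd * sd = 99 / 100 * \<delta>" using assms by (auto simp: sd_def)
  have "sd \<le> sqrt ((199 / 200)\<^sup>2)"
    using assms(2) unfolding sd_def by (intro real_sqrt_le_mono) (simp add: power2_eq_square)
  then have sd1: "sd \<le> 199 / 200" by simp
  then have lam: "1 + 1 / 199 \<le> 1 / sd" using sd by (simp add: field_simps)
  have pow: "1 + real n * (1 / 199) \<le> (1 / sd) ^ n" for n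
  proof -
    have "1 + real n * (1 / 199) \<le> (1 + 1 / 199 :: real) ^ n" by (rule Bernoulli_inequality) simp
    also have "\<dots> \<le> (1 / sd) ^ n" using lam by (intro power_mono) auto
    finally show ?thesis .
  qed
  have "1 / (1 - sd) \<le> 200" using sd1 by (simp add: field_simps)
  also have "200 \<le> (1 / sd) ^ 39601" using pow[of 39601] by simp
  finally have "(1 / sd) * (1 / (1 - sd)) \<le> (1 / sd) * (1 / sd) ^ 39601"
    using sd by (intro mult_left_mono) auto
  then have al: "1 / (sd * (1 - sd)) \<le> (1 / sd) powr 39602"
    using sd power_Suc[of "1 / sd" 39601] powr_realpow[of "1 / sd" 39602] by simp
  have "(1 / sd) powr (- (39602 * r + 201)) * (1 / (sd * (1 - sd))) powr r
      \<le> (1 / sd) powr (- (39602 * r + 201)) * ((1 / sd) powr 39602) powr r"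
    using al sd sd1 assms(3) by (intro mult_left_mono powr_mono2) auto
  also have "\<dots> = (1 / sd) powr (- (39602 * r + 201) + 39602 * r)"
    by (simp only: powr_powr powr_add)
  also have "\<dots> = sd powr 201" using sd by (simp add: powr_minus powr_divide)
  also have "\<dots> = sd * sd * sd ^ 199"
  proof -
    have "sd ^ 201 = sd ^ 2 * sd ^ 199" by (simp only: power_add[symmetric]) simp
    then show ?thesis using sd(1) powr_realpow[of sd 201] by (simp add: power2_eq_square)
  qed
  also have "\<dots> \<le> \<delta> * (1 / 2)"
  proof (rule mult_mono)
    have "2 \<le> (1 / sd) ^ 199" using pow[of 199] by simp
    then show "sd ^ 199 \<le> 1 / 2" using sd by (simp add: power_divide field_simps)
  qed (use sd assms in auto)
  finally show ?thesis by simp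
qed

lemma cmy_cost_le:
  assumes "1 \<le> k" "0 < \<delta>" "1 \<le> N" "real N \<le> lrn_beta * real k * ln (real k / \<delta>)"
  shows "cmy_cost k N \<le> real k * (2006 + 20 * loglog (real k / \<delta>))"
proof -
  let ?m = "max 1 (ln (real k / \<delta>))"
  have "real N / real k \<le> lrn_beta * ln (real k / \<delta>)"
    using assms by (simp add: divide_le_eq mult_ac)
  also have "\<dots> \<le> lrn_beta * ?m" using lrn_beta_ge by (intro mult_left_mono) auto
  also have "\<dots> \<le> 100 * ?m" using lrn_beta_le by (intro mult_right_mono) auto
  finally have "max 1 (real N / real k) \<le> 100 * ?m" by (auto simp: max_def)
  then have "ln (max 1 (real N / real k)) \<le> ln (100 * ?m)"
    by (subst ln_le_cancel_iff) (auto simp: less_max_iff_disj)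
  also have "\<dots> = ln 100 + ln ?m" by (subst ln_mult) (auto simp: less_max_iff_disj)
  also have "\<dots> \<le> 100 + loglog (real k / \<delta>)"
    using ln_le_minus_one[of "100 :: real"] ln_max_le_loglog[of "real k / \<delta>"] assms by auto
  finally show ?thesis unfolding cmy_cost_def by (intro mult_left_mono) auto
qed

theorem theorem5p1:
  fixes A :: algorithm
  shows "\<exists>C>0. \<forall>(k::nat) (N::nat) (\<delta>::real) (p :: nat pmf).
           k \<ge> 1 \<longrightarrow> N \<ge> 1 \<longrightarrow> 0 < \<delta> \<longrightarrow> \<delta> < 1 \<longrightarrow> set_pmf p \<subseteq> {..<k} \<longrightarrow>
           \<P>(\<omega> in multinomial_arrivals p.
              comm_cost A k \<delta> N \<omega> \<le>
                ereal (C * (real k * loglog (real N / (real k * ln (real k / \<delta>)))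
                          + real k * loglog (real k / \<delta>))))
           \<ge> 1 - \<delta>"
proof (intro exI[of _ "10 ^ 15"] conjI allI impI)
  fix k N :: nat and \<delta> :: real and p :: "nat pmf"
  assume k: "1 \<le> k" and N: "1 \<le> N" and \<delta>: "0 < \<delta>" "\<delta> < 1" and p: "set_pmf p \<subseteq> {..<k}"
  define LL where "LL = loglog (real N / (real k * ln (real k / \<delta>))) + loglog (real k / \<delta>)"
  define r where "r = 2 * 10 ^ 9 * LL"
  \<comment> \<open>The summand 1 offsets the first round, whose \<open>5 * k\<close> messages the
    initial credit already contains.\<close>
  define J where "J = 1 + (39602 * r + 201)"
  define Bnd where "Bnd = 10 ^ 15 * (real k * LL)"
  have LL: "2 \<le> LL" "loglog (real k / \<delta>) \<le> LL"
    using loglog_ge_1[of "real N / (real k * ln (real k / \<delta>))"] loglog_ge_1[of "real k / \<delta>"]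
    by (auto simp: LL_def)
  \<comment> \<open>The dominant term is \<open>5 * 39602 * 2 * 10 ^ 9 * LL\<close>, below
    \<open>4 * 10 ^ 14 * LL\<close>.\<close>
  have cap: "5 * J + (2006 + 20 * LL) \<le> 10 ^ 15 * LL"
    using LL by (simp add: J_def r_def)
  have cap': "real k * (5 * J + (2006 + 20 * LL)) \<le> Bnd"
    using mult_left_mono[OF cap, of "real k"] by (simp add: Bnd_def mult_ac)
  interpret tracking A k N \<delta> p J Bnd
  proof
    show "0 \<le> J" using LL by (simp add: J_def r_def)
    have "real k * (5 * (J + 1)) \<le> real k * (5 * J + (2006 + 20 * LL))"
      using LL by (intro mult_left_mono) auto
    then show "5 * real k * (J + 1) \<le> Bnd" using cap' by (simp add: mult_ac)
    show "5 * real k * J + cmy_cost k n \<le> Bnd"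
      if "1 \<le> n" "real n \<le> lrn_beta * real k * ln (real k / \<delta>)" for n
    proof -
      have "cmy_cost k n \<le> real k * (2006 + 20 * loglog (real k / \<delta>))"
        by (rule cmy_cost_le[OF k \<delta>(1) that])
      also have "\<dots> \<le> real k * (2006 + 20 * LL)"
        using LL by (intro mult_left_mono) auto
      finally show ?thesis using cap' by (simp add: distrib_left mult_ac)
    qed
  qed (fact k N \<delta> p)+
  have "credit (5 * real k) (rounds_left k \<delta> N N) \<le> credit (5 * real k) r"
    using rounds_left_initial_le[of k \<delta> N] k N \<delta> by (intro credit_mono) (auto simp: r_def LL_def)
  also have "credit (5 * real k) r \<le> \<delta> / 2"
  proof -
    have "5 * real k / (5 * real k) - J = - (39602 * r + 201)" using k by (simp add: J_def)
    moreover have "0 \<le> r" using LL by (simp add: r_def)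
    ultimately show ?thesis using credit_initial_le[OF \<delta>, of r] unfolding credit_def sd_def by simp
  qed
  finally have "1 - \<delta> \<le> measure (multinomial_arrivals p)
      {\<omega>. \<forall>m. real (messages (run A k \<delta> N \<omega> m)) \<le> Bnd}"
    by (rule messages_bound)
  moreover have "Bnd = 10 ^ 15 * (real k * loglog (real N / (real k * ln (real k / \<delta>)))
      + real k * loglog (real k / \<delta>))"
    by (simp add: Bnd_def LL_def distrib_left)
  ultimately show "1 - \<delta> \<le> \<P>(\<omega> in multinomial_arrivals p. comm_cost A k \<delta> N \<omega> \<le>
      ereal (10 ^ 15 * (real k * loglog (real N / (real k * ln (real k / \<delta>)))
        + real k * loglog (real k / \<delta>))))"
    by (simp only: comm_cost_le_iff space_multinomial_arrivals UNIV_I simp_thms)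
qed simp

end
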